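(* Let $\mathcal{X}$ be a compact subset of $\mathbb{R}^d$ with Lipschitz boundary, let the cost $c$ satisfy the Lipschitz cost assumption and $c\in\mathcal{C}^{s+1}(\mathcal{X}\times\mathcal{X})$ for some $s>d/2$, and let $\mu,\nu$ satisfy the ball-mass assumption (see context). Then there exist positive constants $K,C,L$ (only depending on $c$ and $\mathcal{X}$) such that for any $\tau\in(0,1)$, any $\varepsilon\in(0,1]$, and $N$ sufficiently large to satisfy $$\frac{\log(3/\tau)}{\varepsilon^{d/2}\sqrt N}\left(4L\exp(C/\varepsilon)+2\sqrt K\right)\le1,$$ one has with probability at least $1-4\tau$ $$\|T^{B,\varepsilon}_N-T^{C,\varepsilon}_N\|_{\mathrm{HS}}\ \le\ \|t^\varepsilon_N-t^{C,\varepsilon}_N\|_\infty\ \le\ M\,\frac{\varepsilon^{-(d/2+\mathcal{D}_\mu+\mathcal{D}_\nu)}}{\sqrt N}\exp\left(\frac C\varepsilon\right)\log\left(\frac3\tau\right),$$ where $M>0$ is a constant that does not depend on $N,\varepsilon,\tau$.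
   Context: $\mathcal{X}\subset\mathbb{R}^d$ is equipped with the Euclidean metric, also written $d(\cdot,\cdot)$. $\mathcal{P}(\mathcal{X})$ is the set of Borel probability measures, $\mathrm{spt}$ denotes support, $B(x,r)=\{x'\in\mathcal{X}:d(x,x')<r\}$, $\|\cdot\|_{\mathrm{HS}}$ is the Hilbert--Schmidt norm, and $\|\cdot\|_\infty$ is the supremum over $\mathcal{X}\times\mathcal{X}$. Lipschitz cost assumption: $c:\mathcal{X}\times\mathcal{X}\to\mathbb{R}$ is continuous and symmetric, $c\ge0$, $c(x,x)=0$, and there is $\mathrm{Lip}(c)>0$ with $|c(x,y)-c(x',y)|\le\mathrm{Lip}(c)\,d(x,x')$ for all $x,x',y$. Ball-mass assumption: there are constants $C_\mu,\mathcal{D}_\mu,\delta_\mu>0$ with $\mu(B(x,\delta))\ge C_\mu\delta^{\mathcal{D}_\mu}$ for all $\delta\in(0,\delta_\mu]$, $x\in\mathrm{spt}(\mu)$; moreover $C_\mu\le1$ and $\mathcal{D}_\mu\le d$ (the dimension). Analogous constants $C_\nu,\mathcal{D}_\nu,\delta_\nu$ exist for $\nu$. Entropic transport kernel: for $\rho,\sigma\in\mathcal{P}(\mathcal{X})$ and $\varepsilon>0$, $k^\varepsilon_{\rho\sigma}(x,y)=\exp([\alpha(x)+\beta(y)-c(x,y)]/\varepsilon)$ on $\mathcal{X}\times\mathcal{X}$, where $\alpha,\beta\in C(\mathcal{X})$ maximize $\int\alpha\,d\rho+\int\beta\,d\sigma-\varepsilon\int[\exp((\alpha(x)+\beta(y)-c(x,y))/\varepsilon)-1]\,d(\rho\otimes\sigma)(x,y)$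 and satisfy, for all $x,y\in\mathcal{X}$, $\alpha(x)=-\varepsilon\log\int\exp([\beta(y')-c(x,y')]/\varepsilon)\,d\sigma(y')$ and $\beta(y)=-\varepsilon\log\int\exp([\alpha(x')-c(x',y)]/\varepsilon)\,d\rho(x')$. Such pairs exist and $\alpha(x)+\beta(y)$ does not depend on the choice, so $k^\varepsilon_{\rho\sigma}\in C(\mathcal{X}\times\mathcal{X})$ is well defined. Data: $\mu,\nu\in\mathcal{P}(\mathcal{X})$, $\pi$ is a probability measure on $\mathcal{X}\times\mathcal{X}$ with first marginal $\mu$ and second marginal $\nu$; $(x_i,y_i)_{i=1}^N$ are i.i.d. with law $\pi$; $\pi_N=\frac1N\sum_i\delta_{(x_i,y_i)}$, with first and second marginals $\mu_N,\nu_N$. Operators: $t^\varepsilon_N(x,y)=\int k^\varepsilon_{\mu_N\mu_N}(x,x')\,k^\varepsilon_{\nu_N\nu_N}(y',y)\,d\pi_N(x',y')$ and $T^{B,\varepsilon}_N:L^2(\mu)\to L^2(\nu)$, $u\mapsto\int u(x)t^\varepsilon_N(x,\cdot)\,d\mu(x)$. $t^{C,\varepsilon}_N(x,y)=\int k^\varepsilon_{\mu\mu}(x,x')\,k^\varepsilon_{\nu\nu}(y',y)\,d\pi_N(x',y')$ and $T^{C,\varepsilon}_N:L^2(\mu)\to L^2(\nu)$, $u\mapsto\int u(x)t^{C,\varepsilon}_N(x,\cdot)\,d\mu(x)$. *)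

theory Defs
  imports "HOL-Probability.Probability"
begin

section \<open>Domain and regularity\<close>

text \<open>Near every boundary point, \<open>X\<close> is the closed epigraph of a Lipschitz function \<open>g\<close> over the
  hyperplane orthogonal to some unit vector \<open>e\<close>.\<close>

definition lipschitz_boundary :: "'a::euclidean_space set \<Rightarrow> bool" where
  "lipschitz_boundary X \<longleftrightarrow>
     (\<forall>p \<in> frontier X. \<exists>r>0. \<exists>e g L. norm e = 1 \<and> L-lipschitz_on {y. y \<bullet> e = 0} g \<and>
        X \<inter> ball p r = {x \<in> ball p r. g (x - (x \<bullet> e) *\<^sub>R e) \<le> x \<bullet> e})"

primrec Ck_on_open :: "nat \<Rightarrow> 'e::real_normed_vector set \<Rightarrow> ('e \<Rightarrow> real) \<Rightarrow> bool" where
  "Ck_on_open 0 U f \<longleftrightarrow> continuous_on U f"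
| "Ck_on_open (Suc k) U f \<longleftrightarrow>
     (\<exists>f'. (\<forall>x\<in>U. (f has_derivative f' x) (at x)) \<and> (\<forall>v. Ck_on_open k U (\<lambda>x. f' x v)))"

text \<open>\<open>C\<^sup>k\<close> on a compact set: restrictions of \<open>C\<^sup>k\<close> functions on an open neighbourhood. For a
  compact set with Lipschitz boundary this is the same, by Whitney's extension theorem, as asking
  that all partial derivatives of order at most \<open>k\<close> on the interior extend continuously to the set.\<close>

definition Ck_on :: "nat \<Rightarrow> 'e::real_normed_vector set \<Rightarrow> ('e \<Rightarrow> real) \<Rightarrow> bool" where
  "Ck_on k S f \<longleftrightarrow> (\<exists>U g. open U \<and> S \<subseteq> U \<and> Ck_on_open k U g \<and> (\<forall>x\<in>S. g x = f x))"

definition lipschitz_cost :: "'a::euclidean_space set \<Rightarrow> ('a \<Rightarrow> 'a \<Rightarrow> real) \<Rightarrow> bool" where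
  "lipschitz_cost X c \<longleftrightarrow>
     continuous_on (X \<times> X) (\<lambda>(x, y). c x y) \<and>
     (\<forall>x\<in>X. \<forall>y\<in>X. c x y = c y x) \<and>
     (\<forall>x\<in>X. \<forall>y\<in>X. 0 \<le> c x y) \<and>
     (\<forall>x\<in>X. c x x = 0) \<and>
     (\<exists>Lip>0. \<forall>x\<in>X. \<forall>x'\<in>X. \<forall>y\<in>X. \<bar>c x y - c x' y\<bar> \<le> Lip * dist x x')"


section \<open>Probability measures on the domain\<close>

text \<open>Measures in \<open>\<P>(X)\<close> have underlying space \<open>X\<close>, so functions are only ever
  integrated over \<open>X\<close> and their values elsewhere are irrelevant.\<close>

abbreviation borel_on :: "'a::topological_space set \<Rightarrow> 'a measure" where
  "borel_on X \<equiv> restrict_space borel X"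

abbreviation prob_measures_on :: "'a::topological_space set \<Rightarrow> 'a measure set" where
  "prob_measures_on X \<equiv> space (prob_algebra (borel_on X))"

definition spt :: "'a::topological_space measure \<Rightarrow> 'a set" where
  "spt \<mu> = {x \<in> space \<mu>. \<forall>U. open U \<longrightarrow> x \<in> U \<longrightarrow> measure \<mu> (U \<inter> space \<mu>) > 0}"

definition ball_mass :: "'a::euclidean_space measure \<Rightarrow> real \<Rightarrow> real \<Rightarrow> real \<Rightarrow> bool" where
  "ball_mass \<mu> Cm Dm \<delta>m \<longleftrightarrow>
     0 < Cm \<and> Cm \<le> 1 \<and> 0 < Dm \<and> Dm \<le> real DIM('a) \<and> 0 < \<delta>m \<and>
     (\<forall>\<delta> x. 0 < \<delta> \<and> \<delta> \<le> \<delta>m \<and> x \<in> spt \<mu> \<longrightarrow> measure \<mu> (space \<mu> \<inter> ball x \<delta>) \<ge> Cm * \<delta> powr Dm)"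

definition is_coupling ::
  "'a::topological_space set \<Rightarrow> 'a measure \<Rightarrow> 'a measure \<Rightarrow> ('a \<times> 'a) measure \<Rightarrow> bool" where
  "is_coupling X \<mu> \<nu> \<pi> \<longleftrightarrow>
     \<pi> \<in> space (prob_algebra (borel_on X \<Otimes>\<^sub>M borel_on X)) \<and>
     distr \<pi> (borel_on X) fst = \<mu> \<and> distr \<pi> (borel_on X) snd = \<nu>"

text \<open>\<open>(1/N) \<Sum>\<^sub>i \<delta>\<^bsub>z\<^sub>i\<^esub>\<close> as the image of the uniform distribution on the
  indices; only meaningful for \<open>N > 0\<close>.\<close>

definition empirical :: "'a::topological_space set \<Rightarrow> nat \<Rightarrow> (nat \<Rightarrow> 'a \<times> 'a) \<Rightarrow> ('a \<times> 'a) measure" where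
  "empirical X N z = distr (uniform_count_measure {..<N}) (borel_on X \<Otimes>\<^sub>M borel_on X) z"


section \<open>Entropic transport kernels\<close>

definition eot_dual ::
  "('a \<Rightarrow> 'a \<Rightarrow> real) \<Rightarrow> real \<Rightarrow> 'a measure \<Rightarrow> 'a measure \<Rightarrow> ('a \<Rightarrow> real) \<Rightarrow> ('a \<Rightarrow> real) \<Rightarrow> real" where
  "eot_dual c \<epsilon> \<rho> \<sigma> \<alpha> \<beta> =
     (LINT x|\<rho>. \<alpha> x) + (LINT y|\<sigma>. \<beta> y)
       - \<epsilon> * (LINT (x, y)|(\<rho> \<Otimes>\<^sub>M \<sigma>). exp ((\<alpha> x + \<beta> y - c x y) / \<epsilon>) - 1)"

definition eot_potentials ::
  "'a::euclidean_space set \<Rightarrow> ('a \<Rightarrow> 'a \<Rightarrow> real) \<Rightarrow> real \<Rightarrow> 'a measure \<Rightarrow> 'a measure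
     \<Rightarrow> ('a \<Rightarrow> real) \<Rightarrow> ('a \<Rightarrow> real) \<Rightarrow> bool" where
  "eot_potentials X c \<epsilon> \<rho> \<sigma> \<alpha> \<beta> \<longleftrightarrow>
     continuous_on X \<alpha> \<and> continuous_on X \<beta> \<and>
     (\<forall>a b. continuous_on X a \<longrightarrow> continuous_on X b \<longrightarrow> eot_dual c \<epsilon> \<rho> \<sigma> a b \<le> eot_dual c \<epsilon> \<rho> \<sigma> \<alpha> \<beta>) \<and>
     (\<forall>x\<in>X. \<alpha> x = - \<epsilon> * ln (LINT y|\<sigma>. exp ((\<beta> y - c x y) / \<epsilon>))) \<and>
     (\<forall>y\<in>X. \<beta> y = - \<epsilon> * ln (LINT x|\<rho>. exp ((\<alpha> x - c x y) / \<epsilon>)))"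

text \<open>On \<open>X \<times> X\<close> the value does not depend on the chosen pair of potentials.\<close>

definition eot_kernel ::
  "'a::euclidean_space set \<Rightarrow> ('a \<Rightarrow> 'a \<Rightarrow> real) \<Rightarrow> real \<Rightarrow> 'a measure \<Rightarrow> 'a measure
     \<Rightarrow> 'a \<Rightarrow> 'a \<Rightarrow> real" where
  "eot_kernel X c \<epsilon> \<rho> \<sigma> x y =
     (let (\<alpha>, \<beta>) = (SOME (\<alpha>, \<beta>). eot_potentials X c \<epsilon> \<rho> \<sigma> \<alpha> \<beta>)
      in exp ((\<alpha> x + \<beta> y - c x y) / \<epsilon>))"

definition t_B ::
  "'a::euclidean_space set \<Rightarrow> ('a \<Rightarrow> 'a \<Rightarrow> real) \<Rightarrow> real \<Rightarrow> nat \<Rightarrow> (nat \<Rightarrow> 'a \<times> 'a)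
     \<Rightarrow> 'a \<Rightarrow> 'a \<Rightarrow> real" where
  "t_B X c \<epsilon> N z x y =
     (let \<pi>N = empirical X N z;
          \<mu>N = distr \<pi>N (borel_on X) fst;
          \<nu>N = distr \<pi>N (borel_on X) snd
      in LINT (x', y')|\<pi>N. eot_kernel X c \<epsilon> \<mu>N \<mu>N x x' * eot_kernel X c \<epsilon> \<nu>N \<nu>N y' y)"

definition t_C ::
  "'a::euclidean_space set \<Rightarrow> ('a \<Rightarrow> 'a \<Rightarrow> real) \<Rightarrow> 'a measure \<Rightarrow> 'a measure \<Rightarrow> real \<Rightarrow> nat
     \<Rightarrow> (nat \<Rightarrow> 'a \<times> 'a) \<Rightarrow> 'a \<Rightarrow> 'a \<Rightarrow> real" where
  "t_C X c \<mu> \<nu> \<epsilon> N z x y =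
     (LINT (x', y')|empirical X N z. eot_kernel X c \<epsilon> \<mu> \<mu> x x' * eot_kernel X c \<epsilon> \<nu> \<nu> y' y)"

definition kernel_op :: "'a measure \<Rightarrow> ('a \<Rightarrow> 'a \<Rightarrow> real) \<Rightarrow> ('a \<Rightarrow> real) \<Rightarrow> 'a \<Rightarrow> real" where
  "kernel_op \<mu> t u = (\<lambda>y. LINT x|\<mu>. u x * t x y)"


section \<open>Hilbert--Schmidt norm of operators between \<open>L\<^sup>2\<close> spaces\<close>

text \<open>Elements of \<open>L\<^sup>2\<close> are represented by square-integrable functions; orthonormality excludes
  that two representatives of the same class both belong to a basis.\<close>

definition L2 :: "'a measure \<Rightarrow> ('a \<Rightarrow> real) set" where
  "L2 M = {f \<in> borel_measurable M. integrable M (\<lambda>x. (f x)\<^sup>2)}"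

definition L2_orthonormal_basis :: "'a measure \<Rightarrow> ('a \<Rightarrow> real) set \<Rightarrow> bool" where
  "L2_orthonormal_basis M E \<longleftrightarrow>
     E \<subseteq> L2 M \<and>
     (\<forall>e\<in>E. \<forall>f\<in>E. (LINT x|M. e x * f x) = (if e = f then 1 else 0)) \<and>
     (\<forall>f\<in>L2 M. (\<forall>e\<in>E. (LINT x|M. f x * e x) = 0) \<longrightarrow> (AE x in M. f x = 0))"

definition ennreal_sqrt :: "ennreal \<Rightarrow> ennreal" where
  "ennreal_sqrt a = (if a = \<top> then \<top> else ennreal (sqrt (enn2real a)))"

text \<open>\<open>(\<Sum>\<^sub>e \<parallel>T e\<parallel>\<^sup>2)\<^sup>1\<^sup>/\<^sup>2\<close> over an orthonormal basis of \<open>L\<^sup>2(\<mu>)\<close>, with norms in \<open>L\<^sup>2(\<nu>)\<close>; it is \<open>\<infinity>\<close>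
  if \<open>T\<close> is not Hilbert--Schmidt. The value does not depend on the chosen basis.\<close>

definition hs_norm :: "'a measure \<Rightarrow> 'b measure \<Rightarrow> (('a \<Rightarrow> real) \<Rightarrow> 'b \<Rightarrow> real) \<Rightarrow> ennreal" where
  "hs_norm \<mu> \<nu> T =
     ennreal_sqrt (\<Sum>\<^sub>\<infinity> e \<in> (SOME E. L2_orthonormal_basis \<mu> E). \<integral>\<^sup>+ y. ennreal ((T e y)\<^sup>2) \<partial>\<nu>)"

definition sup_norm_on :: "'a set \<Rightarrow> ('a \<Rightarrow> 'a \<Rightarrow> real) \<Rightarrow> ennreal" where
  "sup_norm_on X f = (SUP (x, y) \<in> X \<times> X. ennreal \<bar>f x y\<bar>)"

end

theory Submission
  imports Defs
begin

text \<open>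
  Put \<open>G = exp (- c / \<epsilon>)\<close>. On the compact domain \<open>g \<le> G \<le> 1\<close> with \<open>g = exp (- B / \<epsilon>)\<close>, where
  \<open>B\<close> bounds the cost. For the transport of a measure \<open>\<rho>\<close> to itself the two potentials of an
  optimal pair differ by a constant (\<open>symmetrize_pair\<close>), so the kernel is
  \<open>k(x, y) = G(x, y) w(x) w(y)\<close>, where the positive continuous function \<open>w\<close> solves
  \<open>w(x) \<integral> G(x, y) w(y) d\<rho>(y) = 1\<close>. Such a \<open>w\<close> is called a scaling of \<open>\<rho>\<close> below, and the theorem
  becomes a question about how the scaling depends on the measure.

  Stability. Let \<open>w\<close> and \<open>v\<close> be the scalings of \<open>\<rho>\<close> and \<open>\<sigma>\<close>. The quotient \<open>u = v / w\<close> satisfies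
  \<open>1 / u = s \<cdot> P u\<close>, where \<open>P\<close> is a Markov average and \<open>s(x) = w(x) \<integral> G(x, y) w(y) d\<sigma>(y)\<close> is close
  to \<open>1\<close> when \<open>\<sigma>\<close> is close to \<open>\<rho>\<close>. Since \<open>g \<le> G \<le> 1\<close>, all the averages \<open>P(x, \<cdot>)\<close> share a common part
  of mass \<open>g\<close>, so \<open>P\<close> shrinks oscillations by the factor \<open>1 - g\<close> (\<open>doeblin_averaging\<close>). This forces
  \<open>\<bar>v - w\<bar> \<le> 3 \<eta> / g ^ 5\<close> with \<open>\<eta> = sup\<^sub>x \<bar>\<integral> G(x, y) w(y) d(\<sigma> - \<rho>)(y)\<bar>\<close> (\<open>scaling_stability\<close>). The same
  contraction makes products of consecutive Sinkhorn iterates converge (\<open>sinkhorn_converges\<close>), which gives existence of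
  scalings, while the case \<open>\<sigma> = \<rho>\<close> of stability gives uniqueness. Together with the inequality
  \<open>1 + t \<le> exp t\<close>, which shows that the logarithm of a scaling is optimal for the dual problem, this
  identifies the transport kernel (\<open>eot_kernel_eq\<close>).

  Concentration. For \<open>\<rho> = \<mu>\<close> and \<open>\<sigma> = \<mu>\<^sub>N\<close> the quantity \<open>\<eta>\<close> is the supremum over \<open>x\<close> of the deviation
  of an empirical mean of \<open>y \<mapsto> G(x, y) w(y)\<close>, where \<open>w\<close> is now a fixed function. This family is bounded
  and Lipschitz in the finite-dimensional parameter \<open>x\<close>, so chaining along nets of geometrically
  growing size, with Hoeffding's inequality for each link, bounds the supremum by a multiple of
  \<open>ln (3 / \<tau>) / sqrt N\<close> with probability at least \<open>1 - \<tau>\<close> (\<open>uniform_deviation\<close>).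

  Conclusion. On the intersection of the two good events, for \<open>\<mu>\<close> and for \<open>\<nu>\<close>, the kernels of the two
  operators differ by at most \<open>12 \<eta> / g ^ 8\<close> (\<open>t_B_t_C_close\<close>). All powers of \<open>1 / g\<close> and \<open>1 / \<epsilon>\<close> are
  absorbed in \<open>exp (C / \<epsilon>)\<close>, and the power of \<open>\<epsilon>\<close> in the claim is at least \<open>1\<close> because \<open>\<epsilon> \<le> 1\<close>.
  The Hilbert--Schmidt norm is bounded by the supremum norm of the kernel through Bessel's inequality
  in an orthonormal basis (\<open>hs_norm_kernel_le\<close>). Finally, the event must be shown to be
  measurable: the supremum of a continuous function can be taken over a countable dense set, and at
  each point the empirical transport kernel is a limit of products of Sinkhorn iterates, which are explicit
  measurable functions of the sample.
\<close>

section \<open>Integration against probability measures on the domain\<close>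

lemma prob_measures_onD:
  assumes "\<rho> \<in> prob_measures_on X"
  shows "prob_space \<rho>" "sets \<rho> = sets (borel_on X)" "space \<rho> = X"
  using assms sets_eq_imp_space_eq[of \<rho> "borel_on X"]
  by (auto simp: space_prob_algebra space_restrict_space)

lemma integrable_bounded_on:
  fixes f :: "'a::topological_space \<Rightarrow> real"
  assumes "\<rho> \<in> prob_measures_on X" "f \<in> borel_measurable (borel_on X)" "\<And>x. x \<in> X \<Longrightarrow> \<bar>f x\<bar> \<le> B"
  shows "integrable \<rho> f"
proof -
  interpret prob_space \<rho> by (rule prob_measures_onD[OF assms(1)])
  show ?thesis
  proof (rule integrable_const_bound[where B = B])
    show "AE x in \<rho>. norm (f x) \<le> B"
      using assms(3) prob_measures_onD(3)[OF assms(1)] by (intro AE_I2) auto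
    show "f \<in> borel_measurable \<rho>"
      using assms(2) measurable_cong_sets[OF prob_measures_onD(2)[OF assms(1)] refl, of borel] by blast
  qed
qed

lemma integrable_continuous_on:
  fixes f :: "'a::topological_space \<Rightarrow> real"
  assumes "\<rho> \<in> prob_measures_on X" "compact X" "continuous_on X f"
  shows "integrable \<rho> f"
proof -
  have "bounded (f ` X)"
    using assms compact_continuous_image compact_imp_bounded by blast
  then obtain B where "\<And>x. x \<in> X \<Longrightarrow> \<bar>f x\<bar> \<le> B"
    by (auto simp: bounded_iff)
  then show ?thesis
    by (rule integrable_bounded_on[OF assms(1) borel_measurable_continuous_on_restrict[OF assms(3)]])
qed

lemma integral_bounds_on:
  fixes f :: "'a::topological_space \<Rightarrow> real"
  assumes "\<rho> \<in> prob_measures_on X" "integrable \<rho> f" "\<And>x. x \<in> X \<Longrightarrow> m \<le> f x" "\<And>x. x \<in> X \<Longrightarrow> f x \<le> M"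
  shows "m \<le> integral\<^sup>L \<rho> f" "integral\<^sup>L \<rho> f \<le> M"
proof -
  interpret prob_space \<rho> by (rule prob_measures_onD[OF assms(1)])
  show "m \<le> integral\<^sup>L \<rho> f" "integral\<^sup>L \<rho> f \<le> M"
    using assms prob_measures_onD[OF assms(1)]
    by (auto intro!: integral_ge_const integral_le_const)
qed

lemma integral_mono_on_space:
  fixes f h :: "'a::topological_space \<Rightarrow> real"
  assumes "\<rho> \<in> prob_measures_on X" "integrable \<rho> f" "integrable \<rho> h" "\<And>x. x \<in> X \<Longrightarrow> f x \<le> h x"
  shows "integral\<^sup>L \<rho> f \<le> integral\<^sup>L \<rho> h"
  using assms prob_measures_onD[OF assms(1)] by (auto intro!: integral_mono)

text \<open>The product of the two Borel \<open>\<sigma>\<close>-algebras on \<open>X\<close> is the Borel \<open>\<sigma>\<close>-algebra of \<open>X \<times> X\<close> because the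
  topology is second countable, and so continuity on the square suffices.\<close>
lemma measurable_continuous_on_Times:
  fixes f :: "'a::second_countable_topology \<times> 'a \<Rightarrow> real"
  assumes "continuous_on (X \<times> X) f"
  shows "f \<in> borel_measurable (borel_on X \<Otimes>\<^sub>M borel_on X)"
proof -
  have i: "(\<lambda>x. x) \<in> measurable (borel_on X) borel"
    by (rule measurable_restrict_space1[OF measurable_ident_sets[OF refl]])
  have "(\<lambda>p. (fst p, snd p)) \<in> measurable (borel_on X \<Otimes>\<^sub>M borel_on X) (borel \<Otimes>\<^sub>M borel)"
    by (intro measurable_Pair measurable_compose[OF measurable_fst i] measurable_compose[OF measurable_snd i])
  then have "(\<lambda>p. p) \<in> measurable (borel_on X \<Otimes>\<^sub>M borel_on X) (restrict_space borel (X \<times> X))"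
    by (intro measurable_restrict_space2) (auto simp: borel_prod space_pair_measure space_restrict_space)
  from measurable_compose[OF this borel_measurable_continuous_on_restrict[OF assms]]
  show ?thesis .
qed

lemma integrable_continuous_on_Times:
  fixes f :: "'a::second_countable_topology \<times> 'a \<Rightarrow> real"
  assumes rho: "\<rho> \<in> prob_measures_on X" and sig: "\<sigma> \<in> prob_measures_on X" and "compact X"
    and f: "continuous_on (X \<times> X) f"
  shows "integrable (\<rho> \<Otimes>\<^sub>M \<sigma>) f"
proof -
  interpret r: prob_space \<rho> by (rule prob_measures_onD(1)[OF rho])
  interpret s: prob_space \<sigma> by (rule prob_measures_onD(1)[OF sig])
  interpret pair_prob_space \<rho> \<sigma> ..
  have "bounded (f ` (X \<times> X))"
    using assms by (intro compact_imp_bounded compact_continuous_image compact_Times)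
  then obtain B where B: "\<And>p. p \<in> X \<times> X \<Longrightarrow> \<bar>f p\<bar> \<le> B"
    by (auto simp: bounded_iff)
  have "sets (\<rho> \<Otimes>\<^sub>M \<sigma>) = sets (borel_on X \<Otimes>\<^sub>M borel_on X)"
    using prob_measures_onD(2)[OF rho] prob_measures_onD(2)[OF sig] by (rule sets_pair_measure_cong)
  then have "f \<in> borel_measurable (\<rho> \<Otimes>\<^sub>M \<sigma>)"
    using measurable_continuous_on_Times[OF f] by (simp add: measurable_cong_sets[of "\<rho> \<Otimes>\<^sub>M \<sigma>"])
  moreover have "space (\<rho> \<Otimes>\<^sub>M \<sigma>) = X \<times> X"
    using prob_measures_onD(3)[OF rho] prob_measures_onD(3)[OF sig] by (simp add: space_pair_measure)
  ultimately show ?thesis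
    using B by (intro integrable_const_bound[where B = B]) auto
qed

section \<open>Symmetric Gibbs kernels and their scalings\<close>

text \<open>This describes \<open>exp (- c / \<epsilon>)\<close> by its bounds, its symmetry and its Lipschitz constant; all estimates
  below are explicit in \<open>g\<close>, which is exponentially small in \<open>1 / \<epsilon>\<close>.\<close>
locale gibbs_kernel =
  fixes X :: "'a::euclidean_space set" and G :: "'a \<Rightarrow> 'a \<Rightarrow> real" and g \<Lambda> :: real
  assumes compact: "compact X" and nonempty: "X \<noteq> {}"
    and g_pos: "0 < g"
    and G_ge: "\<And>x y. x \<in> X \<Longrightarrow> y \<in> X \<Longrightarrow> g \<le> G x y"
    and G_le: "\<And>x y. x \<in> X \<Longrightarrow> y \<in> X \<Longrightarrow> G x y \<le> 1"
    and G_sym: "\<And>x y. x \<in> X \<Longrightarrow> y \<in> X \<Longrightarrow> G x y = G y x"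
    and G_lip: "\<And>x x' y. x \<in> X \<Longrightarrow> x' \<in> X \<Longrightarrow> y \<in> X \<Longrightarrow> \<bar>G x y - G x' y\<bar> \<le> \<Lambda> * dist x x'"
    and Lip_nonneg: "0 \<le> \<Lambda>"
begin

lemma g_le_1: "g \<le> 1"
proof -
  obtain x where "x \<in> X" using nonempty by auto
  then show ?thesis using G_ge[of x x] G_le[of x x] by linarith
qed

lemma G_pos: "x \<in> X \<Longrightarrow> y \<in> X \<Longrightarrow> 0 < G x y"
  using G_ge g_pos by force

lemma G_continuous1: "y \<in> X \<Longrightarrow> continuous_on X (\<lambda>x. G x y)"
  using G_lip Lip_nonneg
  by (intro lipschitz_on_continuous_on[of \<Lambda>] lipschitz_onI) (auto simp: dist_real_def)

lemma G_continuous2: "x \<in> X \<Longrightarrow> continuous_on X (\<lambda>y. G x y)"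
  using G_continuous1[of x] G_sym[of x] by (simp cong: continuous_on_cong)

definition gibbs_op :: "'a measure \<Rightarrow> ('a \<Rightarrow> real) \<Rightarrow> 'a \<Rightarrow> real" where
  "gibbs_op \<rho> f x = (LINT y|\<rho>. G x y * f y)"

definition pos_cont :: "('a \<Rightarrow> real) \<Rightarrow> bool" where
  "pos_cont f \<longleftrightarrow> continuous_on X f \<and> (\<forall>x\<in>X. 0 < f x)"

lemma attains_bounds:
  fixes f :: "'a \<Rightarrow> real"
  assumes "continuous_on X f"
  obtains a b where "a \<in> X" "b \<in> X" "\<And>x. x \<in> X \<Longrightarrow> f a \<le> f x" "\<And>x. x \<in> X \<Longrightarrow> f x \<le> f b"
  using continuous_attains_inf[OF compact nonempty assms]
    continuous_attains_sup[OF compact nonempty assms] by metis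

lemma integrable_G_mult:
  assumes "\<rho> \<in> prob_measures_on X" "continuous_on X f" "x \<in> X"
  shows "integrable \<rho> (\<lambda>y. G x y * f y)"
  by (intro integrable_continuous_on[OF assms(1) compact] continuous_intros assms G_continuous2)

text \<open>The Lipschitz bound on \<open>G\<close> passes to the integral, so merely bounded measurable functions are
  mapped to continuous ones. This is what makes pointwise limits of Sinkhorn iterates continuous.\<close>
lemma gibbs_op_continuous:
  assumes rho: "\<rho> \<in> prob_measures_on X"
    and f: "f \<in> borel_measurable (borel_on X)" "\<And>x. x \<in> X \<Longrightarrow> \<bar>f x\<bar> \<le> B"
  shows "continuous_on X (gibbs_op \<rho> f)"
proof -
  have B0: "0 \<le> B" using f(2) nonempty by (meson abs_ge_zero ex_in_conv order_trans)
  have int: "integrable \<rho> (\<lambda>y. G x y * f y)" if "x \<in> X" for x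
  proof (rule integrable_bounded_on[OF rho, where B = B])
    have "G x \<in> borel_measurable (borel_on X)"
      using G_continuous2[OF that] by (intro borel_measurable_continuous_on_restrict)
    then show "(\<lambda>y. G x y * f y) \<in> borel_measurable (borel_on X)"
      using f(1) by measurable
    show "\<bar>G x y * f y\<bar> \<le> B" if "y \<in> X" for y
    proof -
      have "\<bar>G x y\<bar> * \<bar>f y\<bar> \<le> 1 * B"
        using G_pos[OF \<open>x \<in> X\<close> that] G_le[OF \<open>x \<in> X\<close> that] f(2)[OF that]
        by (intro mult_mono) auto
      then show ?thesis by (simp add: abs_mult)
    qed
  qed
  have "(\<Lambda> * B)-lipschitz_on X (gibbs_op \<rho> f)"
  proof (rule lipschitz_onI)
    fix x x' assume x: "x \<in> X" "x' \<in> X"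
    have "gibbs_op \<rho> f x - gibbs_op \<rho> f x' = (LINT y|\<rho>. G x y * f y - G x' y * f y)"
      unfolding gibbs_op_def using int x by simp
    moreover have "\<bar>G x y * f y - G x' y * f y\<bar> \<le> \<Lambda> * B * dist x x'" if "y \<in> X" for y
    proof -
      have "\<bar>G x y - G x' y\<bar> * \<bar>f y\<bar> \<le> (\<Lambda> * dist x x') * B"
        using G_lip[OF x that] f(2)[OF that] B0 Lip_nonneg by (intro mult_mono) auto
      moreover have "G x y * f y - G x' y * f y = (G x y - G x' y) * f y" by (simp add: algebra_simps)
      ultimately show ?thesis by (simp only: abs_mult) (simp add: ac_simps)
    qed
    then have "- (\<Lambda> * B * dist x x') \<le> G x y * f y - G x' y * f y"
      "G x y * f y - G x' y * f y \<le> \<Lambda> * B * dist x x'" if "y \<in> X" for y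
      using abs_le_D1[of "G x y * f y - G x' y * f y"] abs_le_D2[of "G x y * f y - G x' y * f y"] that by fastforce+
    then have "- (\<Lambda> * B * dist x x') \<le> (LINT y|\<rho>. G x y * f y - G x' y * f y)"
      "(LINT y|\<rho>. G x y * f y - G x' y * f y) \<le> \<Lambda> * B * dist x x'"
      using int x by (intro integral_bounds_on[OF rho] Bochner_Integration.integrable_diff; blast)+
    ultimately show "dist (gibbs_op \<rho> f x) (gibbs_op \<rho> f x') \<le> \<Lambda> * B * dist x x'"
      by (simp add: dist_real_def abs_le_iff)
  qed (use B0 Lip_nonneg in simp)
  then show ?thesis by (rule lipschitz_on_continuous_on)
qed

lemma gibbs_op_bounds:
  assumes rho: "\<rho> \<in> prob_measures_on X" and f: "pos_cont f" and x: "x \<in> X"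
  shows "g * integral\<^sup>L \<rho> f \<le> gibbs_op \<rho> f x" "gibbs_op \<rho> f x \<le> integral\<^sup>L \<rho> f" "0 < integral\<^sup>L \<rho> f"
proof -
  have fc: "continuous_on X f" and fpos: "\<And>x. x \<in> X \<Longrightarrow> 0 < f x"
    using f by (auto simp: pos_cont_def)
  note int = integrable_continuous_on[OF rho compact fc]
  have "(LINT y|\<rho>. g * f y) \<le> gibbs_op \<rho> f x"
    unfolding gibbs_op_def using G_ge[OF x] fpos
    by (intro integral_mono_on_space[OF rho]) (auto intro: integrable_G_mult[OF rho fc x] int less_imp_le)
  then show "g * integral\<^sup>L \<rho> f \<le> gibbs_op \<rho> f x" by simp
  show "gibbs_op \<rho> f x \<le> integral\<^sup>L \<rho> f"
    unfolding gibbs_op_def using G_le[OF x] fpos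
    by (intro integral_mono_on_space[OF rho])
      (auto intro!: integrable_G_mult[OF rho fc x] int mult_left_le_one_le less_imp_le[OF G_pos] x less_imp_le)
  obtain a b where ab: "a \<in> X" "\<And>x. x \<in> X \<Longrightarrow> f a \<le> f x" "\<And>x. x \<in> X \<Longrightarrow> f x \<le> f b"
    using attains_bounds[OF fc] by metis
  have "f a \<le> integral\<^sup>L \<rho> f" using ab by (intro integral_bounds_on(1)[OF rho int]) auto
  with fpos[OF ab(1)] show "0 < integral\<^sup>L \<rho> f" by linarith
qed

lemma gibbs_op_pos_cont:
  assumes rho: "\<rho> \<in> prob_measures_on X" and f: "pos_cont f"
  shows "pos_cont (gibbs_op \<rho> f)"
proof -
  have fc: "continuous_on X f" using f by (auto simp: pos_cont_def)
  obtain B where "\<And>x. x \<in> X \<Longrightarrow> \<bar>f x\<bar> \<le> B"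
    using compact_imp_bounded[OF compact_continuous_image[OF fc compact]] by (auto simp: bounded_iff)
  then have "continuous_on X (gibbs_op \<rho> f)"
    by (rule gibbs_op_continuous[OF rho borel_measurable_continuous_on_restrict[OF fc]])
  moreover have "0 < gibbs_op \<rho> f x" if "x \<in> X" for x
    using gibbs_op_bounds[OF rho f that] g_pos by (meson less_le_trans mult_pos_pos)
  ultimately show ?thesis by (auto simp: pos_cont_def)
qed

text \<open>The averages \<open>r \<mapsto> \<integral> G(x, y) b(y) r(y) d\<rho>(y) / \<integral> G(x, y) b(y) d\<rho>(y)\<close>, one for each \<open>x\<close>, all have
  a density of at least \<open>g\<close> with respect to the probability measure proportional to \<open>b \<rho>\<close>. The mean \<open>p\<close>
  of \<open>r\<close> under that measure therefore enters each average with weight \<open>g\<close>, and only the remaining weight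
  \<open>1 - g\<close> can distinguish different \<open>x\<close>.\<close>
lemma doeblin_averaging:
  assumes rho: "\<rho> \<in> prob_measures_on X" and b: "pos_cont b" and r: "continuous_on X r"
    and mM: "\<And>y. y \<in> X \<Longrightarrow> m \<le> r y" "\<And>y. y \<in> X \<Longrightarrow> r y \<le> M"
  shows "\<exists>p. m \<le> p \<and> p \<le> M \<and> (\<forall>x\<in>X.
    g * p + (1 - g) * m \<le> gibbs_op \<rho> (\<lambda>y. b y * r y) x / gibbs_op \<rho> b x \<and>
    gibbs_op \<rho> (\<lambda>y. b y * r y) x / gibbs_op \<rho> b x \<le> g * p + (1 - g) * M)"
proof -
  have bc: "continuous_on X b" and bpos: "\<And>x. x \<in> X \<Longrightarrow> 0 < b x"
    using b by (auto simp: pos_cont_def)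
  define I where "I = integral\<^sup>L \<rho> b"
  define J where "J = (LINT y|\<rho>. b y * r y)"
  have I: "0 < I" using gibbs_op_bounds[OF rho b] nonempty by (auto simp: I_def)
  have brc: "continuous_on X (\<lambda>y. b y * r y)" by (intro continuous_intros bc r)
  note ints [simp] = integrable_continuous_on[OF rho compact bc] integrable_continuous_on[OF rho compact brc]
  \<comment> \<open>The cases \<open>\<sigma> = 1\<close> and \<open>\<sigma> = -1\<close> give the upper and the lower bounds with one computation.\<close>
  have main: "(\<sigma> * J) * (g / I) + (1 - g) * (\<sigma> * K) \<ge> \<sigma> * gibbs_op \<rho> (\<lambda>y. b y * r y) x / gibbs_op \<rho> b x \<and> \<sigma> * J \<le> \<sigma> * K * I"
    if x: "x \<in> X" and K: "\<And>y. y \<in> X \<Longrightarrow> \<sigma> * r y \<le> \<sigma> * K" for \<sigma> K x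
  proof -
    define D where "D = gibbs_op \<rho> b x"
    have D: "0 < D" "D \<le> I"
      using gibbs_op_bounds[OF rho b x] gibbs_op_pos_cont[OF rho b] x by (auto simp: D_def I_def pos_cont_def)
    note gi [simp] = integrable_G_mult[OF rho bc x] integrable_G_mult[OF rho brc x]
    have nn: "0 \<le> G x y - g * D / I" if "y \<in> X" for y
    proof -
      have "g * D / I \<le> g" using D I g_pos by (simp add: divide_simps)
      then show ?thesis using G_ge[OF x that] by linarith
    qed
    have "(LINT y|\<rho>. \<sigma> * (G x y * (b y * r y)) - \<sigma> * (g * D / I) * (b y * r y))
        \<le> (LINT y|\<rho>. \<sigma> * K * (G x y * b y) - \<sigma> * K * (g * D / I) * b y)"
    proof (rule integral_mono_on_space[OF rho])
      fix y assume y: "y \<in> X"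
      have "((G x y - g * D / I) * b y) * (\<sigma> * r y) \<le> ((G x y - g * D / I) * b y) * (\<sigma> * K)"
        by (intro mult_left_mono mult_nonneg_nonneg nn y K less_imp_le bpos)
      then show "\<sigma> * (G x y * (b y * r y)) - \<sigma> * (g * D / I) * (b y * r y)
          \<le> \<sigma> * K * (G x y * b y) - \<sigma> * K * (g * D / I) * b y"
        by (simp add: algebra_simps)
    qed simp_all
    then have "\<sigma> * gibbs_op \<rho> (\<lambda>y. b y * r y) x - \<sigma> * (g * D / I) * J \<le> \<sigma> * K * D - \<sigma> * K * (g * D / I) * I"
      by (simp add: gibbs_op_def J_def I_def D_def)
    then have "\<sigma> * gibbs_op \<rho> (\<lambda>y. b y * r y) x \<le> D * ((\<sigma> * J) * (g / I) + (1 - g) * (\<sigma> * K))"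
      using I by (simp add: algebra_simps)
    then have 1: "(\<sigma> * J) * (g / I) + (1 - g) * (\<sigma> * K) \<ge> \<sigma> * gibbs_op \<rho> (\<lambda>y. b y * r y) x / D"
      using D by (simp add: pos_divide_le_eq mult.commute)
    have "(LINT y|\<rho>. \<sigma> * (b y * r y)) \<le> (LINT y|\<rho>. \<sigma> * K * b y)"
    proof (rule integral_mono_on_space[OF rho])
      fix y assume y: "y \<in> X"
      have "b y * (\<sigma> * r y) \<le> b y * (\<sigma> * K)"
        by (intro mult_left_mono K y less_imp_le bpos)
      then show "\<sigma> * (b y * r y) \<le> \<sigma> * K * b y" by (simp add: algebra_simps)
    qed simp_all
    then have "\<sigma> * J \<le> \<sigma> * K * I" by (simp add: J_def I_def)
    with 1 show ?thesis by (simp add: D_def)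
  qed
  obtain x0 where x0: "x0 \<in> X" using nonempty by auto
  show ?thesis
  proof (intro exI[of _ "J / I"] conjI ballI)
    show "m \<le> J / I" using main[OF x0, of "-1" m] mM I by (simp add: divide_simps)
    show "J / I \<le> M" using main[OF x0, of 1 M] mM I by (simp add: divide_simps)
    fix x assume x: "x \<in> X"
    show "g * (J / I) + (1 - g) * m \<le> gibbs_op \<rho> (\<lambda>y. b y * r y) x / gibbs_op \<rho> b x"
      using main[OF x, of "-1" m] mM by (simp add: mult.commute)
    show "gibbs_op \<rho> (\<lambda>y. b y * r y) x / gibbs_op \<rho> b x \<le> g * (J / I) + (1 - g) * M"
      using main[OF x, of 1 M] mM by (simp add: mult.commute)
  qed
qed

definition scaling :: "'a measure \<Rightarrow> ('a \<Rightarrow> real) \<Rightarrow> bool" where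
  "scaling \<rho> w \<longleftrightarrow> pos_cont w \<and> (\<forall>x\<in>X. w x * gibbs_op \<rho> w x = 1)"

lemma gibbs_op_cong:
  assumes "\<rho> \<in> prob_measures_on X" "\<And>y. y \<in> X \<Longrightarrow> f y = h y"
  shows "gibbs_op \<rho> f x = gibbs_op \<rho> h x"
  unfolding gibbs_op_def using assms prob_measures_onD[OF assms(1)]
  by (intro Bochner_Integration.integral_cong) auto

lemma gibbs_op_cmult: "gibbs_op \<rho> (\<lambda>y. k * f y) x = k * gibbs_op \<rho> f x"
proof -
  have "(\<lambda>y. G x y * (k * f y)) = (\<lambda>y. k * (G x y * f y))" by (simp add: ac_simps)
  then show ?thesis by (simp add: gibbs_op_def)
qed

text \<open>The quotient \<open>r = a / b\<close> is a fixed point of an averaging operator, because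
  \<open>r = G a / G b = G (b r) / G b\<close>. By the strict contraction of oscillations it is constant, and the constant
  can be distributed evenly over the two factors.\<close>
lemma symmetrize_pair:
  assumes rho: "\<rho> \<in> prob_measures_on X" and ab: "pos_cont a" "pos_cont b"
    and a: "\<And>x. x \<in> X \<Longrightarrow> a x * gibbs_op \<rho> b x = 1"
    and b: "\<And>x. x \<in> X \<Longrightarrow> b x * gibbs_op \<rho> a x = 1"
  obtains w where "scaling \<rho> w" "\<And>x y. x \<in> X \<Longrightarrow> y \<in> X \<Longrightarrow> a x * b y = w x * w y"
proof -
  have ac: "continuous_on X a" "\<And>x. x \<in> X \<Longrightarrow> 0 < a x"
    and bc: "continuous_on X b" "\<And>x. x \<in> X \<Longrightarrow> 0 < b x"
    using ab by (auto simp: pos_cont_def)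
  define r where "r x = a x / b x" for x
  have rc: "continuous_on X r"
    unfolding r_def using bc(2) by (intro continuous_intros ac bc) force
  obtain x1 x2 where x12: "x1 \<in> X" "x2 \<in> X" "\<And>x. x \<in> X \<Longrightarrow> r x1 \<le> r x" "\<And>x. x \<in> X \<Longrightarrow> r x \<le> r x2"
    using attains_bounds[OF rc] by metis
  obtain p where p: "r x1 \<le> p" "p \<le> r x2"
    "\<And>x. x \<in> X \<Longrightarrow> g * p + (1 - g) * r x1 \<le> gibbs_op \<rho> (\<lambda>y. b y * r y) x / gibbs_op \<rho> b x"
    "\<And>x. x \<in> X \<Longrightarrow> gibbs_op \<rho> (\<lambda>y. b y * r y) x / gibbs_op \<rho> b x \<le> g * p + (1 - g) * r x2"
    using doeblin_averaging[OF rho ab(2) rc x12(3,4)] by blast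
  have fixed_point: "gibbs_op \<rho> (\<lambda>y. b y * r y) x / gibbs_op \<rho> b x = r x" if "x \<in> X" for x
  proof -
    have "gibbs_op \<rho> (\<lambda>y. b y * r y) x = gibbs_op \<rho> a x"
      using bc(2) by (intro gibbs_op_cong[OF rho]) (force simp: r_def)
    also have "\<dots> = 1 / b x" using b[OF that] bc(2)[OF that] by (simp add: field_simps)
    finally have "gibbs_op \<rho> (\<lambda>y. b y * r y) x = 1 / b x" .
    moreover have "a x = 1 / gibbs_op \<rho> b x"
      using a[OF that] by (metis mult_eq_0_iff nonzero_eq_divide_eq one_neq_zero)
    ultimately show ?thesis by (simp only: r_def) (simp add: mult.commute)
  qed
  have "g * p \<ge> g * r x2" using p(4)[OF x12(2)] fixed_point[OF x12(2)] by (simp add: algebra_simps)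
  moreover have "g * p \<le> g * r x1" using p(3)[OF x12(1)] fixed_point[OF x12(1)] by (simp add: algebra_simps)
  ultimately have "r x2 \<le> r x1" using g_pos by (meson mult_le_cancel_left_pos order_trans)
  then have eq: "r x1 = r x2" using x12(3)[OF x12(2)] by linarith
  define k where "k = r x1"
  have k: "r x = k" if "x \<in> X" for x using x12(3,4)[OF that] eq by (simp add: k_def)
  have k0: "0 < k" using ac(2) bc(2) x12(1) by (simp add: k_def r_def)
  have abk: "a x = k * b x" if "x \<in> X" for x
    using k[OF that] bc(2)[OF that] by (simp add: r_def field_simps)
  define w where "w x = sqrt k * b x" for x
  have "pos_cont w" unfolding w_def pos_cont_def using bc k0 by (auto intro!: continuous_intros)
  moreover have "w x * gibbs_op \<rho> w x = 1" if "x \<in> X" for x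
  proof -
    have "gibbs_op \<rho> w x = sqrt k * gibbs_op \<rho> b x"
      unfolding w_def by (rule gibbs_op_cmult)
    then have "w x * gibbs_op \<rho> w x = (sqrt k * sqrt k) * (b x * gibbs_op \<rho> b x)"
      by (simp add: w_def ac_simps)
    also have "\<dots> = a x * gibbs_op \<rho> b x" using k0 abk[OF that] by (simp add: ac_simps)
    finally show ?thesis using a[OF that] by simp
  qed
  moreover have "a x * b y = w x * w y" if "x \<in> X" "y \<in> X" for x y
    using abk[OF that(1)] k0 by (simp add: w_def)
  ultimately show thesis by (intro that[of w]) (auto simp: scaling_def)
qed

text \<open>With \<open>m = \<integral> w d\<rho>\<close> the equation gives \<open>1 / m \<le> w \<le> 1 / (g m)\<close>, and integrating these bounds
  confines \<open>m\<close> itself.\<close>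
lemma scaling_bounds:
  assumes rho: "\<rho> \<in> prob_measures_on X" and w: "scaling \<rho> w" and x: "x \<in> X"
  shows "g \<le> w x" "w x \<le> 1 / g" 
proof -
  have pc: "pos_cont w" and eq: "\<And>x. x \<in> X \<Longrightarrow> w x * gibbs_op \<rho> w x = 1" using w by (auto simp: scaling_def)
  have wc: "continuous_on X w" "\<And>x. x \<in> X \<Longrightarrow> 0 < w x" using pc by (auto simp: pos_cont_def)
  define m where "m = integral\<^sup>L \<rho> w"
  have m: "0 < m" "\<And>x. x \<in> X \<Longrightarrow> g * m \<le> gibbs_op \<rho> w x" "\<And>x. x \<in> X \<Longrightarrow> gibbs_op \<rho> w x \<le> m"
    using gibbs_op_bounds[OF rho pc] nonempty by (auto simp: m_def)
  have lo: "1 / m \<le> w y" if "y \<in> X" for y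
  proof -
    have "1 \<le> w y * m" using eq[OF that] m(3)[OF that] wc(2)[OF that] by (metis mult_left_mono less_imp_le)
    then show ?thesis using m(1) by (simp add: divide_simps mult.commute)
  qed
  have hi: "w y \<le> 1 / (g * m)" if "y \<in> X" for y
  proof -
    have "w y * (g * m) \<le> 1" using eq[OF that] m(2)[OF that] wc(2)[OF that] by (metis mult_left_mono less_imp_le)
    then show ?thesis using m(1) g_pos by (simp add: divide_simps mult.commute)
  qed
  note int = integrable_continuous_on[OF rho compact wc(1)]
  have "1 / m \<le> m" "m \<le> 1 / (g * m)"
    using integral_bounds_on[OF rho int lo hi] unfolding m_def by auto
  then have mm: "1 \<le> m * m" "g * (m * m) \<le> 1" using m(1) g_pos by (auto simp: divide_simps ac_simps)
  have "1 \<le> m"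
  proof (rule ccontr)
    assume "\<not> 1 \<le> m"
    then have "m * m < 1 * 1" using m(1) by (intro mult_strict_mono) auto
    with mm(1) show False by simp
  qed
  then have "1 / (g * m) \<le> 1 / g" using g_pos by (intro divide_left_mono) auto
  with hi[OF x] show "w x \<le> 1 / g" by linarith
  have "g * m \<le> 1"
  proof -
    have "g * m * 1 \<le> g * m * m" using \<open>1 \<le> m\<close> g_pos m(1) by (intro mult_left_mono) auto
    with mm(2) show ?thesis by (simp add: ac_simps)
  qed
  then have "g \<le> 1 / m" using m(1) by (simp add: divide_simps)
  with lo[OF x] show "g \<le> w x" by linarith
qed

lemma scaling_continuous: "scaling \<rho> w \<Longrightarrow> continuous_on X w"
  and scaling_pos: "scaling \<rho> w \<Longrightarrow> x \<in> X \<Longrightarrow> 0 < w x"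
  and scaling_eq: "scaling \<rho> w \<Longrightarrow> x \<in> X \<Longrightarrow> w x * gibbs_op \<rho> w x = 1"
  by (auto simp: scaling_def pos_cont_def)

text \<open>The quotient \<open>u = v / w\<close> satisfies \<open>1 / u = s \<cdot> P u\<close> with an averaging operator \<open>P\<close> and a factor \<open>s\<close> in
  \<open>[1 - e, 1 + e]\<close>, where \<open>e = \<eta> / g\<close>. At a minimum \<open>m\<close> and a maximum \<open>M\<close> of \<open>u\<close> the averaging bounds give
  \<open>1 \<le> (1 + e) (g p m + (1 - g) M m)\<close> and \<open>(1 - e) (g p M + (1 - g) m M) \<le> 1\<close>. The terms \<open>(1 - g) m M\<close> almost
  cancel in the difference, which leaves \<open>g p (M - m) = O(e)\<close>; and since \<open>u\<close> cannot lie entirely above or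
  below \<open>1\<close> by more than \<open>O(e)\<close>, it is uniformly close to \<open>1\<close>. For \<open>e > 1 / 2\<close> the claim follows from the a
  priori bounds on scalings.\<close>
lemma scaling_stability:
  assumes rho: "\<rho> \<in> prob_measures_on X" and sig: "\<sigma> \<in> prob_measures_on X"
    and w: "scaling \<rho> w" and v: "scaling \<sigma> v"
    and dist: "\<And>x. x \<in> X \<Longrightarrow> \<bar>gibbs_op \<sigma> w x - gibbs_op \<rho> w x\<bar> \<le> \<eta>"
    and x: "x \<in> X"
  shows "\<bar>v x - w x\<bar> \<le> 3 * \<eta> / g ^ 5"
proof -
  note wp = scaling_pos[OF w] and vp = scaling_pos[OF v]
  note g1 = g_le_1
  define e where "e = \<eta> / g"
  have eta0: "0 \<le> \<eta>" using dist[OF x] by linarith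
  have e0: "0 \<le> e" using eta0 g_pos by (simp add: e_def)
  define u where "u y = v y / w y" for y
  have up: "0 < u y" if "y \<in> X" for y using wp[OF that] vp[OF that] by (simp add: u_def)
  have uc: "continuous_on X u"
    unfolding u_def using wp
    by (intro continuous_intros scaling_continuous[OF v] scaling_continuous[OF w]) force
  have pw: "pos_cont w" and pv: "pos_cont v" using w v by (auto simp: scaling_def)
  define s where "s y = w y * gibbs_op \<sigma> w y" for y
  have sp: "0 < s y" if "y \<in> X" for y
    using gibbs_op_pos_cont[OF sig pw] wp[OF that] that by (auto simp: pos_cont_def s_def)
  have s: "1 - e \<le> s y" "s y \<le> 1 + e" if "y \<in> X" for y
  proof -
    have "s y - 1 = w y * (gibbs_op \<sigma> w y - gibbs_op \<rho> w y)"
      using scaling_eq[OF w that] by (simp add: s_def algebra_simps)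
    then have "\<bar>s y - 1\<bar> = w y * \<bar>gibbs_op \<sigma> w y - gibbs_op \<rho> w y\<bar>"
      using wp[OF that] by (simp add: abs_mult)
    also have "\<dots> \<le> 1 / g * \<eta>"
      using scaling_bounds[OF rho w that] wp[OF that] dist[OF that] g_pos
      by (intro mult_mono) auto
    finally have "\<bar>s y - 1\<bar> \<le> e" by (simp add: e_def)
    then show "1 - e \<le> s y" "s y \<le> 1 + e" by auto
  qed
  obtain x1 x2 where x12: "x1 \<in> X" "x2 \<in> X" "\<And>y. y \<in> X \<Longrightarrow> u x1 \<le> u y" "\<And>y. y \<in> X \<Longrightarrow> u y \<le> u x2"
    using attains_bounds[OF uc] by metis
  define m M where "m = u x1" and "M = u x2"
  have mM: "0 < m" "m \<le> M" using up x12 by (auto simp: m_def M_def)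
  obtain p where p: "m \<le> p" "p \<le> M"
    and plo: "\<And>y. y \<in> X \<Longrightarrow> g * p + (1 - g) * m \<le> gibbs_op \<sigma> (\<lambda>y. w y * u y) y / gibbs_op \<sigma> w y"
    and phi: "\<And>y. y \<in> X \<Longrightarrow> gibbs_op \<sigma> (\<lambda>y. w y * u y) y / gibbs_op \<sigma> w y \<le> g * p + (1 - g) * M"
    using doeblin_averaging[OF sig pw uc x12(3,4)] unfolding m_def M_def by blast
  have inv: "1 / u y = s y * (gibbs_op \<sigma> (\<lambda>y. w y * u y) y / gibbs_op \<sigma> w y)" if "y \<in> X" for y
  proof -
    have "gibbs_op \<sigma> (\<lambda>y. w y * u y) y = gibbs_op \<sigma> v y"
      using wp by (intro gibbs_op_cong[OF sig]) (force simp: u_def)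
    also have "\<dots> = 1 / v y" using scaling_eq[OF v that] vp[OF that] by (simp add: field_simps)
    moreover have "gibbs_op \<sigma> w y \<noteq> 0" using sp[OF that] by (auto simp: s_def)
    ultimately show ?thesis
      using wp[OF that] vp[OF that] by (simp add: u_def s_def field_simps)
  qed
  have P0: "0 < g * p + (1 - g) * m" "0 < g * p + (1 - g) * M"
    using mM p g_pos g1 by (auto intro!: add_pos_nonneg mult_pos_pos)
  have A: "1 \<le> (1 + e) * (g * p * m + (1 - g) * M * m)"
  proof -
    have "1 / m \<le> (1 + e) * (g * p + (1 - g) * M)"
      using inv[OF x12(1)] phi[OF x12(1)] s[OF x12(1)] sp[OF x12(1)] P0 plo[OF x12(1)] unfolding m_def[symmetric]
      by (smt (verit) mult_mono)
    then have "1 \<le> (1 + e) * (g * p + (1 - g) * M) * m" using mM by (simp only: pos_divide_le_eq)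
    then show ?thesis by (simp add: algebra_simps)
  qed
  have B: "(1 - e) * (g * p * M + (1 - g) * m * M) \<le> 1"
  proof -
    have "(1 - e) * (g * p + (1 - g) * m) \<le> s x2 * (g * p + (1 - g) * m)"
      using s[OF x12(2)] P0 by (intro mult_right_mono) auto
    also have "\<dots> \<le> 1 / M"
      unfolding M_def inv[OF x12(2)] using plo[OF x12(2)] sp[OF x12(2)] by (intro mult_left_mono) auto
    finally have "(1 - e) * (g * p + (1 - g) * m) * M \<le> 1"
      using mM order_less_le_trans[OF mM] by (simp only: pos_le_divide_eq)
    then show ?thesis by (simp add: algebra_simps)
  qed
  have osc: "M - m \<le> 2 * M * e / g"
  proof -
    have "(1 - e) * (g * p * M + (1 - g) * m * M) \<le> (1 + e) * (g * p * m + (1 - g) * M * m)"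
      using A B by linarith
    then have "g * p * (M - m) \<le> e * (g * p * (M + m) + 2 * (1 - g) * (M * m))"
      by (simp add: algebra_simps)
    also have "\<dots> \<le> e * (2 * M * p)"
    proof (rule mult_left_mono[OF _ e0])
      have "g * p * (M + m) \<le> g * p * (2 * M)" using mM p g_pos by (intro mult_left_mono) auto
      moreover have "2 * (1 - g) * (M * m) \<le> 2 * (1 - g) * (M * p)"
        using mM p g1 by (intro mult_left_mono) auto
      ultimately show "g * p * (M + m) + 2 * (1 - g) * (M * m) \<le> 2 * M * p"
        by (simp add: algebra_simps)
    qed
    finally have "p * (g * (M - m)) \<le> p * (2 * M * e)" by (simp add: algebra_simps)
    then have "g * (M - m) \<le> 2 * M * e" using p mM by simp
    then show ?thesis using g_pos by (simp add: pos_le_divide_eq mult.commute)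
  qed
  have uM: "M \<le> 1 / g\<^sup>2"
  proof -
    have "v x2 / w x2 \<le> (1 / g) / g"
      using scaling_bounds[OF rho w x12(2)] scaling_bounds[OF sig v x12(2)] g_pos vp[OF x12(2)]
      by (intro frac_le) auto
    then show ?thesis by (simp add: M_def u_def power2_eq_square)
  qed
  have pow: "1 \<le> 1 / g" "1 / g \<le> 1 / g ^ 3" "1 / g\<^sup>2 \<le> 1 / g ^ 3" 
    using g_pos g1 by (auto simp: divide_simps power_decreasing power_le_one mult_le_one intro: power_decreasing[of 1 3 g, simplified])
  have eg: "e \<le> e / g ^ 3" using pow(1,2) e0 mult_left_mono[of 1 "1 / g ^ 3" e] by simp
  have "\<bar>u x - 1\<bar> \<le> 3 * e / g ^ 3"
  proof (cases "e \<le> 1 / 2")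
    case True
    have Mm: "M - m \<le> 2 * e / g ^ 3"
    proof -
      have "M * (2 * e / g) \<le> (1 / g\<^sup>2) * (2 * e / g)"
        using uM e0 g_pos by (intro mult_right_mono) auto
      also have "\<dots> = 2 * e / g ^ 3" by (simp add: power2_eq_square power3_eq_cube)
      finally show ?thesis using osc by (simp add: ac_simps)
    qed
    have M1: "1 - e \<le> M"
    proof -
      have "g * p * m + (1 - g) * M * m \<le> g * (M * M) + (1 - g) * (M * M)"
        using mM p g_pos g1 unfolding mult.assoc by (intro add_mono mult_left_mono mult_mono) auto
      then have "g * p * m + (1 - g) * M * m \<le> M * M" by (simp add: algebra_simps)
      then have "(1 + e) * (g * p * m + (1 - g) * M * m) \<le> (1 + e) * (M * M)"
        using e0 by (intro mult_left_mono) auto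
      with A have 1: "1 \<le> (1 + e) * (M * M)" by linarith
      show ?thesis
      proof (rule ccontr)
        assume "\<not> 1 - e \<le> M"
        then have "M * M < (1 - e) * (1 - e)" using mM True by (intro mult_strict_mono) auto
        then have "(1 + e) * (M * M) < (1 + e) * ((1 - e) * (1 - e))" using e0 by auto
        also have "\<dots> = (1 - e * e) * (1 - e)" by (simp add: algebra_simps)
        also have "\<dots> \<le> 1 * 1" using True e0 by (intro mult_mono) (auto simp: mult_le_one)
        finally show False using 1 by simp
      qed
    qed
    have m1: "m \<le> 1 + e"
    proof -
      have "g * (m * m) + (1 - g) * (m * m) \<le> g * p * M + (1 - g) * m * M"
        using mM p g_pos g1 unfolding mult.assoc by (intro add_mono mult_left_mono mult_mono) auto
      then have "m * m \<le> g * p * M + (1 - g) * m * M" by (simp add: algebra_simps)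
      then have "(1 - e) * (m * m) \<le> (1 - e) * (g * p * M + (1 - g) * m * M)"
        using True by (intro mult_left_mono) auto
      with B have 1: "(1 - e) * (m * m) \<le> 1" by linarith
      show ?thesis
      proof (rule ccontr)
        assume "\<not> m \<le> 1 + e"
        then have "(1 + e) * (1 + e) < m * m" using mM e0 by (intro mult_strict_mono) auto
        then have "(1 - e) * ((1 + e) * (1 + e)) < (1 - e) * (m * m)" using True by auto
        moreover have "(1 - e) * ((1 + e) * (1 + e)) = 1 + e * (1 - e - e * e)"
          by (simp add: algebra_simps)
        moreover have "e * e \<le> 1 / 2 * (1 / 2)" using True e0 by (intro mult_mono) auto
        then have "0 \<le> e * (1 - e - e * e)" using True e0 by (intro mult_nonneg_nonneg) auto
        ultimately show False using 1 by linarith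
      qed
    qed
    have "m \<le> u x" "u x \<le> M" using x12 x by (auto simp: m_def M_def)
    moreover have "2 * e / g ^ 3 + e / g ^ 3 = 3 * e / g ^ 3" by (simp add: add_divide_distrib[symmetric])
    ultimately show ?thesis using Mm M1 m1 eg by (simp add: abs_le_iff)
  next
    case False
    have "0 < u x" "u x \<le> 1 / g\<^sup>2" using up[OF x] x12(4)[OF x] uM by (auto simp: M_def)
    moreover have "1 \<le> 1 / g ^ 3" using pow by linarith
    ultimately have "\<bar>u x - 1\<bar> \<le> 1 / g ^ 3" using pow by (simp add: abs_le_iff)
    also have "\<dots> \<le> 3 * e / g ^ 3" using False g_pos by (intro divide_right_mono) auto
    finally show ?thesis .
  qed
  then have "w x * \<bar>u x - 1\<bar> \<le> (1 / g) * (3 * e / g ^ 3)"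
    using scaling_bounds[OF rho w x] wp[OF x] g_pos by (intro mult_mono) auto
  also have "\<dots> = 3 * \<eta> / g ^ 5" by (simp add: e_def power_numeral_reduce)
  finally have "w x * \<bar>u x - 1\<bar> \<le> 3 * \<eta> / g ^ 5" .
  moreover have "v x - w x = w x * (u x - 1)" using wp[OF x] by (simp add: u_def algebra_simps)
  then have "\<bar>v x - w x\<bar> = w x * \<bar>u x - 1\<bar>" using wp[OF x] by (simp add: abs_mult)
  ultimately show ?thesis by linarith
qed

lemma scaling_unique:
  assumes rho: "\<rho> \<in> prob_measures_on X" and w: "scaling \<rho> w" and v: "scaling \<rho> v" and x: "x \<in> X"
  shows "v x = w x"
  using scaling_stability[OF rho rho w v _ x, of 0] by simp

text \<open>The two half steps of the Sinkhorn iteration coincide for a symmetric problem. The iterates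
  themselves need not converge: multiplying the start by \<open>t\<close> multiplies them alternately by \<open>t\<close> and \<open>1 / t\<close>.
  The products of consecutive iterates do converge.\<close>
primrec sinkhorn :: "'a measure \<Rightarrow> nat \<Rightarrow> 'a \<Rightarrow> real" where
  "sinkhorn \<rho> 0 = (\<lambda>x. 1)"
| "sinkhorn \<rho> (Suc n) = (\<lambda>x. 1 / gibbs_op \<rho> (sinkhorn \<rho> n) x)"

lemma sinkhorn_pos_cont:
  assumes "\<rho> \<in> prob_measures_on X"
  shows "pos_cont (sinkhorn \<rho> n)"
proof (induction n)
  case 0
  show ?case by (simp add: pos_cont_def)
next
  case (Suc n)
  from gibbs_op_pos_cont[OF assms Suc] show ?case
    unfolding pos_cont_def sinkhorn.simps by (auto intro!: continuous_intros dest: bspec)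
qed

text \<open>If \<open>r\<close> is the quotient of two consecutive iterates then the next quotient is the reciprocal of an
  average of \<open>r\<close>. Averaging multiplies the excess over \<open>1\<close> of the quotient between maximum and minimum by
  \<open>1 - g\<close>, and taking reciprocals preserves this quotient.\<close>
lemma sinkhorn_ratio_contraction:
  assumes rho: "\<rho> \<in> prob_measures_on X" and xy: "x \<in> X" "y \<in> X"
  shows "sinkhorn \<rho> (Suc n) x / sinkhorn \<rho> n x
       \<le> (1 + (1 - g) ^ n / g) * (sinkhorn \<rho> (Suc n) y / sinkhorn \<rho> n y)"
  using xy
proof (induction n arbitrary: x y)
  case 0
  have one: "pos_cont (\<lambda>_. 1)" by (simp add: pos_cont_def)
  interpret prob_space \<rho> by (rule prob_measures_onD(1)[OF rho])
  have b: "g \<le> gibbs_op \<rho> (\<lambda>_. 1) z" "gibbs_op \<rho> (\<lambda>_. 1) z \<le> 1" if "z \<in> X" for z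
    using gibbs_op_bounds[OF rho one that] by (simp_all add: prob_space)
  have "1 / gibbs_op \<rho> (\<lambda>_. 1) x \<le> 1 / g" using b[OF 0(1)] g_pos by (intro divide_left_mono) auto
  moreover have "1 \<le> 1 / gibbs_op \<rho> (\<lambda>_. 1) y" using b[OF 0(2)] g_pos by simp
  then have "(1 + 1 / g) * 1 \<le> (1 + 1 / g) * (1 / gibbs_op \<rho> (\<lambda>_. 1) y)"
    using g_pos by (intro mult_left_mono) auto
  ultimately show ?case by simp
next
  case (Suc n)
  define v where "v = sinkhorn \<rho> n"
  define v' where "v' = sinkhorn \<rho> (Suc n)"
  define r where "r z = v' z / v z" for z
  define q where "q = (1 - g) ^ n / g"
  have pv: "pos_cont v" "pos_cont v'" unfolding v_def v'_def by (rule sinkhorn_pos_cont[OF rho])+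
  have vp: "0 < v z" "0 < v' z" if "z \<in> X" for z using pv that by (auto simp: pos_cont_def)
  have rc: "continuous_on X r"
    unfolding r_def using pv vp by (intro continuous_intros) (force simp: pos_cont_def)+
  obtain x1 x2 where x12: "x1 \<in> X" "x2 \<in> X" "\<And>y. y \<in> X \<Longrightarrow> r x1 \<le> r y" "\<And>y. y \<in> X \<Longrightarrow> r y \<le> r x2"
    using attains_bounds[OF rc] by metis
  obtain p where p: "r x1 \<le> p" "p \<le> r x2"
    and plo: "\<And>z. z \<in> X \<Longrightarrow> g * p + (1 - g) * r x1 \<le> gibbs_op \<rho> (\<lambda>y. v y * r y) z / gibbs_op \<rho> v z"
    and phi: "\<And>z. z \<in> X \<Longrightarrow> gibbs_op \<rho> (\<lambda>y. v y * r y) z / gibbs_op \<rho> v z \<le> g * p + (1 - g) * r x2"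
    using doeblin_averaging[OF rho pv(1) rc x12(3,4)] by blast
  have rat: "gibbs_op \<rho> (\<lambda>y. v y * r y) z / gibbs_op \<rho> v z
      = 1 / (sinkhorn \<rho> (Suc (Suc n)) z / sinkhorn \<rho> (Suc n) z)" for z
  proof -
    have "gibbs_op \<rho> (\<lambda>y. v y * r y) z = gibbs_op \<rho> v' z"
      using vp by (intro gibbs_op_cong[OF rho]) (force simp: r_def)
    then show ?thesis by (simp add: v_def v'_def)
  qed
  have r1: "0 < r x1" using vp x12(1) by (simp add: r_def)
  have q0: "0 \<le> q" using g_pos g_le_1 by (simp add: q_def)
  have q: "r x2 \<le> (1 + q) * r x1"
    using Suc.IH[OF x12(2,1)] by (simp add: r_def q_def v_def v'_def)
  define U where "U = g * p + (1 - g) * r x1"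
  have U: "0 < U" unfolding U_def using p r1 g_pos g_le_1 by (auto intro!: add_pos_nonneg)
  have "r x1 \<le> U"
  proof -
    have "g * r x1 \<le> g * p" using p g_pos by simp
    then show ?thesis by (simp add: U_def algebra_simps)
  qed
  have "g * p + (1 - g) * r x2 \<le> g * p + (1 - g) * ((1 + q) * r x1)"
    using q g_le_1 by (intro add_left_mono mult_left_mono) auto
  also have "\<dots> = U + (1 - g) * q * r x1" by (simp add: U_def algebra_simps)
  also have "\<dots> \<le> U + (1 - g) * q * U"
    using \<open>r x1 \<le> U\<close> q0 g_le_1 by (intro add_left_mono mult_left_mono) auto
  also have "\<dots> = (1 + (1 - g) * q) * U" by (simp add: algebra_simps)
  finally have ub: "g * p + (1 - g) * r x2 \<le> (1 + (1 - g) * q) * U" .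
  define a where "a z = sinkhorn \<rho> (Suc (Suc n)) z / sinkhorn \<rho> (Suc n) z" for z
  have ap: "0 < a z" if "z \<in> X" for z
    using sinkhorn_pos_cont[OF rho, of "Suc n"] sinkhorn_pos_cont[OF rho, of "Suc (Suc n)"] that
    unfolding a_def by (auto simp: pos_cont_def simp del: sinkhorn.simps)
  have lo: "U \<le> 1 / a x" using plo[OF Suc.prems(1)] rat[of x] by (simp add: U_def a_def)
  have hi: "1 / a y \<le> (1 + (1 - g) * q) * U" using phi[OF Suc.prems(2)] rat[of y] ub by (simp add: a_def)
  have "a x \<le> 1 / U" using lo ap[OF Suc.prems(1)] U by (simp add: field_simps)
  also have "\<dots> \<le> (1 + (1 - g) * q) * a y" using hi ap[OF Suc.prems(2)] U by (simp add: field_simps)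
  finally show ?case by (simp add: a_def q_def del: sinkhorn.simps)
qed

text \<open>The quotient of consecutive products is \<open>r(x)\<close> divided by an average of \<open>r\<close>, where \<open>r\<close> is the quotient of
  consecutive iterates, and \<open>r\<close> is almost constant.\<close>
lemma sinkhorn_product_step:
  fixes n
  assumes rho: "\<rho> \<in> prob_measures_on X" and xy: "x \<in> X" "y \<in> X"
  defines "q \<equiv> 1 + (1 - g) ^ n / g"
  defines "s \<equiv> \<lambda>n. sinkhorn \<rho> n x * sinkhorn \<rho> (Suc n) y"
  shows "s (Suc n) \<le> q * s n" "s n \<le> q * s (Suc n)"
proof -
  define v where "v = sinkhorn \<rho> n"
  define v' where "v' = sinkhorn \<rho> (Suc n)"
  have pv: "pos_cont v" "pos_cont v'" unfolding v_def v'_def by (rule sinkhorn_pos_cont[OF rho])+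
  have vp: "0 < v z" "0 < v' z" if "z \<in> X" for z using pv that by (auto simp: pos_cont_def)
  define r where "r = v' x / v x"
  have r0: "0 < r" using vp xy by (simp add: r_def)
  have q0: "1 \<le> q" using g_pos g_le_1 by (simp add: q_def)
  have int: "integrable \<rho> (\<lambda>z. G y z * v z)" "integrable \<rho> (\<lambda>z. G y z * v' z)"
    using pv integrable_G_mult[OF rho _ xy(2)] by (auto simp: pos_cont_def)
  have b1: "v' z \<le> q * r * v z" and b2: "r * v z \<le> q * v' z" if "z \<in> X" for z
    using sinkhorn_ratio_contraction[OF rho that xy(1), of n]
      sinkhorn_ratio_contraction[OF rho xy(1) that, of n] vp[OF that]
    unfolding r_def q_def v_def v'_def by (simp_all add: pos_divide_le_eq pos_le_divide_eq del: sinkhorn.simps)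
  have "gibbs_op \<rho> v' y \<le> (LINT z|\<rho>. q * r * (G y z * v z))"
    unfolding gibbs_op_def
  proof (intro integral_mono_on_space[OF rho] int integrable_mult_right)
    fix z assume z: "z \<in> X"
    have "G y z * v' z \<le> G y z * (q * r * v z)"
      using b1[OF z] G_pos[OF xy(2) z] by (intro mult_left_mono) auto
    then show "G y z * v' z \<le> q * r * (G y z * v z)" by (simp add: ac_simps)
  qed
  then have u: "gibbs_op \<rho> v' y \<le> q * r * gibbs_op \<rho> v y" by (simp add: gibbs_op_def)
  have "(LINT z|\<rho>. r * (G y z * v z)) \<le> (LINT z|\<rho>. q * (G y z * v' z))"
  proof (intro integral_mono_on_space[OF rho] int integrable_mult_right)
    fix z assume z: "z \<in> X"
    have "G y z * (r * v z) \<le> G y z * (q * v' z)"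
      using b2[OF z] G_pos[OF xy(2) z] by (intro mult_left_mono) auto
    then show "r * (G y z * v z) \<le> q * (G y z * v' z)" by (simp add: ac_simps)
  qed
  then have l: "r * gibbs_op \<rho> v y \<le> q * gibbs_op \<rho> v' y" by (simp add: gibbs_op_def)
  have gp: "0 < gibbs_op \<rho> v y" "0 < gibbs_op \<rho> v' y"
    using gibbs_op_pos_cont[OF rho] pv xy by (auto simp: pos_cont_def)
  have sn: "s n = v x / gibbs_op \<rho> v y" "s (Suc n) = r * v x / gibbs_op \<rho> v' y"
    using vp[OF xy(1)] by (simp_all add: s_def r_def v_def v'_def)
  have vx: "0 < v x" using vp xy by auto
  show "s (Suc n) \<le> q * s n"
    unfolding sn using mult_left_mono[OF l less_imp_le[OF vx]] gp by (simp add: field_simps)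
  show "s n \<le> q * s (Suc n)"
    unfolding sn using mult_left_mono[OF u less_imp_le[OF vx]] gp by (simp add: field_simps)
qed

text \<open>An iterate after the start is a reciprocal of a function with values in some \<open>[g J, J]\<close>, so its values
  differ by at most the factor \<open>1 / g\<close>; the second factor \<open>1 / g\<close> comes from the kernel.\<close>
lemma sinkhorn_product_bounds:
  assumes rho: "\<rho> \<in> prob_measures_on X" and xy: "x \<in> X" "y \<in> X"
  shows "0 < sinkhorn \<rho> n x * sinkhorn \<rho> (Suc n) y" "sinkhorn \<rho> n x * sinkhorn \<rho> (Suc n) y \<le> 1 / g\<^sup>2"
proof -
  define v where "v = sinkhorn \<rho> n"
  have pv: "pos_cont v" unfolding v_def by (rule sinkhorn_pos_cont[OF rho])
  have vp: "0 < v z" if "z \<in> X" for z using pv that by (auto simp: pos_cont_def)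
  have gp: "0 < gibbs_op \<rho> v y"
    using gibbs_op_pos_cont[OF rho] pv xy by (auto simp: pos_cont_def)
  have eq: "sinkhorn \<rho> n x * sinkhorn \<rho> (Suc n) y = v x / gibbs_op \<rho> v y" by (simp add: v_def)
  show "0 < sinkhorn \<rho> n x * sinkhorn \<rho> (Suc n) y"
    unfolding eq using gp vp xy by simp
  have vv: "g * v x \<le> v z" if "z \<in> X" for z
  proof (cases n)
    case 0
    then show ?thesis using g_le_1 by (simp add: v_def)
  next
    case (Suc k)
    define f where "f = sinkhorn \<rho> k"
    define J where "J = integral\<^sup>L \<rho> f"
    have pf: "pos_cont f" unfolding f_def by (rule sinkhorn_pos_cont[OF rho])
    note bx = gibbs_op_bounds[OF rho pf xy(1)] and bz = gibbs_op_bounds[OF rho pf that]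
    have v: "v u = 1 / gibbs_op \<rho> f u" for u by (simp add: v_def f_def Suc)
    have gz: "0 < gibbs_op \<rho> f z" "0 < gibbs_op \<rho> f x"
      using gibbs_op_pos_cont[OF rho pf] that xy by (auto simp: pos_cont_def)
    have "g * gibbs_op \<rho> f z \<le> gibbs_op \<rho> f x"
      using bx bz g_pos by (meson mult_le_cancel_left_pos order_trans)
    then show ?thesis unfolding v using gz by (simp add: field_simps)
  qed
  have "g * v x \<le> integral\<^sup>L \<rho> v"
  proof -
    obtain b where "\<And>z. z \<in> X \<Longrightarrow> v z \<le> v b" using attains_bounds pv unfolding pos_cont_def by metis
    with vv show ?thesis
      using integral_bounds_on(1)[OF rho integrable_continuous_on[OF rho compact]] pv
      unfolding pos_cont_def by blast
  qed
  then have "g * (g * v x) \<le> gibbs_op \<rho> v y"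
    using gibbs_op_bounds(1)[OF rho pv xy(2)] g_pos by (meson mult_le_cancel_left_pos order_trans)
  then show "sinkhorn \<rho> n x * sinkhorn \<rho> (Suc n) y \<le> 1 / g\<^sup>2"
    unfolding eq using gp g_pos by (simp add: field_simps power2_eq_square)
qed

text \<open>The logarithms of the products form a Cauchy sequence with geometrically decreasing steps.\<close>
lemma sinkhorn_product_limit:
  assumes rho: "\<rho> \<in> prob_measures_on X" and xy: "x \<in> X" "y \<in> X"
  shows "\<exists>S>0. (\<lambda>n. sinkhorn \<rho> n x * sinkhorn \<rho> (Suc n) y) \<longlonglongrightarrow> S"
proof -
  define s where "s n = sinkhorn \<rho> n x * sinkhorn \<rho> (Suc n) y" for n
  define a where "a n = ln (s n)" for n
  define q where "q n = (1 - g) ^ n / g" for n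
  have sp: "0 < s n" for n unfolding s_def by (rule sinkhorn_product_bounds[OF rho xy])
  have q0: "0 \<le> q n" for n using g_pos g_le_1 by (simp add: q_def)
  have step: "\<bar>a (Suc n) - a n\<bar> \<le> q n" for n
  proof -
    have up: "s (Suc n) \<le> (1 + q n) * s n" and lo: "s n \<le> (1 + q n) * s (Suc n)"
      unfolding s_def q_def by (rule sinkhorn_product_step[OF rho xy])+
    have "ln (s (Suc n)) \<le> ln ((1 + q n) * s n)" "ln (s n) \<le> ln ((1 + q n) * s (Suc n))"
      using up lo sp by (simp_all add: ln_mono)
    moreover have "ln ((1 + q n) * s m) = ln (1 + q n) + ln (s m)" for m
      using sp[of m] q0[of n] by (simp add: ln_mult)
    moreover have "ln (1 + q n) \<le> q n" using q0 by (rule ln_add_one_self_le_self)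
    ultimately show ?thesis unfolding a_def abs_le_iff by simp
  qed
  have "summable (\<lambda>n. (1 - g) ^ n * (1 / g))"
    using g_pos g_le_1 by (intro summable_mult2 summable_geometric) auto
  moreover have "q = (\<lambda>n. (1 - g) ^ n * (1 / g))" by (simp add: q_def fun_eq_iff)
  ultimately have "summable q" by (simp only:)
  then have "summable (\<lambda>n. a (Suc n) - a n)"
    by (rule summable_comparison_test[rotated]) (use step in auto)
  then obtain l where "(\<lambda>m. \<Sum>n<m. a (Suc n) - a n) \<longlonglongrightarrow> l"
    by (auto simp: summable_def sums_def)
  then have "(\<lambda>m. a m - a 0) \<longlonglongrightarrow> l" by (simp add: sum_lessThan_telescope)
  then have "(\<lambda>m. (a m - a 0) + a 0) \<longlonglongrightarrow> l + a 0" by (intro tendsto_intros)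
  then have "(\<lambda>m. exp (a m)) \<longlonglongrightarrow> exp (l + a 0)" by (intro tendsto_exp) simp
  then have "s \<longlonglongrightarrow> exp (l + a 0)" using sp by (simp add: a_def)
  then show ?thesis unfolding s_def by (intro exI[of _ "exp (l + a 0)"]) simp
qed

lemma gibbs_op_dominated_limit:
  assumes rho: "\<rho> \<in> prob_measures_on X" and x: "x \<in> X"
    and f: "\<And>n. continuous_on X (f n)" "\<And>n y. y \<in> X \<Longrightarrow> \<bar>f n y\<bar> \<le> B"
    and lim: "\<And>y. y \<in> X \<Longrightarrow> (\<lambda>n. f n y) \<longlonglongrightarrow> h y"
  shows "h \<in> borel_measurable (borel_on X)" "\<And>y. y \<in> X \<Longrightarrow> \<bar>h y\<bar> \<le> B"
    "(\<lambda>n. gibbs_op \<rho> (f n) x) \<longlonglongrightarrow> gibbs_op \<rho> h x"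
proof -
  interpret prob_space \<rho> by (rule prob_measures_onD(1)[OF rho])
  have meas: "u \<in> borel_measurable \<rho>" if "u \<in> borel_measurable (borel_on X)" for u :: "'a \<Rightarrow> real"
    using measurable_cong_sets[OF prob_measures_onD(2)[OF rho] refl, of borel] that by blast
  note sp = prob_measures_onD(3)[OF rho]
  show h: "h \<in> borel_measurable (borel_on X)"
    using borel_measurable_continuous_on_restrict[OF f(1)] lim
    by (rule borel_measurable_LIMSEQ_real[rotated]) (simp add: space_restrict_space)
  show "\<bar>h y\<bar> \<le> B" if "y \<in> X" for y
    using tendsto_rabs[OF lim[OF that]] f(2)[OF that] by (intro LIMSEQ_le_const2) auto
  have Gm: "G x \<in> borel_measurable (borel_on X)"
    using G_continuous2[OF x] by (rule borel_measurable_continuous_on_restrict)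
  show "(\<lambda>n. gibbs_op \<rho> (f n) x) \<longlonglongrightarrow> gibbs_op \<rho> h x"
    unfolding gibbs_op_def
  proof (rule integral_dominated_convergence[where w = "\<lambda>_. B"])
    show "(\<lambda>y. G x y * h y) \<in> borel_measurable \<rho>"
      by (rule meas) (use h Gm in measurable)
    show "(\<lambda>y. G x y * f n y) \<in> borel_measurable \<rho>" for n
      by (rule meas) (use borel_measurable_continuous_on_restrict[OF f(1)[of n]] Gm in measurable)
    show "AE y in \<rho>. (\<lambda>n. G x y * f n y) \<longlonglongrightarrow> G x y * h y"
      using lim sp by (intro AE_I2 tendsto_intros) auto
    show "AE y in \<rho>. norm (G x y * f n y) \<le> B" for n
    proof (rule AE_I2)
      fix y assume "y \<in> space \<rho>"
      then have y: "y \<in> X" using sp by simp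
      have "\<bar>G x y\<bar> * \<bar>f n y\<bar> \<le> 1 * B"
        using G_pos[OF x y] G_le[OF x y] f(2)[OF y] by (intro mult_mono) auto
      then show "norm (G x y * f n y) \<le> B" by (simp add: abs_mult)
    qed
  qed simp
qed

text \<open>The limit of the products keeps their product form, and by dominated convergence both of its
  marginal equations hold. This yields a pair of positive solutions, which is then symmetrised.\<close>
lemma sinkhorn_converges:
  assumes rho: "\<rho> \<in> prob_measures_on X"
  shows "\<exists>w. scaling \<rho> w \<and>
    (\<forall>x\<in>X. \<forall>y\<in>X. (\<lambda>n. sinkhorn \<rho> n x * sinkhorn \<rho> (Suc n) y) \<longlonglongrightarrow> w x * w y)"
proof -
  define v where "v = sinkhorn \<rho>"
  have pv: "pos_cont (v n)" for n unfolding v_def by (rule sinkhorn_pos_cont[OF rho])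
  have vp: "0 < v n x" if "x \<in> X" for x n using pv that by (auto simp: pos_cont_def)
  have vc: "continuous_on X (v n)" for n using pv by (auto simp: pos_cont_def)
  have vS: "v (Suc n) y * gibbs_op \<rho> (v n) y = 1" if "y \<in> X" for n y
    using gibbs_op_pos_cont[OF rho pv[of n]] that by (force simp: v_def pos_cont_def)
  define s where "s n x y = v n x * v (Suc n) y" for n x y
  have sb: "0 < s n x y" "s n x y \<le> 1 / g\<^sup>2" if "x \<in> X" "y \<in> X" for n x y
    using sinkhorn_product_bounds[OF rho that] by (auto simp: s_def v_def simp del: sinkhorn.simps)
  then have sabs: "\<bar>s n x y\<bar> \<le> 1 / g\<^sup>2" if "x \<in> X" "y \<in> X" for n x y
    using that by (metis abs_of_pos)
  have "\<exists>S. \<forall>x\<in>X. \<forall>y\<in>X. 0 < S x y \<and> (\<lambda>n. s n x y) \<longlonglongrightarrow> S x y"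
    using sinkhorn_product_limit[OF rho] unfolding s_def v_def by metis
  then obtain S where S: "0 < S x y" "(\<lambda>n. s n x y) \<longlonglongrightarrow> S x y" if "x \<in> X" "y \<in> X" for x y
    by blast
  obtain x0 where x0: "x0 \<in> X" using nonempty by auto
  define a where "a x = S x x0" for x
  define b where "b y = S x0 y / S x0 x0" for y
  have fac: "S x y = a x * b y" if "x \<in> X" "y \<in> X" for x y
  proof -
    have "(\<lambda>n. s n x y * s n x0 x0) \<longlonglongrightarrow> S x y * S x0 x0"
      by (intro tendsto_intros S that x0)
    moreover have "(\<lambda>n. s n x x0 * s n x0 y) \<longlonglongrightarrow> S x x0 * S x0 y"
      by (intro tendsto_intros S that x0)
    moreover have "s n x y * s n x0 x0 = s n x x0 * s n x0 y" for n by (simp add: s_def)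
    ultimately have "S x y * S x0 x0 = S x x0 * S x0 y" using LIMSEQ_unique by simp
    then show ?thesis using S(1)[OF x0 x0] by (simp add: a_def b_def field_simps)
  qed
  have row: "gibbs_op \<rho> (S x) x = 1" if x: "x \<in> X" for x
  proof -
    have lim: "(\<lambda>n. gibbs_op \<rho> (s n x) x) \<longlonglongrightarrow> gibbs_op \<rho> (S x) x"
      by (rule gibbs_op_dominated_limit(3)[OF rho x, where B = "1 / g\<^sup>2"])
        (use sabs x S in \<open>auto simp: s_def intro!: continuous_intros vc\<close>)
    have "gibbs_op \<rho> (s n x) x = s n x x / s (Suc n) x x" for n
    proof -
      have "gibbs_op \<rho> (s n x) x = v n x * gibbs_op \<rho> (v (Suc n)) x"
        unfolding s_def by (rule gibbs_op_cmult)
      moreover have "gibbs_op \<rho> (v (Suc n)) x = 1 / v (Suc (Suc n)) x"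
        using vS[OF x, of "Suc n"] vp[OF x, of "Suc (Suc n)"] by (simp add: field_simps)
      ultimately show ?thesis using vp[OF x, of n] vp[OF x, of "Suc n"] by (simp add: s_def)
    qed
    then have "(\<lambda>n. s n x x / s (Suc n) x x) \<longlonglongrightarrow> gibbs_op \<rho> (S x) x"
      using lim by simp
    moreover have "(\<lambda>n. s n x x / s (Suc n) x x) \<longlonglongrightarrow> S x x / S x x"
      using S[OF x x] by (intro tendsto_divide LIMSEQ_Suc) auto
    ultimately have "gibbs_op \<rho> (S x) x = S x x / S x x" by (rule LIMSEQ_unique)
    then show ?thesis using S(1)[OF x x] by simp
  qed
  have col: "gibbs_op \<rho> (\<lambda>x. S x y) y = 1" if y: "y \<in> X" for y
  proof -
    have "(\<lambda>n. gibbs_op \<rho> (\<lambda>x. s n x y) y) \<longlonglongrightarrow> gibbs_op \<rho> (\<lambda>x. S x y) y"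
      by (rule gibbs_op_dominated_limit(3)[OF rho y, where B = "1 / g\<^sup>2"])
        (use sabs y S in \<open>auto simp: s_def intro!: continuous_intros vc\<close>)
    moreover have "gibbs_op \<rho> (\<lambda>x. s n x y) y = 1" for n
    proof -
      have "gibbs_op \<rho> (\<lambda>x. s n x y) y = v (Suc n) y * gibbs_op \<rho> (v n) y"
        unfolding s_def by (subst mult.commute) (rule gibbs_op_cmult)
      then show ?thesis using vS[OF y] by simp
    qed
    ultimately show ?thesis by (simp add: LIMSEQ_const_iff)
  qed
  have A: "a x * gibbs_op \<rho> b x = 1" if "x \<in> X" for x
  proof -
    have "gibbs_op \<rho> (S x) x = gibbs_op \<rho> (\<lambda>y. a x * b y) x"
      using fac[OF that] by (intro gibbs_op_cong[OF rho]) auto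
    then show ?thesis using row[OF that] by (simp add: gibbs_op_cmult)
  qed
  have B: "b y * gibbs_op \<rho> a y = 1" if "y \<in> X" for y
  proof -
    have "gibbs_op \<rho> (\<lambda>x. S x y) y = gibbs_op \<rho> (\<lambda>x. b y * a x) y"
      using fac[OF _ that] by (intro gibbs_op_cong[OF rho]) (auto simp: mult.commute)
    then show ?thesis using col[OF that] by (simp add: gibbs_op_cmult)
  qed
  have ab0: "0 < a x" "0 < b x" if "x \<in> X" for x using S x0 that by (simp_all add: a_def b_def)
  have am: "a \<in> borel_measurable (borel_on X)" "\<And>y. y \<in> X \<Longrightarrow> \<bar>a y\<bar> \<le> 1 / g\<^sup>2"
    by (rule gibbs_op_dominated_limit[OF rho x0, where f = "\<lambda>n x. s n x x0"];
      use sabs S x0 in \<open>auto simp: s_def a_def intro!: continuous_intros vc\<close>)+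
  have bm: "S x0 \<in> borel_measurable (borel_on X)" "\<And>y. y \<in> X \<Longrightarrow> \<bar>S x0 y\<bar> \<le> 1 / g\<^sup>2"
    by (rule gibbs_op_dominated_limit[OF rho x0, where f = "\<lambda>n y. s n x0 y"];
      use sabs S x0 in \<open>auto simp: s_def intro!: continuous_intros vc\<close>)+
  have bm': "b \<in> borel_measurable (borel_on X)" "\<And>y. y \<in> X \<Longrightarrow> \<bar>b y\<bar> \<le> 1 / g\<^sup>2 / S x0 x0"
  proof -
    show "b \<in> borel_measurable (borel_on X)" using bm(1) unfolding b_def by measurable
    show "\<bar>b y\<bar> \<le> 1 / g\<^sup>2 / S x0 x0" if "y \<in> X" for y
      using divide_right_mono[OF bm(2)[OF that], of "S x0 x0"] S(1)[OF x0 x0] by (simp add: b_def)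
  qed
  have inv: "continuous_on X f" if "continuous_on X h" "\<And>x. x \<in> X \<Longrightarrow> f x * h x = 1" for f h :: "'a \<Rightarrow> real"
  proof -
    have "h x \<noteq> 0 \<and> f x = 1 / h x" if "x \<in> X" for x
      using \<open>\<And>x. x \<in> X \<Longrightarrow> f x * h x = 1\<close>[OF that]
      by (metis mult_zero_right nonzero_eq_divide_eq zero_neq_one)
    then show ?thesis using that(1) by (auto intro!: continuous_intros cong: continuous_on_cong)
  qed
  have "pos_cont a" unfolding pos_cont_def
    using inv[OF gibbs_op_continuous[OF rho bm'] A] ab0 by blast
  moreover have "pos_cont b" unfolding pos_cont_def
    using inv[OF gibbs_op_continuous[OF rho am] B] ab0 by blast
  ultimately obtain w where w: "scaling \<rho> w" "\<And>x y. x \<in> X \<Longrightarrow> y \<in> X \<Longrightarrow> a x * b y = w x * w y"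
    using symmetrize_pair[OF rho _ _ A B] by metis
  have "(\<lambda>n. s n x y) \<longlonglongrightarrow> w x * w y" if "x \<in> X" "y \<in> X" for x y
    using S(2)[OF that] fac[OF that] w(2)[OF that] by simp
  with w(1) show ?thesis unfolding s_def v_def by blast
qed

end

section \<open>Entropic self-transport kernels\<close>

lemma exp_neg_lipschitz: "\<bar>exp (- s) - exp (- t)\<bar> \<le> \<bar>s - t\<bar>" if "0 \<le> s" "0 \<le> t" for s t :: real
proof -
  have *: "exp (- s) - exp (- t) \<le> t - s" if "0 \<le> s" "s \<le> t" for s t :: real
  proof -
    have "1 - exp (- (t - s)) \<le> t - s" using exp_ge_add_one_self[of "- (t - s)"] by linarith
    moreover have "exp (- s) * (1 - exp (- (t - s))) \<le> 1 * (1 - exp (- (t - s)))"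
      using that by (intro mult_right_mono) auto
    moreover have "exp (- s) * (1 - exp (- (t - s))) = exp (- s) - exp (- t)"
      by (simp add: right_diff_distrib exp_add[symmetric])
    ultimately show ?thesis by simp
  qed
  show ?thesis
    using that *[of s t] *[of t s] by (cases "s \<le> t") (auto simp: abs_if not_le)
qed

locale eot_cost =
  fixes X :: "'a::euclidean_space set" and c :: "'a \<Rightarrow> 'a \<Rightarrow> real" and B Lip \<epsilon> :: real
  assumes compact_X: "compact X" and X_nonempty: "X \<noteq> {}"
    and c_continuous: "continuous_on (X \<times> X) (\<lambda>(x, y). c x y)"
    and c_nonneg: "\<And>x y. x \<in> X \<Longrightarrow> y \<in> X \<Longrightarrow> 0 \<le> c x y"
    and c_le: "\<And>x y. x \<in> X \<Longrightarrow> y \<in> X \<Longrightarrow> c x y \<le> B"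
    and c_sym: "\<And>x y. x \<in> X \<Longrightarrow> y \<in> X \<Longrightarrow> c x y = c y x"
    and c_lip: "\<And>x x' y. x \<in> X \<Longrightarrow> x' \<in> X \<Longrightarrow> y \<in> X \<Longrightarrow> \<bar>c x y - c x' y\<bar> \<le> Lip * dist x x'"
    and Lip_ge0: "0 \<le> Lip" and eps: "0 < \<epsilon>"
begin

abbreviation G :: "'a \<Rightarrow> 'a \<Rightarrow> real" where "G x y \<equiv> exp (- (c x y / \<epsilon>))"
abbreviation g :: real where "g \<equiv> exp (- (B / \<epsilon>))"

sublocale gibbs_kernel X G g "Lip / \<epsilon>"
proof
  show "compact X" "X \<noteq> {}" by (rule compact_X X_nonempty)+
  show "0 < g" by simp
  show "g \<le> G x y" if "x \<in> X" "y \<in> X" for x y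
    using c_le[OF that] eps by (simp add: divide_right_mono)
  show "G x y \<le> 1" if "x \<in> X" "y \<in> X" for x y
    using c_nonneg[OF that] eps by simp
  show "G x y = G y x" if "x \<in> X" "y \<in> X" for x y
    using c_sym[OF that] by simp
  show "\<bar>G x y - G x' y\<bar> \<le> Lip / \<epsilon> * dist x x'" if "x \<in> X" "x' \<in> X" "y \<in> X" for x x' y
  proof -
    have "\<bar>exp (- (c x y / \<epsilon>)) - exp (- (c x' y / \<epsilon>))\<bar> \<le> \<bar>c x y / \<epsilon> - c x' y / \<epsilon>\<bar>"
      using that c_nonneg eps by (intro exp_neg_lipschitz) auto
    also have "\<dots> = \<bar>c x y - c x' y\<bar> / \<epsilon>"
      using eps by (simp add: diff_divide_distrib[symmetric])
    also have "\<dots> \<le> Lip * dist x x' / \<epsilon>"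
      using c_lip[OF that] eps by (intro divide_right_mono) auto
    finally show ?thesis by simp
  qed
  show "0 \<le> Lip / \<epsilon>" using Lip_ge0 eps by simp
qed

lemma gibbs_op_exp: "gibbs_op \<rho> (\<lambda>y. exp (\<beta> y / \<epsilon>)) x = (LINT y|\<rho>. exp ((\<beta> y - c x y) / \<epsilon>))"
  unfolding gibbs_op_def by (simp add: exp_add[symmetric] diff_divide_distrib)

lemma gibbs_op_exp_sym:
  assumes rho: "\<rho> \<in> prob_measures_on X" and "y \<in> X"
  shows "gibbs_op \<rho> (\<lambda>x. exp (\<alpha> x / \<epsilon>)) y = (LINT x|\<rho>. exp ((\<alpha> x - c x y) / \<epsilon>))"
  unfolding gibbs_op_exp
  using assms prob_measures_onD(3)[OF rho] c_sym by (intro Bochner_Integration.integral_cong) auto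

text \<open>After exponentiation the two fixed-point equations of the potentials say that
  \<open>exp (\<alpha> / \<epsilon>)\<close> and \<open>exp (\<beta> / \<epsilon>)\<close> form a pair as in \<open>symmetrize_pair\<close>.\<close>
lemma eot_potentials_scaling:
  assumes rho: "\<rho> \<in> prob_measures_on X" and pot: "eot_potentials X c \<epsilon> \<rho> \<rho> \<alpha> \<beta>"
  obtains w where "scaling \<rho> w"
    "\<And>x y. x \<in> X \<Longrightarrow> y \<in> X \<Longrightarrow> exp ((\<alpha> x + \<beta> y - c x y) / \<epsilon>) = G x y * w x * w y"
proof -
  define a b where "a x = exp (\<alpha> x / \<epsilon>)" and "b x = exp (\<beta> x / \<epsilon>)" for x
  have ab: "continuous_on X \<alpha>" "continuous_on X \<beta>"
    using pot unfolding eot_potentials_def by blast+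
  have pos: "pos_cont a" "pos_cont b"
    unfolding pos_cont_def a_def b_def using eps by (auto intro!: continuous_intros ab)
  have inv: "exp (u / \<epsilon>) * I = 1" if "u = - \<epsilon> * ln I" "0 < I" for u I
    using that eps by (simp add: exp_minus)
  have A: "a x * gibbs_op \<rho> b x = 1" if "x \<in> X" for x
  proof -
    have "\<alpha> x = - \<epsilon> * ln (gibbs_op \<rho> b x)"
      using pot that unfolding b_def gibbs_op_exp eot_potentials_def by blast
    then show ?thesis
      unfolding a_def using gibbs_op_pos_cont[OF rho pos(2)] that by (intro inv) (auto simp: pos_cont_def)
  qed
  have Bb: "b x * gibbs_op \<rho> a x = 1" if "x \<in> X" for x
  proof -
    have "\<beta> x = - \<epsilon> * ln (gibbs_op \<rho> a x)"
      using pot that unfolding a_def gibbs_op_exp_sym[OF rho that] eot_potentials_def by blast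
    then show ?thesis
      unfolding b_def using gibbs_op_pos_cont[OF rho pos(1)] that by (intro inv) (auto simp: pos_cont_def)
  qed
  obtain w where w: "scaling \<rho> w" "\<And>x y. x \<in> X \<Longrightarrow> y \<in> X \<Longrightarrow> a x * b y = w x * w y"
    using symmetrize_pair[OF rho pos A Bb] by metis
  have "exp ((\<alpha> x + \<beta> y - c x y) / \<epsilon>) = G x y * (a x * b y)" for x y
    unfolding a_def b_def by (simp add: exp_add[symmetric] add_divide_distrib diff_divide_distrib)
  with w show thesis by (intro that[of w]) (auto simp: mult.assoc)
qed

lemma G_continuous: "continuous_on (X \<times> X) (\<lambda>p. G (fst p) (snd p))"
  using c_continuous eps by (intro continuous_intros) (auto simp: case_prod_beta)

lemma continuous_on_fst_snd:
  assumes "continuous_on X f"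
  shows "continuous_on (X \<times> X) (\<lambda>p. f (fst p))" "continuous_on (X \<times> X) (\<lambda>p. f (snd p))"
  by (intro continuous_on_compose2[OF assms] continuous_intros; auto)+

text \<open>Let \<open>k\<close> be the kernel of the scaling and write the competitor relative to it with \<open>\<phi>\<close> and \<open>\<psi>\<close>. By
  \<open>1 + t \<le> exp t\<close> the penalty increases by at least \<open>\<integral> k (\<phi> + \<psi>)\<close>, which equals \<open>\<integral> \<phi> + \<integral> \<psi>\<close> because both
  marginals of \<open>k d(\<rho> \<otimes> \<rho>)\<close> are \<open>\<rho>\<close>, and this is the whole gain of the linear part.\<close>
lemma dual_optimal:
  assumes rho: "\<rho> \<in> prob_measures_on X" and w: "scaling \<rho> w"
    and a: "continuous_on X a" and b: "continuous_on X b"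
  shows "eot_dual c \<epsilon> \<rho> \<rho> a b \<le> eot_dual c \<epsilon> \<rho> \<rho> (\<lambda>x. \<epsilon> * ln (w x)) (\<lambda>x. \<epsilon> * ln (w x))"
proof -
  interpret r: prob_space \<rho> by (rule prob_measures_onD(1)[OF rho])
  interpret pair_prob_space \<rho> \<rho> ..
  note sp = prob_measures_onD(3)[OF rho]
  have wpos: "0 < w x" if "x \<in> X" for x using scaling_pos[OF w that] .
  have wc: "continuous_on X w" using scaling_continuous[OF w] .
  define \<alpha> where "\<alpha> x = \<epsilon> * ln (w x)" for x
  have ac: "continuous_on X \<alpha>" unfolding \<alpha>_def using wc wpos by (intro continuous_intros) force+
  define \<phi> where "\<phi> x = (a x - \<alpha> x) / \<epsilon>" for x
  define \<psi> where "\<psi> x = (b x - \<alpha> x) / \<epsilon>" for x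
  have fc: "continuous_on X \<phi>" "continuous_on X \<psi>"
    unfolding \<phi>_def \<psi>_def using eps by (auto intro!: continuous_intros ac a b)
  define k where "k p = w (fst p) * G (fst p) (snd p) * w (snd p)" for p
  have kc: "continuous_on (X \<times> X) k"
    unfolding k_def by (intro continuous_intros continuous_on_fst_snd wc G_continuous)
  define F where "F u v p = exp ((u (fst p) + v (snd p) - c (fst p) (snd p)) / \<epsilon>)" for u v :: "'a \<Rightarrow> real" and p
  have Fc: "continuous_on (X \<times> X) (F u v)" if "continuous_on X u" "continuous_on X v" for u v
    unfolding F_def using c_continuous eps
    by (intro continuous_intros continuous_on_fst_snd that) (auto simp: case_prod_beta)
  note int = integrable_continuous_on_Times[OF rho rho compact_X]
  have I: "integrable \<rho> f" if "continuous_on X f" for f :: "'a \<Rightarrow> real"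
    by (rule integrable_continuous_on[OF rho compact_X that])
  have Fk: "F a b p = k p * exp (\<phi> (fst p) + \<psi> (snd p))" "F \<alpha> \<alpha> p = k p" if "p \<in> X \<times> X" for p
  proof -
    have 1: "w z = exp (\<alpha> z / \<epsilon>)" if "z \<in> X" for z using wpos[OF that] eps by (simp add: \<alpha>_def)
    have z: "fst p \<in> X" "snd p \<in> X" using that by auto
    show "F \<alpha> \<alpha> p = k p"
      unfolding F_def k_def 1[OF z(1)] 1[OF z(2)]
      by (simp add: exp_add[symmetric] add_divide_distrib diff_divide_distrib)
    have "F a b p = F \<alpha> \<alpha> p * exp (\<phi> (fst p) + \<psi> (snd p))"
      unfolding F_def \<phi>_def \<psi>_def exp_add[symmetric] add_divide_distrib[symmetric] by (simp add: algebra_simps)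
    with \<open>F \<alpha> \<alpha> p = k p\<close> show "F a b p = k p * exp (\<phi> (fst p) + \<psi> (snd p))" by simp
  qed
  have k0: "0 < k p" if "p \<in> X \<times> X" for p unfolding k_def using that wpos by auto
  have c1: "continuous_on (X \<times> X) (\<lambda>p. k p * \<phi> (fst p))" "continuous_on (X \<times> X) (\<lambda>p. k p * \<psi> (snd p))"
    by (intro continuous_intros kc continuous_on_fst_snd fc)+
  have row: "(LINT p|(\<rho> \<Otimes>\<^sub>M \<rho>). k p * \<phi> (fst p)) = integral\<^sup>L \<rho> \<phi>"
  proof -
    have "(LINT p|(\<rho> \<Otimes>\<^sub>M \<rho>). k p * \<phi> (fst p)) = (LINT x|\<rho>. LINT y|\<rho>. k (x, y) * \<phi> x)"
      using integral_fst'[OF int[OF c1(1)]] by simp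
    also have "\<dots> = (LINT x|\<rho>. \<phi> x)"
    proof (intro Bochner_Integration.integral_cong refl)
      fix x assume "x \<in> space \<rho>"
      then have x: "x \<in> X" using sp by simp
      have "(LINT y|\<rho>. k (x, y) * \<phi> x) = (LINT y|\<rho>. (w x * \<phi> x) * (G x y * w y))"
        by (simp add: k_def ac_simps)
      also have "\<dots> = (w x * \<phi> x) * gibbs_op \<rho> w x"
        unfolding gibbs_op_def by (rule integral_mult_right_zero)
      also have "\<dots> = (w x * gibbs_op \<rho> w x) * \<phi> x" by (simp only: ac_simps)
      finally show "(LINT y|\<rho>. k (x, y) * \<phi> x) = \<phi> x" using scaling_eq[OF w x] by simp
    qed
    finally show ?thesis .
  qed
  have col: "(LINT p|(\<rho> \<Otimes>\<^sub>M \<rho>). k p * \<psi> (snd p)) = integral\<^sup>L \<rho> \<psi>"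
  proof -
    have "(LINT p|(\<rho> \<Otimes>\<^sub>M \<rho>). k p * \<psi> (snd p)) = (LINT y|\<rho>. LINT x|\<rho>. k (x, y) * \<psi> y)"
      using integral_snd[of "\<lambda>x y. k (x, y) * \<psi> y"] int[OF c1(2)] by (simp add: case_prod_beta')
    also have "\<dots> = (LINT y|\<rho>. \<psi> y)"
    proof (intro Bochner_Integration.integral_cong refl)
      fix y assume "y \<in> space \<rho>"
      then have y: "y \<in> X" using sp by simp
      have "(LINT x|\<rho>. k (x, y) * \<psi> y) = (LINT x|\<rho>. (w y * \<psi> y) * (G y x * w x))"
        using sp y c_sym[OF y] by (intro Bochner_Integration.integral_cong) (auto simp: k_def)
      also have "\<dots> = (w y * \<psi> y) * gibbs_op \<rho> w y"
        unfolding gibbs_op_def by (rule integral_mult_right_zero)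
      also have "\<dots> = (w y * gibbs_op \<rho> w y) * \<psi> y" by (simp only: ac_simps)
      finally show "(LINT x|\<rho>. k (x, y) * \<psi> y) = \<psi> y" using scaling_eq[OF w y] by simp
    qed
    finally show ?thesis .
  qed
  have "integral\<^sup>L \<rho> \<phi> + integral\<^sup>L \<rho> \<psi> = (LINT p|(\<rho> \<Otimes>\<^sub>M \<rho>). k p * \<phi> (fst p) + k p * \<psi> (snd p))"
    using int[OF c1(1)] int[OF c1(2)] by (simp add: row col)
  also have "\<dots> \<le> (LINT p|(\<rho> \<Otimes>\<^sub>M \<rho>). (F a b p - 1) - (F \<alpha> \<alpha> p - 1))"
  proof (rule integral_mono)
    fix p assume "p \<in> space (\<rho> \<Otimes>\<^sub>M \<rho>)"
    then have p: "p \<in> X \<times> X" using sp by (auto simp: space_pair_measure)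
    have "k p * (\<phi> (fst p) + \<psi> (snd p)) \<le> k p * (exp (\<phi> (fst p) + \<psi> (snd p)) - 1)"
    proof (rule mult_left_mono)
      show "\<phi> (fst p) + \<psi> (snd p) \<le> exp (\<phi> (fst p) + \<psi> (snd p)) - 1"
        using exp_ge_add_one_self[of "\<phi> (fst p) + \<psi> (snd p)"] by linarith
    qed (use k0[OF p] in simp)
    then show "k p * \<phi> (fst p) + k p * \<psi> (snd p) \<le> (F a b p - 1) - (F \<alpha> \<alpha> p - 1)"
      unfolding Fk[OF p] by (simp add: algebra_simps)
  qed (use int[OF c1(1)] int[OF c1(2)] int[OF Fc[OF a b]] int[OF Fc[OF ac ac]] in simp_all)
  also have "\<dots> = (LINT p|(\<rho> \<Otimes>\<^sub>M \<rho>). F a b p - 1) - (LINT p|(\<rho> \<Otimes>\<^sub>M \<rho>). F \<alpha> \<alpha> p - 1)"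
    using int[OF Fc[OF a b]] int[OF Fc[OF ac ac]] by (intro Bochner_Integration.integral_diff) auto
  finally have "integral\<^sup>L \<rho> \<phi> + integral\<^sup>L \<rho> \<psi>
      \<le> (LINT p|(\<rho> \<Otimes>\<^sub>M \<rho>). F a b p - 1) - (LINT p|(\<rho> \<Otimes>\<^sub>M \<rho>). F \<alpha> \<alpha> p - 1)" .
  from mult_left_mono[OF this less_imp_le[OF eps]]
  have "\<epsilon> * integral\<^sup>L \<rho> \<phi> + \<epsilon> * integral\<^sup>L \<rho> \<psi>
      \<le> \<epsilon> * (LINT p|(\<rho> \<Otimes>\<^sub>M \<rho>). F a b p - 1) - \<epsilon> * (LINT p|(\<rho> \<Otimes>\<^sub>M \<rho>). F \<alpha> \<alpha> p - 1)"
    by (simp add: algebra_simps)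
  moreover have "\<epsilon> * integral\<^sup>L \<rho> \<phi> = integral\<^sup>L \<rho> a - integral\<^sup>L \<rho> \<alpha>"
    "\<epsilon> * integral\<^sup>L \<rho> \<psi> = integral\<^sup>L \<rho> b - integral\<^sup>L \<rho> \<alpha>"
    unfolding \<phi>_def \<psi>_def using eps I[OF a] I[OF b] I[OF ac] by simp_all
  moreover have "eot_dual c \<epsilon> \<rho> \<rho> u v = integral\<^sup>L \<rho> u + integral\<^sup>L \<rho> v - \<epsilon> * (LINT p|(\<rho> \<Otimes>\<^sub>M \<rho>). F u v p - 1)" for u v
    unfolding eot_dual_def F_def by (simp add: case_prod_beta')
  ultimately show ?thesis unfolding \<alpha>_def[symmetric, abs_def] by simp
qed

lemma scaling_eot_potentials:
  assumes rho: "\<rho> \<in> prob_measures_on X" and w: "scaling \<rho> w"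
  shows "eot_potentials X c \<epsilon> \<rho> \<rho> (\<lambda>x. \<epsilon> * ln (w x)) (\<lambda>x. \<epsilon> * ln (w x))"
proof -
  have wpos: "0 < w x" if "x \<in> X" for x using scaling_pos[OF w that] .
  have "continuous_on X (\<lambda>x. \<epsilon> * ln (w x))"
    using scaling_continuous[OF w] wpos by (intro continuous_intros) force+
  moreover have e: "gibbs_op \<rho> (\<lambda>y. exp (\<epsilon> * ln (w y) / \<epsilon>)) x = gibbs_op \<rho> w x" for x
    using wpos eps by (intro gibbs_op_cong[OF rho]) simp
  moreover have "\<epsilon> * ln (w x) = - \<epsilon> * ln (gibbs_op \<rho> w x)" if "x \<in> X" for x
  proof -
    have "gibbs_op \<rho> w x = 1 / w x" using scaling_eq[OF w that] wpos[OF that] by (simp add: field_simps)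
    then show ?thesis using wpos[OF that] by (simp add: ln_div)
  qed
  ultimately show ?thesis
    unfolding eot_potentials_def
    using dual_optimal[OF rho w] e gibbs_op_exp[of \<rho> "\<lambda>x. \<epsilon> * ln (w x)"]
      gibbs_op_exp_sym[OF rho, of _ "\<lambda>x. \<epsilon> * ln (w x)"] by simp
qed

text \<open>The scaling itself provides optimal potentials, so the choice in the definition of the kernel
  succeeds; whichever pair is chosen, its scaling is the given one by uniqueness.\<close>
lemma eot_kernel_eq:
  assumes rho: "\<rho> \<in> prob_measures_on X" and w: "scaling \<rho> w" and xy: "x \<in> X" "y \<in> X"
  shows "eot_kernel X c \<epsilon> \<rho> \<rho> x y = G x y * w x * w y"
proof -
  define S where "S = (SOME (\<alpha>, \<beta>). eot_potentials X c \<epsilon> \<rho> \<rho> \<alpha> \<beta>)"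
  have "(\<lambda>(\<alpha>, \<beta>). eot_potentials X c \<epsilon> \<rho> \<rho> \<alpha> \<beta>) S"
    unfolding S_def by (rule someI_ex) (use scaling_eot_potentials[OF rho w] in auto)
  then obtain \<alpha> \<beta> where S: "S = (\<alpha>, \<beta>)" "eot_potentials X c \<epsilon> \<rho> \<rho> \<alpha> \<beta>" by (cases S) auto
  obtain v where v: "scaling \<rho> v"
    "\<And>x y. x \<in> X \<Longrightarrow> y \<in> X \<Longrightarrow> exp ((\<alpha> x + \<beta> y - c x y) / \<epsilon>) = G x y * v x * v y"
    using eot_potentials_scaling[OF rho S(2)] by metis
  have "eot_kernel X c \<epsilon> \<rho> \<rho> x y = exp ((\<alpha> x + \<beta> y - c x y) / \<epsilon>)"
    unfolding eot_kernel_def S_def[symmetric] S(1) by simp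
  then show ?thesis
    using v(2)[OF xy] scaling_unique[OF rho w v(1)] xy by simp
qed

end

section \<open>Uniform deviation of empirical means\<close>

lemma indep_vars_PiM_coordinates:
  assumes "prob_space \<pi>" "I \<noteq> {}"
  shows "prob_space.indep_vars (\<Pi>\<^sub>M i\<in>I. \<pi>) (\<lambda>_. \<pi>) (\<lambda>i z. z i) I"
proof -
  interpret P: prob_space "\<Pi>\<^sub>M i\<in>I. \<pi>" by (intro prob_space_PiM assms)
  have "distr (\<Pi>\<^sub>M i\<in>I. \<pi>) (\<Pi>\<^sub>M i\<in>I. \<pi>) (\<lambda>z. \<lambda>i\<in>I. z i) = distr (\<Pi>\<^sub>M i\<in>I. \<pi>) (\<Pi>\<^sub>M i\<in>I. \<pi>) (\<lambda>z. z)"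
    by (intro distr_cong) (auto simp: space_PiM)
  also have "\<dots> = (\<Pi>\<^sub>M i\<in>I. distr (\<Pi>\<^sub>M i\<in>I. \<pi>) \<pi> (\<lambda>z. z i))"
    by (subst distr_id) (intro PiM_cong refl distr_PiM_component[symmetric] assms)
  finally show ?thesis
    using assms by (subst P.indep_vars_iff_distr_eq_PiM') auto
qed

definition deviation :: "'b measure \<Rightarrow> nat \<Rightarrow> (nat \<Rightarrow> 'b) \<Rightarrow> ('b \<Rightarrow> real) \<Rightarrow> real" where
  "deviation \<pi> N z f = (\<Sum>i<N. f (z i)) / N - integral\<^sup>L \<pi> f"

lemma hoeffding_deviation:
  assumes pi: "prob_space \<pi>" and f: "f \<in> borel_measurable \<pi>" "\<And>\<omega>. \<omega> \<in> space \<pi> \<Longrightarrow> \<bar>f \<omega>\<bar> \<le> b"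
    and "0 < b" "0 \<le> t" "0 < N"
  shows "measure (\<Pi>\<^sub>M i\<in>{..<N}. \<pi>) {z \<in> space (\<Pi>\<^sub>M i\<in>{..<N}. \<pi>). t \<le> \<bar>deviation \<pi> N z f\<bar>}
      \<le> 2 * exp (- (real N * t\<^sup>2 / (2 * b\<^sup>2)))"
proof -
  define P where "P = (\<Pi>\<^sub>M i\<in>{..<N}. \<pi>)"
  interpret P: prob_space P unfolding P_def by (intro prob_space_PiM pi)
  have ne: "{..<N} \<noteq> {}" using \<open>0 < N\<close> by auto
  have comp: "(\<lambda>z. z i) \<in> measurable P \<pi>" if "i < N" for i
    unfolding P_def using that by (intro measurable_component_singleton) auto
  have dist: "distr P \<pi> (\<lambda>z. z i) = \<pi>" if "i < N" for i
    unfolding P_def using that pi by (intro distr_PiM_component) auto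
  interpret H: Hoeffding_ineq_iid P "{..<N}" "\<lambda>i z. f (z i)" "\<lambda>z. f (z 0)" "- b" b "integral\<^sup>L \<pi> f"
  proof unfold_locales
    show "P.indep_vars (\<lambda>_. borel) (\<lambda>i z. f (z i)) {..<N}"
      using P.indep_vars_compose2[OF indep_vars_PiM_coordinates[OF pi ne, folded P_def], of "\<lambda>_. f" "\<lambda>_. borel"] f
      by simp
    have "distr P borel (\<lambda>z. f (z i)) = distr \<pi> borel f" if "i < N" for i
      using distr_distr[OF f(1) comp[OF that]] dist[OF that] by (simp add: comp_def)
    then show "distr P borel (\<lambda>z. f (z i)) = distr P borel (\<lambda>z. f (z 0))" if "i \<in> {..<N}" for i
      using that \<open>0 < N\<close> by auto
    show "P.random_variable borel (\<lambda>z. f (z 0))"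
      using measurable_compose[OF comp f(1)] \<open>0 < N\<close> by auto
    show "AE z in P. f (z 0) \<in> {- b..b}"
    proof (rule AE_I2)
      fix z assume "z \<in> space P"
      then have "z 0 \<in> space \<pi>" using measurable_space[OF comp[OF \<open>0 < N\<close>]] by auto
      then have "\<bar>f (z 0)\<bar> \<le> b" by (rule f(2))
      then show "f (z 0) \<in> {- b..b}" by auto
    qed
    have "P.expectation (\<lambda>z. f (z 0)) = integral\<^sup>L \<pi> f"
      using integral_distr[OF comp[OF \<open>0 < N\<close>] f(1)] dist[OF \<open>0 < N\<close>] by simp
    then show "integral\<^sup>L \<pi> f \<equiv> P.expectation (\<lambda>z. f (z 0))" by simp
  qed auto
  have "P.prob {z \<in> space P. t \<le> \<bar>(\<Sum>i<N. f (z i)) / N - integral\<^sup>L \<pi> f\<bar>} \<le> 2 * exp (- 2 * N * t\<^sup>2 / (b - (- b))\<^sup>2)"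
    using H.Hoeffding_ineq_abs_ge'[of t] assms ne by simp
  also have "- 2 * N * t\<^sup>2 / (b - (- b))\<^sup>2 = - (real N * t\<^sup>2 / (2 * b\<^sup>2))"
    using \<open>0 < b\<close> by (simp add: field_simps power2_eq_square)
  finally show ?thesis unfolding P_def deviation_def by simp
qed

text \<open>Cover the unit ball by finitely many, say \<open>q\<close>, balls of radius \<open>1 / 2\<close>. By scaling, every ball is
  covered by \<open>q\<close> balls of half its radius, so \<open>q ^ k\<close> balls of radius \<open>R / 2 ^ k\<close> cover \<open>X\<close>. Moving the
  centres into \<open>X\<close> doubles the distances.\<close>
lemma geometric_nets:
  fixes X :: "'a::euclidean_space set"
  assumes "compact X" "X \<noteq> {}"
  shows "\<exists>(q::nat) (D::real) (T :: nat \<Rightarrow> 'a set). 0 < q \<and> 0 < D \<and>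
    (\<forall>k. finite (T k) \<and> T k \<subseteq> X \<and> card (T k) \<le> q ^ k \<and> (\<forall>x\<in>X. \<exists>p\<in>T k. dist x p \<le> D / 2 ^ k))"
proof -
  have "\<exists>F. finite F \<and> cball (0::'a) 1 \<subseteq> (\<Union>p\<in>F. ball p (1 / 2))"
    using compact_cball[of "0::'a" 1] unfolding compact_eq_totally_bounded
    by (meson half_gt_zero zero_less_one)
  then obtain F where F: "finite F" "cball (0::'a) 1 \<subseteq> (\<Union>p\<in>F. ball p (1 / 2))" by auto
  have F0: "0 < card F"
    using F by (auto simp: card_gt_0_iff)
  obtain R where R: "0 < R" "\<And>x. x \<in> X \<Longrightarrow> norm x \<le> R"
    using compact_imp_bounded[OF assms(1)] unfolding bounded_pos by auto
  have "\<exists>S. finite S \<and> card S \<le> card F ^ k \<and> X \<subseteq> (\<Union>s\<in>S. cball s (R / 2 ^ k))" for k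
  proof (induction k)
    case 0
    show ?case using R by (intro exI[of _ "{0}"]) auto
  next
    case (Suc k)
    then obtain S where S: "finite S" "card S \<le> card F ^ k" "X \<subseteq> (\<Union>s\<in>S. cball s (R / 2 ^ k))" by blast
    define r where "r = R / 2 ^ k"
    have r: "0 < r" using R by (simp add: r_def)
    define S' where "S' = (\<lambda>(s, p). s + r *\<^sub>R p) ` (S \<times> F)"
    have "card S' \<le> card (S \<times> F)" unfolding S'_def by (intro card_image_le finite_cartesian_product S F)
    also have "\<dots> \<le> card F ^ Suc k" using S(2) by (simp add: card_cartesian_product)
    finally have c: "card S' \<le> card F ^ Suc k" .
    have "x \<in> (\<Union>s\<in>S'. cball s (R / 2 ^ Suc k))" if x: "x \<in> X" for x
    proof -
      obtain s where s: "s \<in> S" "dist s x \<le> r" using S(3) x by (auto simp: r_def)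
      define y where "y = (1 / r) *\<^sub>R (x - s)"
      have "norm y \<le> 1" using s(2) r by (simp add: y_def dist_norm norm_minus_commute)
      then obtain p where p: "p \<in> F" "dist p y < 1 / 2" using F(2) by auto
      have "dist (s + r *\<^sub>R p) x = norm (r *\<^sub>R (p - y))"
        using r by (simp add: dist_norm y_def algebra_simps)
      also have "\<dots> = r * dist p y" using r by (simp add: dist_norm)
      also have "\<dots> \<le> r * (1 / 2)" using p r by (intro mult_left_mono) auto
      finally have "dist (s + r *\<^sub>R p) x \<le> R / 2 ^ Suc k" by (simp add: r_def)
      then show ?thesis using s(1) p(1) by (force simp: S'_def)
    qed
    then show ?case using c S(1) F(1) by (intro exI[of _ S']) (auto simp: S'_def)
  qed
  then obtain S where S: "finite (S k)" "card (S k) \<le> card F ^ k" "X \<subseteq> (\<Union>s\<in>S k. cball s (R / 2 ^ k))" for k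
    by metis
  define c where "c k s = (SOME x. x \<in> X \<inter> cball s (R / 2 ^ k))" for k s
  define S' where "S' k = {s \<in> S k. X \<inter> cball s (R / 2 ^ k) \<noteq> {}}" for k
  have c: "c k s \<in> X \<inter> cball s (R / 2 ^ k)" if "s \<in> S' k" for k s
    unfolding c_def by (rule someI_ex) (use that in \<open>auto simp: S'_def\<close>)
  define T where "T k = c k ` S' k" for k
  have "finite (T k) \<and> T k \<subseteq> X \<and> card (T k) \<le> card F ^ k \<and> (\<forall>x\<in>X. \<exists>p\<in>T k. dist x p \<le> 2 * R / 2 ^ k)" for k
    unfolding T_def
  proof (intro conjI ballI)
    have fin: "finite (S' k)" using S(1)[of k] by (simp add: S'_def)
    then show "finite (c k ` S' k)" by simp
    show "c k ` S' k \<subseteq> X" using c by blast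
    have "card (c k ` S' k) \<le> card (S' k)" by (intro card_image_le fin)
    also have "\<dots> \<le> card (S k)" by (intro card_mono S) (auto simp: S'_def)
    finally show "card (c k ` S' k) \<le> card F ^ k" using S(2)[of k] by simp
    fix x assume x: "x \<in> X"
    obtain s where s: "s \<in> S k" "x \<in> cball s (R / 2 ^ k)" using S(3)[of k] x by auto
    then have "s \<in> S' k" using x by (auto simp: S'_def)
    moreover have "dist x (c k s) \<le> dist s x + dist s (c k s)" by metric
    ultimately show "\<exists>p\<in>c k ` S' k. dist x p \<le> 2 * R / 2 ^ k"
      using c[of s k] s(2) by (intro bexI[of _ "c k s"]) auto
  qed
  then have "0 < card F \<and> 0 < 2 * R \<and> (\<forall>k. finite (T k) \<and> T k \<subseteq> X \<and> card (T k) \<le> card F ^ k \<and>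
      (\<forall>x\<in>X. \<exists>p\<in>T k. dist x p \<le> 2 * R / 2 ^ k))"
    using F0 R(1) by simp
  then show ?thesis by (intro exI)
qed

lemma sum_arith_geometric_le: "(\<Sum>k<K. (real k + 1) / 2 ^ k) \<le> 4"
proof -
  have "(\<Sum>k<K. (real k + 1) / 2 ^ k) = 4 - (2 * real K + 4) / 2 ^ K"
  proof (induction K)
    case (Suc K)
    have "(2 * real K + 4) / 2 ^ K = 2 * (2 * real K + 4) / 2 ^ Suc K"
      unfolding power_Suc by (simp add: divide_simps)
    also have "\<dots> = (2 * real (Suc K) + 4) / 2 ^ Suc K + 2 * (real K + 1) / 2 ^ Suc K"
      by (simp only: add_divide_distrib[symmetric]) (simp add: algebra_simps)
    also have "2 * (real K + 1) / 2 ^ Suc K = (real K + 1) / 2 ^ K"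
      unfolding power_Suc by (rule mult_divide_mult_cancel_left) simp
    finally show ?case using Suc by simp
  qed simp
  then show ?thesis by simp
qed

lemma sum_geometric_quarter_le: "(\<Sum>k<K. \<tau> / 2 ^ (k + 2)) \<le> \<tau> / 2" if "0 < \<tau>" for \<tau> :: real
proof -
  have "(\<Sum>k<K. \<tau> / 2 ^ (k + 2)) = \<tau> / 2 - \<tau> / 2 ^ (K + 1)"
    by (induction K) (auto simp: field_simps)
  then show ?thesis using that by simp
qed

lemma ln_3_ge_1: "1 \<le> ln (3::real)"
  using exp_le by (simp add: ln_ge_iff)

definition lipschitz_class :: "'a::metric_space set \<Rightarrow> 'b measure \<Rightarrow> ('a \<Rightarrow> 'b \<Rightarrow> real) \<Rightarrow> real \<Rightarrow> real \<Rightarrow> bool" where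
  "lipschitz_class X \<pi> f b \<Lambda> \<longleftrightarrow>
     (\<forall>x\<in>X. f x \<in> borel_measurable \<pi> \<and> (\<forall>\<omega>\<in>space \<pi>. \<bar>f x \<omega>\<bar> \<le> b)) \<and>
     (\<forall>x\<in>X. \<forall>x'\<in>X. \<forall>\<omega>\<in>space \<pi>. \<bar>f x \<omega> - f x' \<omega>\<bar> \<le> \<Lambda> * dist x x')"

text \<open>Chaining. A point \<open>x\<close> is approached through its nearest points \<open>y\<^sub>k\<close> in nets of mesh \<open>D / 2 ^ k\<close>. The
  link from \<open>y\<^sub>k\<close> to \<open>y\<^sub>k\<^sub>+\<^sub>1\<close> changes the function by at most \<open>b\<^sub>k = 2 D \<Lambda> / 2 ^ k\<close>, and Hoeffding's inequality bounds
  its deviation by \<open>b\<^sub>k a (k + 1) ln (3 / \<tau>) / sqrt N\<close>, where \<open>a\<close> is large enough for a union bound over the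
  at most \<open>q ^ (2 k + 1)\<close> links of level \<open>k\<close>. These bounds have a finite sum over \<open>k\<close> because \<open>(k + 1) / 2 ^ k\<close>
  does. After \<open>N\<close> levels the remaining distance is below \<open>D / sqrt N\<close> and is treated by the Lipschitz bound
  alone.\<close>
lemma uniform_deviation:
  fixes X :: "'a::euclidean_space set"
  assumes "compact X" "X \<noteq> {}"
  shows "\<exists>A>0. \<forall>(\<pi> :: 'b measure) f b \<Lambda>. prob_space \<pi> \<longrightarrow> lipschitz_class X \<pi> f b \<Lambda> \<longrightarrow> 0 < b \<longrightarrow> 0 < \<Lambda> \<longrightarrow>
    (\<forall>N \<tau>. 0 < N \<longrightarrow> 0 < \<tau> \<longrightarrow> \<tau> < 1 \<longrightarrow>
      (\<exists>E \<in> sets (\<Pi>\<^sub>M i\<in>{..<N}. \<pi>). 1 - \<tau> \<le> measure (\<Pi>\<^sub>M i\<in>{..<N}. \<pi>) E \<and>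
        (\<forall>z\<in>E. \<forall>x\<in>X. \<bar>deviation \<pi> N z (f x)\<bar> \<le> A * (b + \<Lambda>) * (ln (3 / \<tau>) / sqrt N))))"
proof -
  obtain q :: nat and D :: real and T :: "nat \<Rightarrow> 'a set" where q: "0 < q" and D: "0 < D"
    and nets: "\<forall>k. finite (T k) \<and> T k \<subseteq> X \<and> card (T k) \<le> q ^ k \<and> (\<forall>x\<in>X. \<exists>p\<in>T k. dist x p \<le> D / 2 ^ k)"
    using geometric_nets[OF assms] by (elim exE conjE) rule
  have T: "finite (T k)" "T k \<subseteq> X" "card (T k) \<le> q ^ k" for k using nets by blast+
  have near: "\<exists>p\<in>T k. dist x p \<le> D / 2 ^ k" if "x \<in> X" for x k using nets that by blast
  define a where "a = 8 + 4 * ln (real q)"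
  have lnq: "0 \<le> ln (real q)" using q by simp
  then have a: "8 \<le> a" by (simp add: a_def)
  obtain p0 where p0: "T 0 = {p0}"
  proof -
    have "T 0 \<noteq> {}" using near[of _ 0] assms(2) by blast
    then have "card (T 0) = 1" using T(3)[of 0] T(1)[of 0] by (simp add: card_gt_0_iff le_Suc_eq)
    then show thesis using that by (metis card_1_singletonE)
  qed
  have p0X: "p0 \<in> X" using T(2)[of 0] p0 by auto
  define A where "A = 2 + 8 * D * a + 2 * D"
  have main: "\<exists>E \<in> sets (\<Pi>\<^sub>M i\<in>{..<N}. \<pi>). 1 - \<tau> \<le> measure (\<Pi>\<^sub>M i\<in>{..<N}. \<pi>) E \<and>
        (\<forall>z\<in>E. \<forall>x\<in>X. \<bar>deviation \<pi> N z (f x)\<bar> \<le> A * (b + \<Lambda>) * (ln (3 / \<tau>) / sqrt N))"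
    if pi: "prob_space \<pi>" and f: "lipschitz_class X \<pi> f b \<Lambda>"
      and b: "0 < b" and \<Lambda>: "0 < \<Lambda>" and N: "0 < N" and \<tau>: "0 < \<tau>" "\<tau> < 1"
    for \<pi> :: "'b measure" and f b \<Lambda> N \<tau>
  proof -
    have fm: "f x \<in> borel_measurable \<pi>" if "x \<in> X" for x
      using f that unfolding lipschitz_class_def by blast
    have fb: "\<bar>f x \<omega>\<bar> \<le> b" if "x \<in> X" "\<omega> \<in> space \<pi>" for x \<omega>
      using f that unfolding lipschitz_class_def by blast
    have fl: "\<bar>f x \<omega> - f x' \<omega>\<bar> \<le> \<Lambda> * dist x x'" if "x \<in> X" "x' \<in> X" "\<omega> \<in> space \<pi>" for x x' \<omega>
      using f that unfolding lipschitz_class_def by blast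
    define P where "P = (\<Pi>\<^sub>M i\<in>{..<N}. \<pi>)"
    interpret P: prob_space P unfolding P_def by (intro prob_space_PiM pi)
    interpret pi: prob_space \<pi> by (rule pi)
    define Z where "Z z h = deviation \<pi> N z h" for z h
    define l where "l = ln (3 / \<tau>)"
    have l: "1 \<le> l"
    proof -
      have "ln 3 \<le> ln (3 / \<tau>)" using \<tau> by (intro ln_mono) (auto simp: pos_le_divide_eq)
      then show ?thesis using ln_3_ge_1 by (simp add: l_def)
    qed
    have expl: "exp (- l) = \<tau> / 3" using \<tau> by (simp add: l_def exp_minus)
    have sN: "0 < sqrt N" using N by simp
    have comp: "(\<lambda>z. z i) \<in> measurable P \<pi>" if "i < N" for i
      unfolding P_def using that by (intro measurable_component_singleton) auto
    have Zm: "(\<lambda>z. Z z h) \<in> borel_measurable P" if "h \<in> borel_measurable \<pi>" for h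
      unfolding Z_def deviation_def using measurable_compose[OF comp that] by measurable
    have fint: "integrable \<pi> (f x)" if "x \<in> X" for x
      using fb[OF that] fm[OF that] by (intro pi.integrable_const_bound[where B = b]) auto
    have Zdiff: "Z z (f x) - Z z (f y) = Z z (\<lambda>\<omega>. f x \<omega> - f y \<omega>)" if "x \<in> X" "y \<in> X" for x y z
      using fint that by (simp add: Z_def deviation_def sum_subtractf diff_divide_distrib)
    have Zbound: "\<bar>Z z h\<bar> \<le> 2 * u"
      if z: "z \<in> space P" and hm: "h \<in> borel_measurable \<pi>" and h: "\<And>\<omega>. \<omega> \<in> space \<pi> \<Longrightarrow> \<bar>h \<omega>\<bar> \<le> u" for z h u
    proof -
      have "integrable \<pi> h" using h hm by (intro pi.integrable_const_bound[where B = u]) auto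
      then have "- u \<le> integral\<^sup>L \<pi> h" "integral\<^sup>L \<pi> h \<le> u"
        using h by (auto intro!: pi.integral_ge_const pi.integral_le_const AE_I2 simp: abs_le_iff minus_le_iff)
      moreover have "\<bar>\<Sum>i<N. h (z i)\<bar> \<le> (\<Sum>i<N. u)"
        using h measurable_space[OF comp z] by (intro order_trans[OF sum_abs sum_mono]) auto
      then have "\<bar>\<Sum>i<N. h (z i)\<bar> / N \<le> u" using N by (simp add: divide_le_eq mult.commute)
      then have "\<bar>(\<Sum>i<N. h (z i)) / N\<bar> \<le> u" by simp
      ultimately show ?thesis unfolding Z_def deviation_def by linarith
    qed
    define bk where "bk k = 2 * D * \<Lambda> / 2 ^ k" for k :: nat
    define tk where "tk k = bk k * (a * (real k + 1) * l) / sqrt N" for k :: nat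
    define t0 where "t0 = 2 * b * l / sqrt N"
    define Pk where "Pk k = {(x, y) \<in> T k \<times> T (Suc k). dist x y \<le> 2 * D / 2 ^ k}" for k
    define bad where "bad k x y = {z \<in> space P. tk k \<le> \<bar>Z z (\<lambda>\<omega>. f x \<omega> - f y \<omega>)\<bar>}" for k x y
    define bad0 where "bad0 = {z \<in> space P. t0 \<le> \<bar>Z z (f p0)\<bar>}"
    define K where "K = N"
    define Bad where "Bad = bad0 \<union> (\<Union>k<K. \<Union>(x, y)\<in>Pk k. bad k x y)"
    have bk: "0 < bk k" for k using D \<Lambda> by (simp add: bk_def)
    have Pk_fin: "finite (Pk k)" for k
      by (rule finite_subset[of _ "T k \<times> T (Suc k)"]) (auto simp: Pk_def T)
    have Pk_card: "card (Pk k) \<le> q ^ (2 * k + 1)" for k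
    proof -
      have "card (Pk k) \<le> card (T k \<times> T (Suc k))" by (intro card_mono) (auto simp: Pk_def T)
      also have "\<dots> \<le> q ^ k * q ^ Suc k" unfolding card_cartesian_product by (intro mult_mono T) auto
      also have "\<dots> = q ^ (2 * k + 1)" by (simp add: power_add mult_2)
      finally show ?thesis .
    qed
    have PkX: "x \<in> X" "y \<in> X" if "(x, y) \<in> Pk k" for x y k using that T(2) by (auto simp: Pk_def)
    have meas_diff: "(\<lambda>\<omega>. f x \<omega> - f y \<omega>) \<in> borel_measurable \<pi>" if "x \<in> X" "y \<in> X" for x y
      using fm that by measurable
    have bad_sets: "bad k x y \<in> sets P" if "x \<in> X" "y \<in> X" for k x y
      using Zm[OF meas_diff[OF that]] unfolding bad_def by measurable
    have bad0_sets: "bad0 \<in> sets P"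
      using Zm[OF fm[OF p0X]] unfolding bad0_def by measurable
    have UN_sets: "(\<Union>(x, y)\<in>Pk k. bad k x y) \<in> sets P" for k
      using bad_sets PkX Pk_fin by (intro sets.finite_UN) auto
    have UN_K_sets: "(\<Union>k<K. \<Union>(x, y)\<in>Pk k. bad k x y) \<in> sets P"
      by (rule sets.finite_UN[OF finite_lessThan UN_sets])
    have Bad_sets: "Bad \<in> sets P"
      unfolding Bad_def by (rule sets.Un[OF bad0_sets UN_K_sets])
    have prob_bad: "P.prob (bad k x y) \<le> 2 * exp (- ((a * (real k + 1) * l)\<^sup>2 / 2))" if "(x, y) \<in> Pk k" for k x y
    proof -
      note xy = PkX[OF that]
      have "P.prob (bad k x y) \<le> 2 * exp (- (real N * (tk k)\<^sup>2 / (2 * (bk k)\<^sup>2)))"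
        unfolding bad_def Z_def P_def
      proof (rule hoeffding_deviation[OF pi meas_diff[OF xy] _ bk _ N])
        show "0 \<le> tk k" using bk[of k] l a sN by (simp add: tk_def)
        fix \<omega> assume "\<omega> \<in> space \<pi>"
        then have "\<bar>f x \<omega> - f y \<omega>\<bar> \<le> \<Lambda> * dist x y" by (intro fl xy)
        also have "\<dots> \<le> \<Lambda> * (2 * D / 2 ^ k)" using that \<Lambda> by (intro mult_left_mono) (auto simp: Pk_def)
        finally show "\<bar>f x \<omega> - f y \<omega>\<bar> \<le> bk k" by (simp add: bk_def ac_simps)
      qed
      also have "real N * (tk k)\<^sup>2 / (2 * (bk k)\<^sup>2) = (a * (real k + 1) * l)\<^sup>2 / 2"
        using bk[of k] N by (simp add: tk_def power_mult_distrib power_divide)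
      finally show ?thesis .
    qed
    have level: "P.prob (\<Union>(x, y)\<in>Pk k. bad k x y) \<le> \<tau> / 2 ^ (k + 2)" for k
    proof -
      define n where "n = real k + 1"
      have n: "1 \<le> n" by (simp add: n_def)
      have "P.prob (\<Union>p\<in>Pk k. case p of (x, y) \<Rightarrow> bad k x y) \<le> (\<Sum>p\<in>Pk k. P.prob (case p of (x, y) \<Rightarrow> bad k x y))"
        using bad_sets PkX by (intro P.finite_measure_subadditive_finite Pk_fin) auto
      also have "\<dots> \<le> (\<Sum>p\<in>Pk k. 2 * exp (- ((a * n * l)\<^sup>2 / 2)))"
        unfolding n_def using prob_bad by (intro sum_mono) auto
      also have "\<dots> = card (Pk k) * (2 * exp (- ((a * n * l)\<^sup>2 / 2)))" by simp
      also have "\<dots> \<le> real q ^ (2 * k + 1) * (2 * (inverse (real q ^ (2 * k + 2)) * (\<tau> / 3 * (1 / 8) ^ (k + 1))))"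
      proof (rule mult_mono)
        show "real (card (Pk k)) \<le> real q ^ (2 * k + 1)"
          using Pk_card[of k] by (metis of_nat_le_iff of_nat_power)
        have nl: "1 * 1 \<le> n * l" using n l by (intro mult_mono) auto
        \<comment> \<open>On the left, the first term pays for the number of links, \<open>l\<close> produces the factor \<open>\<tau> / 3\<close>, and
          \<open>3 * n\<close> makes the levels summable.\<close>
        have "ln (real q) * (2 * n) + (l + 3 * n) \<le> (a * n * l)\<^sup>2 / 2"
        proof -
          have 1: "n \<le> n * l" using n l by (simp add: mult_le_cancel_left1)
          have 2: "l \<le> n * l" using n l by (simp add: mult_le_cancel_right1)
          have "ln (real q) * (2 * n) \<le> ln (real q) * (2 * (n * l))" using 1 lnq by (intro mult_left_mono) auto
          then have "ln (real q) * (2 * n) + (l + 3 * n) \<le> (a / 2) * (n * l)"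
            using 1 2 unfolding a_def by (simp add: algebra_simps)
          also have "\<dots> \<le> (a * a / 2) * ((n * l) * (n * l))"
          proof (rule mult_mono)
            show "a / 2 \<le> a * a / 2" using a by (simp add: mult_le_cancel_left1)
            show "n * l \<le> n * l * (n * l)" using nl mult_left_mono[of 1 "n * l" "n * l"] by simp
          qed (use a nl in auto)
          also have "\<dots> = (a * n * l)\<^sup>2 / 2" by (simp add: power2_eq_square)
          finally show ?thesis .
        qed
        then have "exp (- ((a * n * l)\<^sup>2 / 2)) \<le> exp (- (ln (real q) * (2 * n)) + (- l + - (3 * n)))" by simp
        also have "\<dots> = exp (- (ln (real q) * (2 * n))) * (exp (- l) * exp (- (3 * n)))" by (simp only: exp_add)
        also have "exp (- (ln (real q) * (2 * n))) = inverse (real q ^ (2 * k + 2))"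
        proof -
          have "ln (real q) * (2 * n) = real (2 * k + 2) * ln (real q)" by (simp add: n_def)
          then show ?thesis using q by (simp only: exp_minus exp_of_nat_mult) simp
        qed
        also have "exp (- l) = \<tau> / 3" by (rule expl)
        finally have "exp (- ((a * n * l)\<^sup>2 / 2)) \<le> inverse (real q ^ (2 * k + 2)) * (\<tau> / 3 * exp (- (3 * n)))" .
        moreover have "exp (- (3 * n)) \<le> (1 / 8) ^ (k + 1)"
        proof -
          have "exp (- (3 * n)) = exp (- 1) ^ (3 * (k + 1))"
            unfolding exp_of_nat_mult[symmetric] by (simp add: n_def algebra_simps)
          also have "\<dots> \<le> (1 / 2) ^ (3 * (k + 1))"
            using exp_ge_add_one_self[of 1] by (intro power_mono) (auto simp: exp_minus field_simps)
          also have "\<dots> = (1 / 8) ^ (k + 1)" unfolding power_mult by (simp add: power3_eq_cube)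
          finally show ?thesis .
        qed
        then have "inverse (real q ^ (2 * k + 2)) * (\<tau> / 3 * exp (- (3 * n)))
            \<le> inverse (real q ^ (2 * k + 2)) * (\<tau> / 3 * (1 / 8) ^ (k + 1))"
          using \<tau> by (intro mult_left_mono) auto
        ultimately have "exp (- ((a * n * l)\<^sup>2 / 2)) \<le> inverse (real q ^ (2 * k + 2)) * (\<tau> / 3 * (1 / 8) ^ (k + 1))"
          by (rule order_trans)
        then show "2 * exp (- ((a * n * l)\<^sup>2 / 2)) \<le> 2 * (inverse (real q ^ (2 * k + 2)) * (\<tau> / 3 * (1 / 8) ^ (k + 1)))"
          by (rule mult_left_mono) simp
      qed auto
      also have "\<dots> = inverse (real q) * (2 / 3 * \<tau> * (1 / 8) ^ (k + 1))"
        using q by (simp add: field_simps)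
      also have "\<dots> \<le> 1 * (1 * \<tau> * ((1 / 2) ^ k * (1 / 4)))"
      proof (intro mult_mono)
        show "inverse (real q) \<le> 1" using q by (simp add: inverse_le_1_iff)
        have "(1 / 8) ^ k * (1 / 8) \<le> (1 / 2) ^ k * (1 / 4 :: real)"
          by (intro mult_mono power_mono) auto
        then show "(1 / 8) ^ (k + 1) \<le> (1 / 2) ^ k * (1 / 4 :: real)" by (simp add: mult.commute)
      qed (use \<tau> in auto)
      also have "\<dots> = \<tau> / 2 ^ (k + 2)" by (simp add: power_divide)
      finally show ?thesis .
    qed
    have base: "P.prob bad0 \<le> \<tau> / 2"
    proof -
      have "P.prob bad0 \<le> 2 * exp (- (real N * t0\<^sup>2 / (2 * b\<^sup>2)))"
        unfolding bad0_def Z_def P_def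
        using b l sN by (intro hoeffding_deviation[OF pi fm[OF p0X] fb[OF p0X] b _ N]) (auto simp: t0_def)
      also have "real N * t0\<^sup>2 / (2 * b\<^sup>2) = 2 * l\<^sup>2"
        using b N by (simp add: t0_def power_mult_distrib power_divide)
      also have "2 * exp (- (2 * l\<^sup>2)) \<le> 2 * exp (- l + - l)"
        using l mult_left_mono[of 1 l l] by (simp add: power2_eq_square)
      also have "\<dots> = 2 * (\<tau> / 3 * (\<tau> / 3))" by (simp only: exp_add expl)
      also have "\<dots> \<le> 2 * (1 / 3 * (\<tau> / 3))" using \<tau> by (intro mult_left_mono mult_right_mono) auto
      also have "\<dots> \<le> \<tau> / 2" using \<tau> by simp
      finally show ?thesis .
    qed
    have "P.prob Bad \<le> P.prob bad0 + P.prob (\<Union>k<K. \<Union>(x, y)\<in>Pk k. bad k x y)"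
      unfolding Bad_def by (rule measure_Un_le[OF bad0_sets UN_K_sets])
    also have "P.prob (\<Union>k<K. \<Union>(x, y)\<in>Pk k. bad k x y) \<le> (\<Sum>k<K. P.prob (\<Union>(x, y)\<in>Pk k. bad k x y))"
      using UN_sets by (intro P.finite_measure_subadditive_finite) auto
    also have "\<dots> \<le> (\<Sum>k<K. \<tau> / 2 ^ (k + 2))" by (intro sum_mono level)
    also have "\<dots> \<le> \<tau> / 2" by (rule sum_geometric_quarter_le[OF \<tau>(1)])
    finally have PBad: "P.prob Bad \<le> \<tau>" using base by simp
    define E where "E = space P - Bad"
    have "1 - \<tau> \<le> P.prob E" unfolding E_def using PBad P.prob_compl[OF Bad_sets] by simp
    moreover have "E \<in> sets P" unfolding E_def using Bad_sets by auto
    moreover have "\<bar>Z z (f x)\<bar> \<le> A * (b + \<Lambda>) * (l / sqrt N)" if z: "z \<in> E" and x: "x \<in> X" for z x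
    proof -
      have zP: "z \<in> space P" using z by (simp add: E_def)
      obtain y where y: "y k \<in> T k" "dist x (y k) \<le> D / 2 ^ k" for k using near[OF x] by metis
      have yX: "y k \<in> X" for k using y(1) T(2) by blast
      have y0: "y 0 = p0" using y(1)[of 0] p0 by simp
      have pair: "(y k, y (Suc k)) \<in> Pk k" for k
      proof -
        have "dist (y k) (y (Suc k)) \<le> dist x (y k) + dist x (y (Suc k))" by metric
        also have "\<dots> \<le> D / 2 ^ k + D / 2 ^ Suc k" by (intro add_mono y)
        also have "\<dots> \<le> 2 * D / 2 ^ k" using D by (simp add: field_simps)
        finally show ?thesis using y(1) by (simp add: Pk_def)
      qed
      have incr: "\<bar>Z z (f (y k)) - Z z (f (y (Suc k)))\<bar> \<le> tk k" if "k < K" for k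
      proof -
        have "z \<notin> bad k (y k) (y (Suc k))" using z pair[of k] that by (auto simp: E_def Bad_def)
        then show ?thesis using zP by (simp add: bad_def Zdiff[OF yX yX])
      qed
      have chain: "\<bar>Z z (f (y n))\<bar> \<le> t0 + (\<Sum>k<n. tk k)" if "n \<le> K" for n
        using that
      proof (induction n)
        case 0
        have "z \<notin> bad0" using z by (auto simp: E_def Bad_def)
        then show ?case using zP by (simp add: bad0_def y0)
      next
        case (Suc n)
        then show ?case using incr[of n] by (simp add: abs_le_iff)
      qed
      have tail: "\<bar>Z z (f x) - Z z (f (y K))\<bar> \<le> 2 * (\<Lambda> * D / sqrt N)"
        unfolding Zdiff[OF x yX]
      proof (rule Zbound[OF zP meas_diff[OF x yX]])
        fix \<omega> assume "\<omega> \<in> space \<pi>"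
        then have "\<bar>f x \<omega> - f (y K) \<omega>\<bar> \<le> \<Lambda> * dist x (y K)" by (intro fl x yX)
        also have "\<dots> \<le> \<Lambda> * (D / 2 ^ K)" using y \<Lambda> by (intro mult_left_mono) auto
        also have "\<dots> \<le> \<Lambda> * (D / sqrt N)"
        proof (intro mult_left_mono divide_left_mono)
          have "sqrt N \<le> sqrt ((2 ^ N)\<^sup>2)"
          proof (intro real_sqrt_le_mono)
            have "real N < 2 ^ N" by (rule of_nat_less_two_power)
            also have "\<dots> \<le> (2 ^ N)\<^sup>2" by (simp add: power2_eq_square)
            finally show "real N \<le> (2 ^ N)\<^sup>2" by simp
          qed
          then show "sqrt N \<le> 2 ^ K" by (simp add: K_def)
        qed (use D \<Lambda> sN in auto)
        finally show "\<bar>f x \<omega> - f (y K) \<omega>\<bar> \<le> \<Lambda> * D / sqrt N" by simp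
      qed
      have "(\<Sum>k<K. tk k) = (2 * D * \<Lambda> * a * l / sqrt N) * (\<Sum>k<K. (real k + 1) / 2 ^ k)"
        unfolding sum_distrib_left tk_def bk_def by (intro sum.cong) (auto simp: field_simps)
      also have "\<dots> \<le> (2 * D * \<Lambda> * a * l / sqrt N) * 4"
        using D \<Lambda> a l sN by (intro mult_left_mono sum_arith_geometric_le) auto
      finally have S: "(\<Sum>k<K. tk k) \<le> 8 * D * a * \<Lambda> * (l / sqrt N)" by (simp add: ac_simps)
      have l1: "1 / sqrt N \<le> l / sqrt N" using l sN by (intro divide_right_mono) auto
      have "2 * D * \<Lambda> * (1 / sqrt N) \<le> 2 * D * \<Lambda> * (l / sqrt N)"
        using l1 D \<Lambda> by (intro mult_left_mono) auto
      then have tl: "2 * (\<Lambda> * D / sqrt N) \<le> 2 * D * \<Lambda> * (l / sqrt N)" by (simp add: ac_simps)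
      have t0': "t0 = 2 * b * (l / sqrt N)" by (simp add: t0_def)
      have "\<bar>Z z (f x)\<bar> \<le> 2 * b * (l / sqrt N) + 8 * D * a * \<Lambda> * (l / sqrt N) + 2 * D * \<Lambda> * (l / sqrt N)"
        using chain[of K] tail S tl t0' by (simp add: abs_le_iff)
      also have "\<dots> = (2 * b + 8 * D * a * \<Lambda> + 2 * D * \<Lambda>) * (l / sqrt N)" by (simp add: algebra_simps)
      also have "\<dots> \<le> (A * (b + \<Lambda>)) * (l / sqrt N)"
      proof (rule mult_right_mono)
        have "0 \<le> 8 * D * a * b + 2 * D * b + 2 * \<Lambda>" using D a b \<Lambda> by auto
        then show "2 * b + 8 * D * a * \<Lambda> + 2 * D * \<Lambda> \<le> A * (b + \<Lambda>)"
          by (simp add: A_def algebra_simps)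
      qed (use l sN in auto)
      finally show ?thesis .
    qed
    ultimately show ?thesis unfolding P_def Z_def l_def by blast
  qed
  have "0 < A" unfolding A_def using D a by (simp add: add_pos_nonneg)
  with main show ?thesis by blast
qed

section \<open>Hilbert--Schmidt norms of integral operators\<close>

lemma L2_mult_integrable:
  assumes "f \<in> L2 M" "h \<in> L2 M"
  shows "integrable M (\<lambda>x. f x * h x)"
proof (rule Bochner_Integration.integrable_bound)
  show "integrable M (\<lambda>x. (f x)\<^sup>2 + (h x)\<^sup>2)"
    using assms by (simp add: L2_def)
  show "(\<lambda>x. f x * h x) \<in> borel_measurable M"
    using assms unfolding L2_def by (intro borel_measurable_times) auto
  have "\<bar>u * v\<bar> \<le> u\<^sup>2 + v\<^sup>2" for u v :: real
  proof -
    have "2 * \<bar>u\<bar> * \<bar>v\<bar> \<le> \<bar>u\<bar>\<^sup>2 + \<bar>v\<bar>\<^sup>2" by (rule sum_squares_bound)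
    moreover have "0 \<le> \<bar>u\<bar> * \<bar>v\<bar>" by simp
    ultimately show ?thesis unfolding abs_mult power2_abs by linarith
  qed
  then show "AE x in M. norm (f x * h x) \<le> norm ((f x)\<^sup>2 + (h x)\<^sup>2)"
    by (intro AE_I2) simp
qed

definition L2_orthonormal :: "'a measure \<Rightarrow> ('a \<Rightarrow> real) set \<Rightarrow> bool" where
  "L2_orthonormal M E \<longleftrightarrow> E \<subseteq> L2 M \<and>
     (\<forall>e\<in>E. \<forall>f\<in>E. (LINT x|M. e x * f x) = (if e = f then 1 else 0))"

text \<open>A maximal orthonormal family is a basis, since a square-integrable function orthogonal to it that does
  not vanish almost everywhere could be normalised and added.\<close>
lemma L2_orthonormal_basis_exists: "\<exists>E. L2_orthonormal_basis M E"
proof -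
  have "\<exists>E\<in>{E. L2_orthonormal M E}. \<forall>F\<in>{E. L2_orthonormal M E}. E \<subseteq> F \<longrightarrow> F = E"
  proof (rule subset_Zorn_nonempty)
    show "{E. L2_orthonormal M E} \<noteq> {}"
      by (auto intro!: exI[of _ "{}"] simp: L2_orthonormal_def)
    fix \<C> assume ne: "\<C> \<noteq> {}" and chain: "subset.chain {E. L2_orthonormal M E} \<C>"
    have sub: "L2_orthonormal M E" if "E \<in> \<C>" for E
      using chain that by (auto simp: subset_chain_def)
    have "(LINT x|M. e x * f x) = (if e = f then 1 else 0)" if ef: "e \<in> \<Union>\<C>" "f \<in> \<Union>\<C>" for e f
    proof -
      obtain E F where EF: "E \<in> \<C>" "e \<in> E" "F \<in> \<C>" "f \<in> F" using ef by auto
      then have "E \<subseteq> F \<or> F \<subseteq> E" using chain by (auto simp: subset_chain_def)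
      then obtain H where "H \<in> \<C>" "e \<in> H" "f \<in> H" using EF by auto
      with sub[of H] show ?thesis by (auto simp: L2_orthonormal_def)
    qed
    moreover have "\<Union>\<C> \<subseteq> L2 M" using sub by (auto simp: L2_orthonormal_def)
    ultimately show "\<Union>\<C> \<in> {E. L2_orthonormal M E}" by (simp add: L2_orthonormal_def)
  qed
  then obtain E where E: "L2_orthonormal M E" and max: "\<And>F. L2_orthonormal M F \<Longrightarrow> E \<subseteq> F \<Longrightarrow> F = E"
    by auto
  have EL2: "E \<subseteq> L2 M" using E by (simp add: L2_orthonormal_def)
  have "AE x in M. f x = 0" if f: "f \<in> L2 M" and orth: "\<And>e. e \<in> E \<Longrightarrow> (LINT x|M. f x * e x) = 0" for f
  proof (rule ccontr)
    assume nz: "\<not> (AE x in M. f x = 0)"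
    define n where "n = (LINT x|M. (f x)\<^sup>2)"
    have fi: "integrable M (\<lambda>x. (f x)\<^sup>2)" using f by (simp add: L2_def)
    have "n \<noteq> 0"
    proof
      assume "n = 0"
      then have "AE x in M. (f x)\<^sup>2 = 0"
        using integral_nonneg_eq_0_iff_AE[OF fi] by (simp add: n_def)
      with nz show False by simp
    qed
    moreover have "0 \<le> n" unfolding n_def by simp
    ultimately have n: "0 < n" by simp
    define h where "h x = f x / sqrt n" for x
    have hL2: "h \<in> L2 M"
    proof -
      have "f \<in> borel_measurable M" using f by (simp add: L2_def)
      then have "h \<in> borel_measurable M" unfolding h_def[abs_def] by measurable
      then show ?thesis using fi by (simp add: L2_def h_def power_divide)
    qed
    have hh: "(LINT x|M. h x * h x) = 1"
    proof -
      have "h x * h x = (f x)\<^sup>2 / n" for x using n by (simp add: h_def power2_eq_square)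
      then show ?thesis using n by (simp add: n_def[symmetric])
    qed
    have he: "(LINT x|M. h x * e x) = 0" "(LINT x|M. e x * h x) = 0" if "e \<in> E" for e
    proof -
      show "(LINT x|M. h x * e x) = 0" using orth[OF that] by (simp add: h_def)
      then show "(LINT x|M. e x * h x) = 0" by (simp add: mult.commute)
    qed
    have "h \<notin> E" using he(1)[of h] hh by auto
    moreover have "L2_orthonormal M (insert h E)"
      unfolding L2_orthonormal_def
    proof (intro conjI ballI)
      show "insert h E \<subseteq> L2 M" using hL2 EL2 by simp
      fix e1 e2 assume e: "e1 \<in> insert h E" "e2 \<in> insert h E"
      show "(LINT x|M. e1 x * e2 x) = (if e1 = e2 then 1 else 0)"
      proof (cases "e1 = h \<or> e2 = h")
        case True
        then show ?thesis using e he hh \<open>h \<notin> E\<close> by auto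
      next
        case False
        then show ?thesis using e E by (auto simp: L2_orthonormal_def)
      qed
    qed
    ultimately show False using max[of "insert h E"] by auto
  qed
  then have "\<forall>f\<in>L2 M. (\<forall>e\<in>E. (LINT x|M. f x * e x) = 0) \<longrightarrow> (AE x in M. f x = 0)" by simp
  then have "L2_orthonormal_basis M E"
    using E by (simp add: L2_orthonormal_basis_def L2_orthonormal_def)
  then show ?thesis ..
qed

lemma bessel_inequality:
  assumes E: "L2_orthonormal M E" and F: "finite F" "F \<subseteq> E" and h: "h \<in> L2 M"
  shows "(\<Sum>e\<in>F. (LINT x|M. e x * h x)\<^sup>2) \<le> (LINT x|M. (h x)\<^sup>2)"
proof -
  define a where "a e = (LINT x|M. e x * h x)" for e
  have L2: "e \<in> L2 M" if "e \<in> F" for e using E F that by (auto simp: L2_orthonormal_def)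
  have on: "(LINT x|M. e x * f x) = (if e = f then 1 else 0)" if "e \<in> F" "f \<in> F" for e f
  proof -
    have "e \<in> E" "f \<in> E" using F that by auto
    with E show ?thesis by (simp add: L2_orthonormal_def)
  qed
  define s where "s x = (\<Sum>e\<in>F. a e * e x)" for x
  have hs: "h x * s x = (\<Sum>e\<in>F. a e * (e x * h x))" for x
    by (simp add: s_def sum_distrib_left ac_simps)
  have ss: "s x * s x = (\<Sum>e\<in>F. \<Sum>f\<in>F. (a e * a f) * (e x * f x))" for x
    by (simp add: s_def sum_product ac_simps)
  have ihs: "integrable M (\<lambda>x. h x * s x)"
    unfolding hs by (intro Bochner_Integration.integrable_sum integrable_mult_right L2_mult_integrable L2 h)
  have iss: "integrable M (\<lambda>x. s x * s x)"
    unfolding ss by (intro Bochner_Integration.integrable_sum integrable_mult_right L2_mult_integrable L2)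
  have ihh: "integrable M (\<lambda>x. (h x)\<^sup>2)" using h by (simp add: L2_def)
  have Ihs: "(LINT x|M. h x * s x) = (\<Sum>e\<in>F. (a e)\<^sup>2)"
    unfolding hs using L2_mult_integrable[OF L2 h]
    by (subst Bochner_Integration.integral_sum) (auto simp: a_def power2_eq_square)
  have "(LINT x|M. s x * s x) = (\<Sum>e\<in>F. \<Sum>f\<in>F. (a e * a f) * (LINT x|M. e x * f x))"
    unfolding ss using L2_mult_integrable[OF L2 L2]
    by (subst Bochner_Integration.integral_sum; (intro Bochner_Integration.integrable_sum)?; simp)+
  also have "\<dots> = (\<Sum>e\<in>F. \<Sum>f\<in>F. if e = f then a e * a f else 0)"
    by (intro sum.cong refl) (simp add: on)
  also have "\<dots> = (\<Sum>e\<in>F. (a e)\<^sup>2)" using F(1) by (simp add: power2_eq_square)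
  finally have Iss: "(LINT x|M. s x * s x) = (\<Sum>e\<in>F. (a e)\<^sup>2)" .
  have "0 \<le> (LINT x|M. (h x - s x)\<^sup>2)" by simp
  also have "\<dots> = (LINT x|M. (h x)\<^sup>2 - 2 * (h x * s x) + s x * s x)"
    by (simp add: power2_eq_square algebra_simps)
  also have "\<dots> = (LINT x|M. (h x)\<^sup>2) - 2 * (LINT x|M. h x * s x) + (LINT x|M. s x * s x)"
    using ihs iss ihh by simp
  finally show ?thesis using Ihs Iss by (simp add: a_def)
qed

lemma ennreal_sqrt_le:
  assumes "a \<le> ennreal (S\<^sup>2)" "0 \<le> S"
  shows "ennreal_sqrt a \<le> ennreal S"
proof -
  have "a < \<top>" using assms(1) ennreal_less_top le_less_trans by blast
  moreover have "enn2real a \<le> S\<^sup>2" using assms by (simp add: enn2real_leI)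
  then have "sqrt (enn2real a) \<le> S" using assms(2) by (simp add: real_le_lsqrt)
  ultimately show ?thesis by (auto simp: ennreal_sqrt_def intro: ennreal_leI)
qed

text \<open>For fixed \<open>y\<close> the numbers \<open>T e y\<close> are the coefficients of the slice \<open>t(\<cdot>, y)\<close> in the orthonormal basis, so
  by Bessel's inequality their squares sum to at most \<open>S\<^sup>2\<close>; integrating over \<open>y\<close> against a probability
  measure preserves the bound. An arbitrary finite part of the basis suffices because the sum is the
  supremum of its finite parts.\<close>
lemma hs_norm_kernel_le:
  assumes mu: "\<mu> \<in> prob_measures_on X" and nu: "\<nu> \<in> prob_measures_on X"
    and t: "(\<lambda>(x, y). t x y) \<in> borel_measurable (borel_on X \<Otimes>\<^sub>M borel_on X)"
    and S: "\<And>x y. x \<in> X \<Longrightarrow> y \<in> X \<Longrightarrow> \<bar>t x y\<bar> \<le> S" "0 \<le> S"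
    and T: "\<And>u y. u \<in> L2 \<mu> \<Longrightarrow> y \<in> X \<Longrightarrow> T u y = kernel_op \<mu> t u y"
  shows "hs_norm \<mu> \<nu> T \<le> ennreal S"
proof -
  interpret m: prob_space \<mu> by (rule prob_measures_onD(1)[OF mu])
  interpret n: prob_space \<nu> by (rule prob_measures_onD(1)[OF nu])
  note smu = prob_measures_onD(2,3)[OF mu] and snu = prob_measures_onD(2,3)[OF nu]
  define E where "E = (SOME E. L2_orthonormal_basis \<mu> E)"
  have "L2_orthonormal_basis \<mu> E"
    unfolding E_def using L2_orthonormal_basis_exists by (rule someI_ex)
  then have E: "L2_orthonormal \<mu> E" and EL2: "E \<subseteq> L2 \<mu>"
    by (auto simp: L2_orthonormal_basis_def L2_orthonormal_def)
  have sets_nm: "sets (\<nu> \<Otimes>\<^sub>M \<mu>) = sets (borel_on X \<Otimes>\<^sub>M borel_on X)"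
    using snu(1) smu(1) by (rule sets_pair_measure_cong)
  have tm: "(\<lambda>p. t (snd p) (fst p)) \<in> borel_measurable (\<nu> \<Otimes>\<^sub>M \<mu>)"
  proof -
    have "(\<lambda>p. (snd p, fst p)) \<in> measurable (borel_on X \<Otimes>\<^sub>M borel_on X) (borel_on X \<Otimes>\<^sub>M borel_on X)"
      by (intro measurable_Pair measurable_fst measurable_snd)
    from measurable_compose[OF this t] show ?thesis
      unfolding measurable_cong_sets[OF sets_nm refl] by simp
  qed
  have txm: "(\<lambda>x. t x y) \<in> borel_measurable \<mu>" if "y \<in> X" for y
    using measurable_compose[OF measurable_Pair1'[of y \<nu> \<mu>] tm] that snu(2) by simp
  have tL2: "(\<lambda>x. t x y) \<in> L2 \<mu>" and tint: "(LINT x|\<mu>. (t x y)\<^sup>2) \<le> S\<^sup>2" if y: "y \<in> X" for y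
  proof -
    have b: "(t x y)\<^sup>2 \<le> S\<^sup>2" if "x \<in> X" for x
      using S(1)[OF that y] S(2) by (simp add: abs_le_square_iff[symmetric])
    have i: "integrable \<mu> (\<lambda>x. (t x y)\<^sup>2)"
      using b smu(2) txm[OF y] by (intro m.integrable_const_bound[where B = "S\<^sup>2"]) auto
    then show "(\<lambda>x. t x y) \<in> L2 \<mu>" using txm[OF y] by (simp add: L2_def)
    show "(LINT x|\<mu>. (t x y)\<^sup>2) \<le> S\<^sup>2"
      using b smu(2) by (intro m.integral_le_const[OF i]) auto
  qed
  have km: "(\<lambda>y. kernel_op \<mu> t e y) \<in> borel_measurable \<nu>" if "e \<in> E" for e
  proof -
    have "e \<in> borel_measurable \<mu>" using EL2 that by (auto simp: L2_def)
    then have "(\<lambda>p. e (snd p) * t (snd p) (fst p)) \<in> borel_measurable (\<nu> \<Otimes>\<^sub>M \<mu>)"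
      by (intro borel_measurable_times tm measurable_compose[OF measurable_snd])
    then show ?thesis
      unfolding kernel_op_def by (intro m.borel_measurable_lebesgue_integral) (simp add: case_prod_beta')
  qed
  have fin: "(\<Sum>e\<in>F. \<integral>\<^sup>+ y. ennreal ((T e y)\<^sup>2) \<partial>\<nu>) \<le> ennreal (S\<^sup>2)" if F: "finite F" "F \<subseteq> E" for F
  proof -
    have "(\<Sum>e\<in>F. \<integral>\<^sup>+ y. ennreal ((T e y)\<^sup>2) \<partial>\<nu>) = (\<Sum>e\<in>F. \<integral>\<^sup>+ y. ennreal ((kernel_op \<mu> t e y)\<^sup>2) \<partial>\<nu>)"
      using T F EL2 snu(2) by (intro sum.cong nn_integral_cong refl) (auto simp: subset_eq)
    also have "\<dots> = (\<integral>\<^sup>+ y. (\<Sum>e\<in>F. ennreal ((kernel_op \<mu> t e y)\<^sup>2)) \<partial>\<nu>)"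
    proof (rule nn_integral_sum[symmetric])
      fix e assume "e \<in> F"
      then have "(\<lambda>y. kernel_op \<mu> t e y) \<in> borel_measurable \<nu>" using F by (intro km) auto
      then show "(\<lambda>y. ennreal ((kernel_op \<mu> t e y)\<^sup>2)) \<in> borel_measurable \<nu>" by measurable
    qed
    also have "\<dots> \<le> (\<integral>\<^sup>+ y. ennreal (S\<^sup>2) \<partial>\<nu>)"
    proof (rule nn_integral_mono)
      fix y assume "y \<in> space \<nu>"
      then have y: "y \<in> X" using snu(2) by simp
      have "(\<Sum>e\<in>F. (kernel_op \<mu> t e y)\<^sup>2) \<le> (LINT x|\<mu>. (t x y)\<^sup>2)"
        unfolding kernel_op_def by (rule bessel_inequality[OF E F tL2[OF y]])
      also have "\<dots> \<le> S\<^sup>2" by (rule tint[OF y])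
      finally show "(\<Sum>e\<in>F. ennreal ((kernel_op \<mu> t e y)\<^sup>2)) \<le> ennreal (S\<^sup>2)"
        by (subst sum_ennreal) (auto intro: ennreal_leI)
    qed
    also have "\<dots> = ennreal (S\<^sup>2)" by (simp add: n.emeasure_space_1)
    finally show ?thesis .
  qed
  have "(\<Sum>\<^sub>\<infinity>e\<in>E. \<integral>\<^sup>+ y. ennreal ((T e y)\<^sup>2) \<partial>\<nu>) \<le> ennreal (S\<^sup>2)"
    by (subst nonneg_infsum_complete) (auto intro!: SUP_least fin)
  then show ?thesis
    unfolding hs_norm_def E_def[symmetric] by (rule ennreal_sqrt_le[OF _ S(2)])
qed

lemma sup_norm_on_le_iff:
  assumes "0 \<le> b"
  shows "sup_norm_on X f \<le> ennreal b \<longleftrightarrow> (\<forall>x\<in>X. \<forall>y\<in>X. \<bar>f x y\<bar> \<le> b)"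
  unfolding sup_norm_on_def SUP_le_iff using assms by (auto simp: ennreal_le_iff)

lemma continuous_on_L2:
  assumes "\<rho> \<in> prob_measures_on X" "compact X" "continuous_on X f"
  shows "f \<in> L2 \<rho>"
proof -
  have "f \<in> borel_measurable \<rho>"
    unfolding measurable_cong_sets[OF prob_measures_onD(2)[OF assms(1)] refl]
    by (rule borel_measurable_continuous_on_restrict[OF assms(3)])
  moreover have "integrable \<rho> (\<lambda>x. (f x)\<^sup>2)"
    by (intro integrable_continuous_on[OF assms(1,2)] continuous_intros assms)
  ultimately show ?thesis by (simp add: L2_def)
qed

lemma hs_norm_kernel_diff_le_sup:
  fixes f h :: "'a::euclidean_space \<Rightarrow> 'a \<Rightarrow> real"
  assumes mu: "\<mu> \<in> prob_measures_on X" and nu: "\<nu> \<in> prob_measures_on X" and X: "compact X"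
    and f: "continuous_on (X \<times> X) (\<lambda>p. f (fst p) (snd p))"
    and h: "continuous_on (X \<times> X) (\<lambda>p. h (fst p) (snd p))"
  shows "hs_norm \<mu> \<nu> (\<lambda>u y. kernel_op \<mu> f u y - kernel_op \<mu> h u y) \<le> sup_norm_on X (\<lambda>x y. f x y - h x y)"
proof (cases "sup_norm_on X (\<lambda>x y. f x y - h x y)")
  case (real S)
  have "continuous_on (X \<times> X) (\<lambda>p. f (fst p) (snd p) - h (fst p) (snd p))"
    by (intro continuous_intros f h)
  from measurable_continuous_on_Times[OF this]
  have m: "(\<lambda>(x, y). f x y - h x y) \<in> borel_measurable (borel_on X \<Otimes>\<^sub>M borel_on X)"
    by (simp add: case_prod_beta')
  have slice: "continuous_on X (\<lambda>x. k x y)" if "y \<in> X" "continuous_on (X \<times> X) (\<lambda>p. k (fst p) (snd p))"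
    for k :: "'a \<Rightarrow> 'a \<Rightarrow> real" and y
  proof -
    have "continuous_on X (\<lambda>x. k (fst (x, y)) (snd (x, y)))"
      by (rule continuous_on_compose2[OF that(2)]) (use that(1) in \<open>auto intro!: continuous_intros\<close>)
    then show ?thesis by simp
  qed
  have "hs_norm \<mu> \<nu> (\<lambda>u y. kernel_op \<mu> f u y - kernel_op \<mu> h u y) \<le> ennreal S"
  proof (rule hs_norm_kernel_le[OF mu nu m])
    show "\<bar>f x y - h x y\<bar> \<le> S" if "x \<in> X" "y \<in> X" for x y
      using sup_norm_on_le_iff[OF real(1), of X "\<lambda>x y. f x y - h x y"] real(2) that by simp
    show "0 \<le> S" by (rule real(1))
    fix u y assume u: "u \<in> L2 \<mu>" and y: "y \<in> X"
    have "integrable \<mu> (\<lambda>x. u x * f x y)" "integrable \<mu> (\<lambda>x. u x * h x y)"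
      by (intro L2_mult_integrable[OF u] continuous_on_L2[OF mu X] slice y f h)+
    then show "kernel_op \<mu> f u y - kernel_op \<mu> h u y = kernel_op \<mu> (\<lambda>x y. f x y - h x y) u y"
      by (simp add: kernel_op_def right_diff_distrib)
  qed
  then show ?thesis using real(2) by simp
qed simp

section \<open>Empirical transport kernels\<close>

text \<open>The supremum is an uncountable one, but by continuity it may be restricted to a countable dense
  subset of \<open>X \<times> X\<close>.\<close>
lemma sup_norm_event_measurable:
  fixes F :: "'z \<Rightarrow> 'a::euclidean_space \<Rightarrow> 'a \<Rightarrow> real"
  assumes "compact X" "0 \<le> b"
    and cont: "\<And>z. z \<in> space P \<Longrightarrow> continuous_on (X \<times> X) (\<lambda>p. F z (fst p) (snd p))"
    and meas: "\<And>x y. x \<in> X \<Longrightarrow> y \<in> X \<Longrightarrow> (\<lambda>z. F z x y) \<in> borel_measurable P"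
  shows "{z \<in> space P. sup_norm_on X (F z) \<le> ennreal b} \<in> sets P"
proof -
  obtain T where T: "countable T" "T \<subseteq> X \<times> X" "X \<times> X \<subseteq> closure T"
    using separable[of "X \<times> X"] by metis
  have "closed (X \<times> X)" using assms(1) by (intro compact_imp_closed compact_Times)
  then have cl: "closure T = X \<times> X" using T closure_minimal by blast
  have dense: "(\<forall>x\<in>X. \<forall>y\<in>X. \<bar>F z x y\<bar> \<le> b) \<longleftrightarrow> (\<forall>p\<in>T. \<bar>F z (fst p) (snd p)\<bar> \<le> b)" if "z \<in> space P" for z
  proof
    assume "\<forall>x\<in>X. \<forall>y\<in>X. \<bar>F z x y\<bar> \<le> b"
    then show "\<forall>p\<in>T. \<bar>F z (fst p) (snd p)\<bar> \<le> b" using T(2) by force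
  next
    assume *: "\<forall>p\<in>T. \<bar>F z (fst p) (snd p)\<bar> \<le> b"
    have "continuous_on (closure T) (\<lambda>p. \<bar>F z (fst p) (snd p)\<bar>)"
      unfolding cl by (intro continuous_intros cont that)
    then have "\<bar>F z (fst p) (snd p)\<bar> \<le> b" if "p \<in> X \<times> X" for p
      using continuous_le_on_closure[of T "\<lambda>p. \<bar>F z (fst p) (snd p)\<bar>" p b] * that cl by blast
    then show "\<forall>x\<in>X. \<forall>y\<in>X. \<bar>F z x y\<bar> \<le> b" by force
  qed
  have "{z \<in> space P. sup_norm_on X (F z) \<le> ennreal b} = {z \<in> space P. \<forall>p\<in>T. \<bar>F z (fst p) (snd p)\<bar> \<le> b}"
    unfolding sup_norm_on_le_iff[OF assms(2)] using dense by blast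
  also have "\<dots> \<in> sets P"
  proof -
    have "{z \<in> space P. \<bar>F z (fst p) (snd p)\<bar> \<le> b} \<in> sets P" if "p \<in> T" for p
    proof -
      have "(\<lambda>z. F z (fst p) (snd p)) \<in> borel_measurable P" using T(2) that by (intro meas) auto
      then show ?thesis by measurable
    qed
    then have "Measurable.pred P (\<lambda>z. \<forall>p\<in>T. \<bar>F z (fst p) (snd p)\<bar> \<le> b)"
      by (intro measurable_pred_countable(1)[OF T(1)]) (simp add: pred_def)
    then show ?thesis by (simp add: pred_def)
  qed
  finally show ?thesis .
qed

definition empirical_on :: "'a::topological_space set \<Rightarrow> nat \<Rightarrow> (nat \<Rightarrow> 'a) \<Rightarrow> 'a measure" where
  "empirical_on X N p = distr (uniform_count_measure {..<N}) (borel_on X) p"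

lemma measurable_uniform_count:
  assumes "p \<in> {..<N} \<rightarrow> space M"
  shows "p \<in> measurable (uniform_count_measure {..<N}) M"
  unfolding measurable_cong_sets[OF sets_uniform_count_measure_count_space refl]
  using assms by (intro measurable_count_space_eq1[THEN iffD2]) auto

lemma empirical_on_prob:
  assumes "0 < N" "p \<in> {..<N} \<rightarrow> X"
  shows "empirical_on X N p \<in> prob_measures_on X"
proof -
  have "prob_space (uniform_count_measure {..<N})"
    using assms(1) by (intro prob_space_uniform_count_measure) auto
  then have "prob_space (empirical_on X N p)"
    unfolding empirical_on_def
    by (rule prob_space.prob_space_distr) (use assms(2) in \<open>auto intro!: measurable_uniform_count simp: space_restrict_space\<close>)
  then show ?thesis by (simp add: space_prob_algebra empirical_on_def)
qed

lemma integral_empirical_on: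
  fixes f :: "'a::topological_space \<Rightarrow> real"
  assumes "p \<in> {..<N} \<rightarrow> X" "f \<in> borel_measurable (borel_on X)"
  shows "integral\<^sup>L (empirical_on X N p) f = (\<Sum>i<N. f (p i)) / N"
proof -
  have "p \<in> measurable (uniform_count_measure {..<N}) (borel_on X)"
    using assms(1) by (intro measurable_uniform_count) (simp add: space_restrict_space)
  then show ?thesis
    unfolding empirical_on_def by (simp add: integral_distr[OF _ assms(2)] integral_uniform_count_measure)
qed

lemma integral_empirical:
  fixes f :: "'a::topological_space \<times> 'a \<Rightarrow> real"
  assumes "z \<in> {..<N} \<rightarrow> X \<times> X" "f \<in> borel_measurable (borel_on X \<Otimes>\<^sub>M borel_on X)"
  shows "integral\<^sup>L (empirical X N z) f = (\<Sum>i<N. f (z i)) / N"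
proof -
  have "z \<in> measurable (uniform_count_measure {..<N}) (borel_on X \<Otimes>\<^sub>M borel_on X)"
    using assms(1) by (intro measurable_uniform_count) (simp add: space_pair_measure space_restrict_space)
  then show ?thesis
    unfolding empirical_def by (simp add: integral_distr[OF _ assms(2)] integral_uniform_count_measure)
qed

lemma empirical_marginals:
  assumes "z \<in> {..<N} \<rightarrow> X \<times> X"
  shows "distr (empirical X N z) (borel_on X) fst = empirical_on X N (\<lambda>i. fst (z i))"
    "distr (empirical X N z) (borel_on X) snd = empirical_on X N (\<lambda>i. snd (z i))"
proof -
  have "z \<in> measurable (uniform_count_measure {..<N}) (borel_on X \<Otimes>\<^sub>M borel_on X)"
    using assms by (intro measurable_uniform_count) (simp add: space_pair_measure space_restrict_space)
  then show "distr (empirical X N z) (borel_on X) fst = empirical_on X N (\<lambda>i. fst (z i))"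
    "distr (empirical X N z) (borel_on X) snd = empirical_on X N (\<lambda>i. snd (z i))"
    unfolding empirical_def empirical_on_def by (simp_all add: distr_distr comp_def)
qed

lemma Pi_Times_coords:
  assumes "z \<in> I \<rightarrow> A \<times> B"
  shows "(\<lambda>i. fst (z i)) \<in> I \<rightarrow> A" "(\<lambda>i. snd (z i)) \<in> I \<rightarrow> B"
  using assms unfolding Pi_iff mem_Times_iff by blast+

context eot_cost begin

definition scaling_of :: "'a measure \<Rightarrow> 'a \<Rightarrow> real" where
  "scaling_of \<rho> = (SOME w. scaling \<rho> w)"

lemma scaling_of:
  assumes "\<rho> \<in> prob_measures_on X"
  shows "scaling \<rho> (scaling_of \<rho>)"
proof -
  obtain w where "scaling \<rho> w" using sinkhorn_converges[OF assms] by blast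
  then show ?thesis unfolding scaling_of_def by (rule someI[where P = "scaling \<rho>"])
qed

text \<open>Both \<open>t_B\<close> and \<open>t_C\<close> have this form, with the scalings of the empirical marginals and of the true
  marginals, respectively.\<close>
definition coupled_kernel :: "('a \<Rightarrow> real) \<Rightarrow> ('a \<Rightarrow> real) \<Rightarrow> nat \<Rightarrow> (nat \<Rightarrow> 'a \<times> 'a) \<Rightarrow> 'a \<Rightarrow> 'a \<Rightarrow> real" where
  "coupled_kernel w w' N z x y =
     (\<Sum>i<N. (G x (fst (z i)) * w x * w (fst (z i))) * (G (snd (z i)) y * w' (snd (z i)) * w' y)) / N"

lemma integral_kernel_product:
  assumes rho: "\<rho> \<in> prob_measures_on X" and sig: "\<sigma> \<in> prob_measures_on X"
    and w: "scaling \<rho> w" "scaling \<sigma> w'" and z: "z \<in> {..<N} \<rightarrow> X \<times> X" and xy: "x \<in> X" "y \<in> X"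
  shows "(LINT (x', y')|empirical X N z. eot_kernel X c \<epsilon> \<rho> \<rho> x x' * eot_kernel X c \<epsilon> \<sigma> \<sigma> y' y)
      = coupled_kernel w w' N z x y"
proof -
  define h where "h p = (G x (fst p) * w x * w (fst p)) * (G (snd p) y * w' (snd p) * w' y)" for p
  have "continuous_on (X \<times> X) h"
    unfolding h_def
    by (intro continuous_intros continuous_on_fst_snd[of "\<lambda>u. G x u"] continuous_on_fst_snd[of "\<lambda>u. G u y"]
        continuous_on_fst_snd[of w] continuous_on_fst_snd[of w']
        G_continuous1 G_continuous2 xy scaling_continuous[OF w(1)] scaling_continuous[OF w(2)])
  then have hm: "h \<in> borel_measurable (borel_on X \<Otimes>\<^sub>M borel_on X)"
    by (rule measurable_continuous_on_Times)
  have "(LINT (x', y')|empirical X N z. eot_kernel X c \<epsilon> \<rho> \<rho> x x' * eot_kernel X c \<epsilon> \<sigma> \<sigma> y' y)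
      = integral\<^sup>L (empirical X N z) h"
    by (intro Bochner_Integration.integral_cong refl)
      (auto simp: h_def empirical_def space_pair_measure space_restrict_space
        eot_kernel_eq[OF rho w(1) xy(1)] eot_kernel_eq[OF sig w(2) _ xy(2)])
  also have "\<dots> = (\<Sum>i<N. h (z i)) / N" by (rule integral_empirical[OF z hm])
  also have "\<dots> = coupled_kernel w w' N z x y" by (simp only: coupled_kernel_def h_def)
  finally show ?thesis .
qed

lemma t_B_eq:
  assumes N: "0 < N" and z: "z \<in> {..<N} \<rightarrow> X \<times> X" and xy: "x \<in> X" "y \<in> X"
  shows "t_B X c \<epsilon> N z x y = coupled_kernel (scaling_of (empirical_on X N (\<lambda>i. fst (z i))))
      (scaling_of (empirical_on X N (\<lambda>i. snd (z i)))) N z x y"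
proof -
  note emp = empirical_on_prob[OF N Pi_Times_coords(1)[OF z]] empirical_on_prob[OF N Pi_Times_coords(2)[OF z]]
  show ?thesis
    unfolding t_B_def Let_def empirical_marginals[OF z]
    by (rule integral_kernel_product[OF emp scaling_of[OF emp(1)] scaling_of[OF emp(2)] z xy])
qed

lemma t_C_eq:
  assumes "\<mu> \<in> prob_measures_on X" "\<nu> \<in> prob_measures_on X"
    and "z \<in> {..<N} \<rightarrow> X \<times> X" "x \<in> X" "y \<in> X"
  shows "t_C X c \<mu> \<nu> \<epsilon> N z x y = coupled_kernel (scaling_of \<mu>) (scaling_of \<nu>) N z x y"
  unfolding t_C_def
  by (rule integral_kernel_product[OF assms(1,2) scaling_of[OF assms(1)] scaling_of[OF assms(2)] assms(3-5)])

lemma coupled_kernel_continuous: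
  assumes "continuous_on X w" "continuous_on X w'" and z: "z \<in> {..<N} \<rightarrow> X \<times> X"
  shows "continuous_on (X \<times> X) (\<lambda>p. coupled_kernel w w' N z (fst p) (snd p))"
proof -
  have zX: "fst (z i) \<in> X" "snd (z i) \<in> X" if "i < N" for i
    using Pi_mem[OF Pi_Times_coords(1)[OF z]] Pi_mem[OF Pi_Times_coords(2)[OF z]] that by simp_all
  define h where "h i p = (G (fst p) (fst (z i)) * w (fst p) * w (fst (z i))) * (G (snd (z i)) (snd p) * w' (snd (z i)) * w' (snd p))" for i p
  have "continuous_on (X \<times> X) (h i)" if "i < N" for i
    unfolding h_def
    by (intro continuous_on_mult continuous_on_const continuous_on_fst_snd(1)[OF assms(1)] continuous_on_fst_snd(2)[OF assms(2)]
        continuous_on_fst_snd(1)[OF G_continuous1[OF zX(1)[OF that]]] continuous_on_fst_snd(2)[OF G_continuous2[OF zX(2)[OF that]]])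
  then have "continuous_on (X \<times> X) (\<lambda>p. (\<Sum>i<N. h i p) * (1 / N))"
    by (intro continuous_on_mult continuous_on_sum continuous_on_const) auto
  moreover have "(\<Sum>i<N. h i p) * (1 / N) = coupled_kernel w w' N z (fst p) (snd p)" for p
    by (simp only: coupled_kernel_def h_def times_divide_eq_right mult_1_right)
  ultimately show ?thesis by simp
qed

lemma t_B_continuous:
  assumes N: "0 < N" and z: "z \<in> {..<N} \<rightarrow> X \<times> X"
  shows "continuous_on (X \<times> X) (\<lambda>p. t_B X c \<epsilon> N z (fst p) (snd p))"
proof -
  note emp = empirical_on_prob[OF N Pi_Times_coords(1)[OF z]] empirical_on_prob[OF N Pi_Times_coords(2)[OF z]]
  have "continuous_on (X \<times> X) (\<lambda>p. coupled_kernel (scaling_of (empirical_on X N (\<lambda>i. fst (z i))))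
      (scaling_of (empirical_on X N (\<lambda>i. snd (z i)))) N z (fst p) (snd p))"
    by (rule coupled_kernel_continuous[OF scaling_continuous[OF scaling_of[OF emp(1)]] scaling_continuous[OF scaling_of[OF emp(2)]] z])
  then show ?thesis by (rule continuous_on_eq) (auto simp: t_B_eq[OF N z])
qed

lemma t_C_continuous:
  assumes "\<mu> \<in> prob_measures_on X" "\<nu> \<in> prob_measures_on X" and z: "z \<in> {..<N} \<rightarrow> X \<times> X"
  shows "continuous_on (X \<times> X) (\<lambda>p. t_C X c \<mu> \<nu> \<epsilon> N z (fst p) (snd p))"
proof -
  have "continuous_on (X \<times> X) (\<lambda>p. coupled_kernel (scaling_of \<mu>) (scaling_of \<nu>) N z (fst p) (snd p))"
    by (rule coupled_kernel_continuous[OF scaling_continuous[OF scaling_of[OF assms(1)]] scaling_continuous[OF scaling_of[OF assms(2)]] z])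
  then show ?thesis by (rule continuous_on_eq) (auto simp: t_C_eq[OF assms(1,2) z])
qed

lemma kernel_close:
  assumes ww: "w \<in> X \<rightarrow> {g..1 / g}" "v \<in> X \<rightarrow> {g..1 / g}"
    and d: "\<forall>u\<in>X. \<bar>v u - w u\<bar> \<le> e" and xy: "x \<in> X" "y \<in> X"
  shows "\<bar>G x y * v x * v y - G x y * w x * w y\<bar> \<le> 2 * e / g" "\<bar>G x y * w x * w y\<bar> \<le> 1 / g\<^sup>2"
proof -
  have wb: "\<bar>w u\<bar> \<le> 1 / g" "\<bar>v u\<bar> \<le> 1 / g" if "u \<in> X" for u
  proof -
    have b: "g \<le> w u" "w u \<le> 1 / g" "g \<le> v u" "v u \<le> 1 / g"
      using Pi_mem[OF ww(1) that] Pi_mem[OF ww(2) that] by simp_all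
    then have "0 < w u" "0 < v u" using g_pos by linarith+
    then show "\<bar>w u\<bar> \<le> 1 / g" "\<bar>v u\<bar> \<le> 1 / g" using b by simp_all
  qed
  have G: "\<bar>G x y\<bar> \<le> 1" using G_le[OF xy] by simp
  have "\<bar>v x * v y - w x * w y\<bar> = \<bar>(v x - w x) * v y + w x * (v y - w y)\<bar>" by (simp add: algebra_simps)
  also have "\<dots> \<le> \<bar>v x - w x\<bar> * \<bar>v y\<bar> + \<bar>w x\<bar> * \<bar>v y - w y\<bar>" by (simp add: abs_mult[symmetric])
  also have "\<dots> \<le> e * (1 / g) + 1 / g * e"
    using d xy g_pos bspec[OF d xy(1)] by (intro add_mono mult_mono wb xy) auto
  finally have 1: "\<bar>v x * v y - w x * w y\<bar> \<le> 2 * e / g" by simp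
  have "\<bar>G x y * v x * v y - G x y * w x * w y\<bar> = \<bar>G x y\<bar> * \<bar>v x * v y - w x * w y\<bar>"
    by (simp only: abs_mult[symmetric] right_diff_distrib mult.assoc)
  also have "\<dots> \<le> 1 * (2 * e / g)" by (intro mult_mono G 1) auto
  finally show "\<bar>G x y * v x * v y - G x y * w x * w y\<bar> \<le> 2 * e / g" by simp
  have "\<bar>G x y\<bar> * \<bar>w x\<bar> * \<bar>w y\<bar> \<le> 1 * (1 / g) * (1 / g)"
    using g_pos by (intro mult_mono G wb xy) auto
  then show "\<bar>G x y * w x * w y\<bar> \<le> 1 / g\<^sup>2" by (simp add: abs_mult power2_eq_square)
qed

lemma coupled_kernel_close:
  assumes N: "0 < N" and z: "z \<in> {..<N} \<rightarrow> X \<times> X" and xy: "x \<in> X" "y \<in> X"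
    and w: "w \<in> X \<rightarrow> {g..1 / g}" "v \<in> X \<rightarrow> {g..1 / g}"
    and w': "w' \<in> X \<rightarrow> {g..1 / g}" "v' \<in> X \<rightarrow> {g..1 / g}"
    and d: "\<forall>u\<in>X. \<bar>v u - w u\<bar> \<le> e" "\<forall>u\<in>X. \<bar>v' u - w' u\<bar> \<le> e"
  shows "\<bar>coupled_kernel v v' N z x y - coupled_kernel w w' N z x y\<bar> \<le> 4 * e / g ^ 3"
proof -
  define k l where "k f u = G x u * f x * f u" and "l f u = G u y * f u * f y" for f :: "'a \<Rightarrow> real" and u
  have e0: "0 \<le> e" using bspec[OF d(1) xy(1)] by linarith
  have summand: "\<bar>k v a * l v' b - k w a * l w' b\<bar> \<le> 4 * e / g ^ 3" if ab: "a \<in> X" "b \<in> X" for a b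
  proof -
    have 1: "\<bar>k v a - k w a\<bar> \<le> 2 * e / g" "\<bar>k w a\<bar> \<le> 1 / g\<^sup>2"
      using kernel_close[OF w d(1) xy(1) ab(1)] by (simp_all only: k_def)
    have dneg: "\<forall>u\<in>X. \<bar>w' u - v' u\<bar> \<le> e" using d(2) by (simp add: abs_minus_commute)
    have 2: "\<bar>l v' b - l w' b\<bar> \<le> 2 * e / g" "\<bar>l v' b\<bar> \<le> 1 / g\<^sup>2"
      using kernel_close(1)[OF w' d(2) ab(2) xy(2)] kernel_close(2)[OF w'(2,1) dneg ab(2) xy(2)]
      by (simp_all only: l_def)
    have "\<bar>k v a * l v' b - k w a * l w' b\<bar> = \<bar>(k v a - k w a) * l v' b + k w a * (l v' b - l w' b)\<bar>"
      by (simp add: algebra_simps)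
    also have "\<dots> \<le> \<bar>k v a - k w a\<bar> * \<bar>l v' b\<bar> + \<bar>k w a\<bar> * \<bar>l v' b - l w' b\<bar>"
      by (simp add: abs_mult[symmetric])
    also have "\<dots> \<le> 2 * e / g * (1 / g\<^sup>2) + 1 / g\<^sup>2 * (2 * e / g)"
      using e0 g_pos by (intro add_mono mult_mono 1 2) auto
    also have "\<dots> = 4 * e / g ^ 3" by (simp add: power2_eq_square power3_eq_cube)
    finally show ?thesis .
  qed
  have ab: "fst (z i) \<in> X" "snd (z i) \<in> X" if "i < N" for i
    using Pi_mem[OF Pi_Times_coords(1)[OF z]] Pi_mem[OF Pi_Times_coords(2)[OF z]] that by simp_all
  have "coupled_kernel v v' N z x y - coupled_kernel w w' N z x y
      = (\<Sum>i<N. k v (fst (z i)) * l v' (snd (z i)) - k w (fst (z i)) * l w' (snd (z i))) / N"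
    unfolding coupled_kernel_def k_def l_def by (simp only: sum_subtractf diff_divide_distrib)
  also have "\<bar>\<dots>\<bar> = \<bar>\<Sum>i<N. k v (fst (z i)) * l v' (snd (z i)) - k w (fst (z i)) * l w' (snd (z i))\<bar> / N"
    by simp
  also have "\<dots> \<le> (\<Sum>i<N. 4 * e / g ^ 3) / N"
    by (intro divide_right_mono order_trans[OF sum_abs sum_mono] summand ab) auto
  also have "\<dots> = 4 * e / g ^ 3" using N by simp
  finally show ?thesis .
qed

text \<open>The evaluation point \<open>\<phi>\<close> may depend on the sample, since one step of the iteration evaluates the
  previous iterate at the sample points themselves.\<close>
lemma sinkhorn_measurable:
  assumes N: "0 < N" and p: "\<And>i. i < N \<Longrightarrow> (\<lambda>z. p z i) \<in> measurable P (borel_on X)"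
    and \<phi>: "\<phi> \<in> measurable P (borel_on X)"
  shows "(\<lambda>z. sinkhorn (empirical_on X N (p z)) n (\<phi> z)) \<in> borel_measurable P"
  using \<phi>
proof (induction n arbitrary: \<phi>)
  case 0
  show ?case by simp
next
  case (Suc n)
  have pX: "p z \<in> {..<N} \<rightarrow> X" if "z \<in> space P" for z
    using measurable_space[OF p that] by (auto simp: space_restrict_space)
  have phX: "\<phi> z \<in> X" if "z \<in> space P" for z
    using measurable_space[OF Suc.prems that] by (simp add: space_restrict_space)
  have Gm: "(\<lambda>z. G (\<phi> z) (p z i)) \<in> borel_measurable P" if "i < N" for i
    using measurable_compose[OF measurable_Pair[OF Suc.prems p[OF that]] measurable_continuous_on_Times[OF G_continuous]]
    by simp
  have "(\<lambda>z. 1 / ((\<Sum>i<N. G (\<phi> z) (p z i) * sinkhorn (empirical_on X N (p z)) n (p z i)) / N)) \<in> borel_measurable P"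
    using Suc.IH[OF p] Gm by (intro borel_measurable_divide borel_measurable_sum borel_measurable_times) auto
  moreover have "1 / ((\<Sum>i<N. G (\<phi> z) (p z i) * sinkhorn (empirical_on X N (p z)) n (p z i)) / N)
      = sinkhorn (empirical_on X N (p z)) (Suc n) (\<phi> z)" if z: "z \<in> space P" for z
  proof -
    have "continuous_on X (\<lambda>y. G (\<phi> z) y * sinkhorn (empirical_on X N (p z)) n y)"
      using sinkhorn_pos_cont[OF empirical_on_prob[OF N pX[OF z]]]
      by (intro continuous_intros G_continuous2 phX z) (auto simp: pos_cont_def)
    then have "(\<lambda>y. G (\<phi> z) y * sinkhorn (empirical_on X N (p z)) n y) \<in> borel_measurable (borel_on X)"
      by (rule borel_measurable_continuous_on_restrict)
    from integral_empirical_on[OF pX[OF z] this] show ?thesis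
      by (simp only: gibbs_op_def sinkhorn.simps)
  qed
  ultimately show ?case by (subst measurable_cong[symmetric]) auto
qed

text \<open>The scaling of the empirical measure is defined by a choice, which says nothing about its dependence on
  the sample; but its products are limits of products of Sinkhorn iterates.\<close>
lemma kernel_product_measurable:
  assumes N: "0 < N" and p: "\<And>i. i < N \<Longrightarrow> (\<lambda>z. p z i) \<in> measurable P (borel_on X)"
    and \<phi>: "\<phi> \<in> measurable P (borel_on X)" and \<psi>: "\<psi> \<in> measurable P (borel_on X)"
  shows "(\<lambda>z. scaling_of (empirical_on X N (p z)) (\<phi> z) * scaling_of (empirical_on X N (p z)) (\<psi> z)) \<in> borel_measurable P"
proof (rule borel_measurable_LIMSEQ_real)
  let ?s = "\<lambda>z. sinkhorn (empirical_on X N (p z))"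
  fix z assume z: "z \<in> space P"
  have pX: "p z \<in> {..<N} \<rightarrow> X"
    using measurable_space[OF p z] by (auto simp: space_restrict_space)
  have X: "\<phi> z \<in> X" "\<psi> z \<in> X"
    using measurable_space[OF \<phi> z] measurable_space[OF \<psi> z] by (simp_all add: space_restrict_space)
  note emp = empirical_on_prob[OF N pX]
  obtain w where w: "scaling (empirical_on X N (p z)) w"
    and lim: "\<And>x y. x \<in> X \<Longrightarrow> y \<in> X \<Longrightarrow> (\<lambda>n. ?s z n x * ?s z (Suc n) y) \<longlonglongrightarrow> w x * w y"
    using sinkhorn_converges[OF emp] by blast
  have "scaling_of (empirical_on X N (p z)) u = w u" if "u \<in> X" for u
    using scaling_unique[OF emp w scaling_of[OF emp] that] .
  then show "(\<lambda>n. ?s z n (\<phi> z) * ?s z (Suc n) (\<psi> z))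
      \<longlonglongrightarrow> scaling_of (empirical_on X N (p z)) (\<phi> z) * scaling_of (empirical_on X N (p z)) (\<psi> z)"
    using lim[OF X] X by simp
next
  fix n
  show "(\<lambda>z. sinkhorn (empirical_on X N (p z)) n (\<phi> z) * sinkhorn (empirical_on X N (p z)) (Suc n) (\<psi> z)) \<in> borel_measurable P"
    by (intro borel_measurable_times sinkhorn_measurable N p \<phi> \<psi>)
qed

text \<open>The factor \<open>1 / g ^ 5\<close> is the stability constant of scalings, and \<open>1 / g ^ 3\<close> stems from the other factors
  in the product of the two transport kernels, which are bounded by powers of \<open>1 / g\<close>.\<close>
lemma t_B_t_C_close:
  assumes N: "0 < N" and z: "z \<in> {..<N} \<rightarrow> X \<times> X"
    and mu: "\<mu> \<in> prob_measures_on X" and nu: "\<nu> \<in> prob_measures_on X"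
    and d1: "\<forall>u\<in>X. \<bar>gibbs_op (empirical_on X N (\<lambda>i. fst (z i))) (scaling_of \<mu>) u - gibbs_op \<mu> (scaling_of \<mu>) u\<bar> \<le> \<eta>"
    and d2: "\<forall>u\<in>X. \<bar>gibbs_op (empirical_on X N (\<lambda>i. snd (z i))) (scaling_of \<nu>) u - gibbs_op \<nu> (scaling_of \<nu>) u\<bar> \<le> \<eta>"
    and xy: "x \<in> X" "y \<in> X"
  shows "\<bar>t_B X c \<epsilon> N z x y - t_C X c \<mu> \<nu> \<epsilon> N z x y\<bar> \<le> 12 * \<eta> / g ^ 8"
proof -
  note emp = empirical_on_prob[OF N Pi_Times_coords(1)[OF z]] empirical_on_prob[OF N Pi_Times_coords(2)[OF z]]
  have b: "scaling_of \<rho> \<in> X \<rightarrow> {g..1 / g}" if "\<rho> \<in> prob_measures_on X" for \<rho>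
    using scaling_bounds[OF that scaling_of[OF that]] by (auto simp del: One_nat_def)
  have close: "\<forall>u\<in>X. \<bar>scaling_of \<sigma> u - scaling_of \<rho> u\<bar> \<le> 3 * \<eta> / g ^ 5"
    if "\<rho> \<in> prob_measures_on X" "\<sigma> \<in> prob_measures_on X"
      "\<forall>u\<in>X. \<bar>gibbs_op \<sigma> (scaling_of \<rho>) u - gibbs_op \<rho> (scaling_of \<rho>) u\<bar> \<le> \<eta>" for \<rho> \<sigma>
    using scaling_stability[OF that(1,2) scaling_of[OF that(1)] scaling_of[OF that(2)]] that(3) by blast
  have "\<bar>t_B X c \<epsilon> N z x y - t_C X c \<mu> \<nu> \<epsilon> N z x y\<bar> \<le> 4 * (3 * \<eta> / g ^ 5) / g ^ 3"
    unfolding t_B_eq[OF N z xy] t_C_eq[OF mu nu z xy]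
    by (rule coupled_kernel_close[OF N z xy b[OF mu] b[OF emp(1)] b[OF nu] b[OF emp(2)]
          close[OF mu emp(1) d1] close[OF nu emp(2) d2]])
  also have "\<dots> = 12 * \<eta> / (g ^ 5 * g ^ 3)" by simp
  also have "g ^ 5 * g ^ 3 = g ^ 8" unfolding power_add[symmetric] by simp
  finally show ?thesis .
qed

text \<open>The perturbation that enters the stability of scalings is the deviation of an empirical mean. Here
  \<open>pr\<close> is either of the two coordinate projections.\<close>
lemma deviation_gibbs_op:
  assumes pr: "pr \<in> measurable \<pi> (borel_on X)" and z: "(\<lambda>i. pr (z i)) \<in> {..<N} \<rightarrow> X"
    and w: "continuous_on X w" and x: "x \<in> X"
  shows "deviation \<pi> N z (\<lambda>\<omega>. G x (pr \<omega>) * w (pr \<omega>))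
      = gibbs_op (empirical_on X N (\<lambda>i. pr (z i))) w x - gibbs_op (distr \<pi> (borel_on X) pr) w x"
proof -
  have "continuous_on X (\<lambda>y. G x y * w y)" by (rule continuous_on_mult[OF G_continuous2[OF x] w])
  then have m: "(\<lambda>y. G x y * w y) \<in> borel_measurable (borel_on X)"
    by (rule borel_measurable_continuous_on_restrict)
  show ?thesis
    unfolding deviation_def gibbs_op_def integral_empirical_on[OF z m] integral_distr[OF pr m] ..
qed

lemma lipschitz_class_gibbs_op:
  assumes pr: "pr \<in> measurable \<pi> (borel_on X)" and rho: "\<rho> \<in> prob_measures_on X" and w: "scaling \<rho> w"
  shows "lipschitz_class X \<pi> (\<lambda>x \<omega>. G x (pr \<omega>) * w (pr \<omega>)) (1 / g) (Lip / \<epsilon> / g)"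
proof -
  have prX: "pr \<omega> \<in> X" if "\<omega> \<in> space \<pi>" for \<omega>
    using measurable_space[OF pr that] by (simp add: space_restrict_space)
  have wb: "\<bar>w u\<bar> \<le> 1 / g" if "u \<in> X" for u
    using scaling_bounds(2)[OF rho w that] scaling_pos[OF w that] by simp
  show ?thesis
    unfolding lipschitz_class_def
  proof (intro conjI ballI)
    fix x assume x: "x \<in> X"
    have "continuous_on X (\<lambda>y. G x y * w y)"
      by (rule continuous_on_mult[OF G_continuous2[OF x] scaling_continuous[OF w]])
    from measurable_compose[OF pr borel_measurable_continuous_on_restrict[OF this]]
    show "(\<lambda>\<omega>. G x (pr \<omega>) * w (pr \<omega>)) \<in> borel_measurable \<pi>" .
    fix \<omega> assume \<omega>: "\<omega> \<in> space \<pi>"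
    have "\<bar>G x (pr \<omega>)\<bar> * \<bar>w (pr \<omega>)\<bar> \<le> 1 * (1 / g)"
      using G_le[OF x prX[OF \<omega>]] by (intro mult_mono wb prX \<omega>) auto
    then show "\<bar>G x (pr \<omega>) * w (pr \<omega>)\<bar> \<le> 1 / g" by (simp only: abs_mult mult_1)
  next
    fix x x' \<omega> assume x: "x \<in> X" "x' \<in> X" and \<omega>: "\<omega> \<in> space \<pi>"
    have "\<bar>G x (pr \<omega>) - G x' (pr \<omega>)\<bar> * \<bar>w (pr \<omega>)\<bar> \<le> (Lip / \<epsilon> * dist x x') * (1 / g)"
      using mult_nonneg_nonneg[OF Lip_nonneg zero_le_dist[of x x']] by (intro mult_mono wb prX \<omega> G_lip x) simp_all
    also have "\<dots> = Lip / \<epsilon> / g * dist x x'" by simp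
    finally show "\<bar>G x (pr \<omega>) * w (pr \<omega>) - G x' (pr \<omega>) * w (pr \<omega>)\<bar> \<le> Lip / \<epsilon> / g * dist x x'"
      by (simp only: abs_mult[symmetric] left_diff_distrib)
  qed
qed

context
  fixes P :: "(nat \<Rightarrow> 'a \<times> 'a) measure" and N :: nat
  assumes N: "0 < N" and coord: "\<forall>i<N. (\<lambda>z. z i) \<in> measurable P (borel_on X \<Otimes>\<^sub>M borel_on X)"
begin

lemma sample_space: "z \<in> space P \<Longrightarrow> z \<in> {..<N} \<rightarrow> X \<times> X"
  using measurable_space[OF coord[rule_format]] by (auto simp: space_pair_measure space_restrict_space)

lemma sample_coords:
  "i < N \<Longrightarrow> (\<lambda>z. fst (z i)) \<in> measurable P (borel_on X)" "i < N \<Longrightarrow> (\<lambda>z. snd (z i)) \<in> measurable P (borel_on X)"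
  using measurable_compose[OF coord[rule_format] measurable_fst]
    measurable_compose[OF coord[rule_format] measurable_snd] by auto

lemma sample_G:
  "i < N \<Longrightarrow> x \<in> X \<Longrightarrow> (\<lambda>z. G x (fst (z i))) \<in> borel_measurable P"
  "i < N \<Longrightarrow> y \<in> X \<Longrightarrow> (\<lambda>z. G (snd (z i)) y) \<in> borel_measurable P"
  by (rule measurable_compose[OF sample_coords(1) borel_measurable_continuous_on_restrict[OF G_continuous2]]
      measurable_compose[OF sample_coords(2) borel_measurable_continuous_on_restrict[OF G_continuous1]]; assumption)+

lemma t_B_measurable:
  assumes xy: "x \<in> X" "y \<in> X"
  shows "(\<lambda>z. t_B X c \<epsilon> N z x y) \<in> borel_measurable P"
proof -
  let ?w = "\<lambda>z. scaling_of (empirical_on X N (\<lambda>i. fst (z i)))" and ?v = "\<lambda>z. scaling_of (empirical_on X N (\<lambda>i. snd (z i)))"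
  have const: "(\<lambda>z. u) \<in> measurable P (borel_on X)" if "u \<in> X" for u
    using that by (simp add: space_restrict_space)
  have "(\<lambda>z. (\<Sum>i<N. (G x (fst (z i)) * (?w z x * ?w z (fst (z i)))) * (G (snd (z i)) y * (?v z (snd (z i)) * ?v z y))) / N)
      \<in> borel_measurable P"
    by (intro borel_measurable_divide borel_measurable_sum borel_measurable_times borel_measurable_const sample_G xy
        kernel_product_measurable N sample_coords const; simp)
  moreover have "t_B X c \<epsilon> N z x y = (\<Sum>i<N. (G x (fst (z i)) * (?w z x * ?w z (fst (z i)))) * (G (snd (z i)) y * (?v z (snd (z i)) * ?v z y))) / N"
    if "z \<in> space P" for z
    using t_B_eq[OF N sample_space[OF that] xy] by (simp only: coupled_kernel_def mult.assoc)
  ultimately show ?thesis by (subst measurable_cong) auto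
qed

lemma t_C_measurable:
  assumes mu: "\<mu> \<in> prob_measures_on X" and nu: "\<nu> \<in> prob_measures_on X" and xy: "x \<in> X" "y \<in> X"
  shows "(\<lambda>z. t_C X c \<mu> \<nu> \<epsilon> N z x y) \<in> borel_measurable P"
proof -
  let ?w = "scaling_of \<mu>" and ?v = "scaling_of \<nu>"
  have m: "?w \<in> borel_measurable (borel_on X)" "?v \<in> borel_measurable (borel_on X)"
    by (intro borel_measurable_continuous_on_restrict scaling_continuous[OF scaling_of] mu nu)+
  have "(\<lambda>z. coupled_kernel ?w ?v N z x y) \<in> borel_measurable P"
    unfolding coupled_kernel_def
    by (intro borel_measurable_divide borel_measurable_sum borel_measurable_times borel_measurable_const sample_G xy
        measurable_compose[OF sample_coords(1) m(1)] measurable_compose[OF sample_coords(2) m(2)]; simp)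
  then show ?thesis
    using t_C_eq[OF mu nu sample_space xy] by (subst measurable_cong) simp_all
qed

end
end

section \<open>The empirical operator bound\<close>

theorem theorem2p20:
  fixes X :: "'a::euclidean_space set"
    and c :: "'a \<Rightarrow> 'a \<Rightarrow> real"
  assumes "compact X"
    and "lipschitz_boundary X"
    and "lipschitz_cost X c"
    and "\<exists>s::nat. real s > real DIM('a) / 2 \<and> Ck_on (s + 1) (X \<times> X) (\<lambda>(x, y). c x y)"
  shows "\<exists>K C L :: real. K > 0 \<and> C > 0 \<and> L > 0 \<and>
    (\<forall>\<mu> \<nu> \<pi> C\<mu> D\<mu> \<delta>\<mu> C\<nu> D\<nu> \<delta>\<nu>.
       \<mu> \<in> prob_measures_on X \<longrightarrow> \<nu> \<in> prob_measures_on X \<longrightarrow>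
       ball_mass \<mu> C\<mu> D\<mu> \<delta>\<mu> \<longrightarrow> ball_mass \<nu> C\<nu> D\<nu> \<delta>\<nu> \<longrightarrow>
       is_coupling X \<mu> \<nu> \<pi> \<longrightarrow>
       (\<exists>M>0. \<forall>(\<tau>::real) (\<epsilon>::real) (N::nat).
          0 < \<tau> \<longrightarrow> \<tau> < 1 \<longrightarrow> 0 < \<epsilon> \<longrightarrow> \<epsilon> \<le> 1 \<longrightarrow> N > 0 \<longrightarrow>
          ln (3 / \<tau>) / (\<epsilon> powr (real DIM('a) / 2) * sqrt (real N))
             * (4 * L * exp (C / \<epsilon>) + 2 * sqrt K) \<le> 1 \<longrightarrow>
          measure (\<Pi>\<^sub>M i\<in>{..<N}. \<pi>)
            {z \<in> space (\<Pi>\<^sub>M i\<in>{..<N}. \<pi>).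
               hs_norm \<mu> \<nu> (\<lambda>u y. kernel_op \<mu> (t_B X c \<epsilon> N z) u y
                                     - kernel_op \<mu> (t_C X c \<mu> \<nu> \<epsilon> N z) u y)
                 \<le> sup_norm_on X (\<lambda>x y. t_B X c \<epsilon> N z x y - t_C X c \<mu> \<nu> \<epsilon> N z x y)
               \<and> sup_norm_on X (\<lambda>x y. t_B X c \<epsilon> N z x y - t_C X c \<mu> \<nu> \<epsilon> N z x y)
                 \<le> ennreal (M * (\<epsilon> powr (- (real DIM('a) / 2 + D\<mu> + D\<nu>)) / sqrt (real N))
                              * exp (C / \<epsilon>) * ln (3 / \<tau>))}
          \<ge> 1 - 4 * \<tau>))"
proof (cases "X = {}")
  case True
  have "\<mu> \<notin> prob_measures_on X" for \<mu>
    using True prob_measures_onD[of \<mu> X] prob_space.not_empty by blast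
  then show ?thesis by (intro exI[of _ 1]) simp
next
  case False
  obtain A where A: "0 < A"
    and dev: "\<forall>(\<pi> :: ('a \<times> 'a) measure) f b \<Lambda>. prob_space \<pi> \<longrightarrow> lipschitz_class X \<pi> f b \<Lambda> \<longrightarrow> 0 < b \<longrightarrow> 0 < \<Lambda> \<longrightarrow>
      (\<forall>N \<tau>. 0 < N \<longrightarrow> 0 < \<tau> \<longrightarrow> \<tau> < 1 \<longrightarrow>
        (\<exists>E \<in> sets (\<Pi>\<^sub>M i\<in>{..<N}. \<pi>). 1 - \<tau> \<le> measure (\<Pi>\<^sub>M i\<in>{..<N}. \<pi>) E \<and>
          (\<forall>z\<in>E. \<forall>x\<in>X. \<bar>deviation \<pi> N z (f x)\<bar> \<le> A * (b + \<Lambda>) * (ln (3 / \<tau>) / sqrt N))))"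
    using uniform_deviation[OF assms(1) False] by (elim exE conjE) rule
  have cost: "continuous_on (X \<times> X) (\<lambda>(x, y). c x y)"
    "\<forall>x\<in>X. \<forall>y\<in>X. c x y = c y x" "\<forall>x\<in>X. \<forall>y\<in>X. 0 \<le> c x y"
    and "\<exists>Lip>0. \<forall>x\<in>X. \<forall>x'\<in>X. \<forall>y\<in>X. \<bar>c x y - c x' y\<bar> \<le> Lip * dist x x'"
    using assms(3) unfolding lipschitz_cost_def by blast+
  then obtain Lip where Lip: "0 < Lip"
    and lip: "\<forall>x\<in>X. \<forall>x'\<in>X. \<forall>y\<in>X. \<bar>c x y - c x' y\<bar> \<le> Lip * dist x x'" by blast
  have "bounded ((\<lambda>(x, y). c x y) ` (X \<times> X))"
    using cost(1) assms(1) by (intro compact_imp_bounded compact_continuous_image compact_Times)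
  then obtain B where B: "0 < B" "\<And>x y. x \<in> X \<Longrightarrow> y \<in> X \<Longrightarrow> c x y \<le> B"
    unfolding bounded_pos by fastforce
  \<comment> \<open>The bound \<open>12 \<eta> / g ^ 8\<close> contains \<open>g\<close> with the exponent \<open>-9\<close>, which is \<open>exp (9 B / \<epsilon>)\<close>; the additional \<open>1\<close>
    accounts for the Lipschitz constant \<open>Lip / \<epsilon>\<close> through \<open>1 / \<epsilon> \<le> exp (1 / \<epsilon>)\<close>.\<close>
  define C where "C = 9 * B + 1"
  define M where "M = 12 * A * (1 + Lip)"
  have M: "0 < M" using A Lip by (simp add: M_def)
  have main: "1 - 4 * \<tau> \<le> measure (\<Pi>\<^sub>M i\<in>{..<N}. \<pi>)
        {z \<in> space (\<Pi>\<^sub>M i\<in>{..<N}. \<pi>).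
           hs_norm \<mu> \<nu> (\<lambda>u y. kernel_op \<mu> (t_B X c \<epsilon> N z) u y - kernel_op \<mu> (t_C X c \<mu> \<nu> \<epsilon> N z) u y)
             \<le> sup_norm_on X (\<lambda>x y. t_B X c \<epsilon> N z x y - t_C X c \<mu> \<nu> \<epsilon> N z x y)
           \<and> sup_norm_on X (\<lambda>x y. t_B X c \<epsilon> N z x y - t_C X c \<mu> \<nu> \<epsilon> N z x y)
             \<le> ennreal (M * (\<epsilon> powr (- (real DIM('a) / 2 + D\<mu> + D\<nu>)) / sqrt (real N)) * exp (C / \<epsilon>) * ln (3 / \<tau>))}"
    if mu: "\<mu> \<in> prob_measures_on X" and nu: "\<nu> \<in> prob_measures_on X"
      and D: "0 < D\<mu>" "0 < D\<nu>" and coup: "is_coupling X \<mu> \<nu> \<pi>"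
      and \<tau>: "0 < \<tau>" "\<tau> < 1" and \<epsilon>: "0 < \<epsilon>" "\<epsilon> \<le> 1" and N: "0 < N"
    for \<mu> \<nu> \<pi> D\<mu> D\<nu> \<tau> \<epsilon> and N :: nat
  proof -
    interpret eot_cost X c B Lip \<epsilon>
      using assms(1) False cost B Lip lip \<epsilon> by unfold_locales auto
    have pi: "prob_space \<pi>" and pi_sets: "sets \<pi> = sets (borel_on X \<Otimes>\<^sub>M borel_on X)"
      and marg: "distr \<pi> (borel_on X) fst = \<mu>" "distr \<pi> (borel_on X) snd = \<nu>"
      using coup by (auto simp: is_coupling_def space_prob_algebra)
    have fs: "fst \<in> measurable \<pi> (borel_on X)" "snd \<in> measurable \<pi> (borel_on X)"
      unfolding measurable_cong_sets[OF pi_sets refl] by simp_all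
    define P where "P = (\<Pi>\<^sub>M i\<in>{..<N}. \<pi>)"
    interpret P: prob_space P unfolding P_def by (intro prob_space_PiM pi)
    have coord: "\<forall>i<N. (\<lambda>z. z i) \<in> measurable P (borel_on X \<Otimes>\<^sub>M borel_on X)"
      unfolding P_def measurable_cong_sets[OF refl pi_sets[symmetric]]
      by (intro allI impI measurable_component_singleton) simp
    note smp = sample_space[OF N coord]
    define l where "l = ln (3 / \<tau>) / sqrt N"
    define \<eta> where "\<eta> = A * (1 / g + Lip / \<epsilon> / g) * l"
    have pos: "0 < 1 / g" "0 < Lip / \<epsilon> / g" using Lip \<epsilon> by simp_all
    have l0: "0 \<le> l" unfolding l_def using \<tau> by (intro divide_nonneg_nonneg ln_ge_zero) (auto simp: pos_le_divide_eq)
    have dev': "\<exists>E \<in> sets P. 1 - \<tau> \<le> P.prob E \<and> (\<forall>z\<in>E. \<forall>x\<in>X. \<bar>deviation \<pi> N z (f x)\<bar> \<le> \<eta>)"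
      if "lipschitz_class X \<pi> f (1 / g) (Lip / \<epsilon> / g)" for f
      using dev pi that pos N \<tau> unfolding P_def l_def \<eta>_def by blast
    obtain E1 where E1: "E1 \<in> sets P" "1 - \<tau> \<le> P.prob E1"
      and close1: "\<forall>z\<in>E1. \<forall>x\<in>X. \<bar>deviation \<pi> N z (\<lambda>\<omega>. G x (fst \<omega>) * scaling_of \<mu> (fst \<omega>))\<bar> \<le> \<eta>"
      using dev'[OF lipschitz_class_gibbs_op[OF fs(1) mu scaling_of[OF mu]]] by blast
    obtain E2 where E2: "E2 \<in> sets P" "1 - \<tau> \<le> P.prob E2"
      and close2: "\<forall>z\<in>E2. \<forall>x\<in>X. \<bar>deviation \<pi> N z (\<lambda>\<omega>. G x (snd \<omega>) * scaling_of \<nu> (snd \<omega>))\<bar> \<le> \<eta>"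
      using dev'[OF lipschitz_class_gibbs_op[OF fs(2) nu scaling_of[OF nu]]] by blast
    define R where "R = M * (\<epsilon> powr (- (real DIM('a) / 2 + D\<mu> + D\<nu>)) / sqrt (real N)) * exp (C / \<epsilon>) * ln (3 / \<tau>)"
    have bound: "12 * \<eta> / g ^ 8 \<le> R"
    proof -
      have "1 / \<epsilon> \<le> exp (1 / \<epsilon>)" using exp_ge_add_one_self[of "1 / \<epsilon>"] by linarith
      moreover have "1 \<le> 1 / \<epsilon>" using \<epsilon> by simp
      ultimately have e: "1 + Lip / \<epsilon> \<le> (1 + Lip) * exp (1 / \<epsilon>)"
        using mult_left_mono[of "1 / \<epsilon>" "exp (1 / \<epsilon>)" Lip] Lip by (simp add: algebra_simps)
      have "1 / g + Lip / \<epsilon> / g = (1 + Lip / \<epsilon>) / g" by (rule add_divide_distrib[symmetric])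
      then have "12 * \<eta> / g ^ 8 = 12 * A * l * (1 + Lip / \<epsilon>) * (1 / (g * g ^ 8))"
        by (simp only: \<eta>_def) (simp add: ac_simps)
      also have "g * g ^ 8 = g ^ 9" by (simp only: power_Suc[symmetric]) simp
      also have "1 / g ^ 9 = exp (9 * B / \<epsilon>)"
      proof -
        have "g ^ 9 = exp (- (9 * B / \<epsilon>))" by (simp add: exp_of_nat_mult[symmetric])
        then show ?thesis by (simp only: exp_minus inverse_eq_divide) simp
      qed
      also have "12 * A * l * (1 + Lip / \<epsilon>) * exp (9 * B / \<epsilon>)
          \<le> 12 * A * l * ((1 + Lip) * exp (1 / \<epsilon>)) * exp (9 * B / \<epsilon>)"
        using A l0 e by (intro mult_right_mono mult_left_mono) auto
      also have "\<dots> = M * l * (exp (1 / \<epsilon>) * exp (9 * B / \<epsilon>))" by (simp add: M_def)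
      also have "exp (1 / \<epsilon>) * exp (9 * B / \<epsilon>) = exp (C / \<epsilon>)"
        by (simp add: exp_add[symmetric] C_def add_divide_distrib)
      also have "M * l * exp (C / \<epsilon>) = 1 * (M * l * exp (C / \<epsilon>))" by simp
      also have "\<dots> \<le> \<epsilon> powr (- (real DIM('a) / 2 + D\<mu> + D\<nu>)) * (M * l * exp (C / \<epsilon>))"
      proof (rule mult_right_mono)
        have "1 \<le> 1 / \<epsilon> powr (real DIM('a) / 2 + D\<mu> + D\<nu>)"
          using \<epsilon> D powr_le1[of "real DIM('a) / 2 + D\<mu> + D\<nu>" \<epsilon>] by (simp add: pos_le_divide_eq)
        then show "1 \<le> \<epsilon> powr (- (real DIM('a) / 2 + D\<mu> + D\<nu>))"
          by (simp only: powr_minus inverse_eq_divide)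
      qed (use M l0 in simp)
      also have "\<dots> = R" by (simp add: R_def l_def)
      finally show ?thesis .
    qed
    have "0 \<le> \<eta>" unfolding \<eta>_def using A pos l0 by (intro mult_nonneg_nonneg) auto
    then have R0: "0 \<le> R" using bound by (smt (verit) divide_nonneg_pos g_pos zero_less_power)
    let ?F = "\<lambda>z x y. t_B X c \<epsilon> N z x y - t_C X c \<mu> \<nu> \<epsilon> N z x y"
    define Q where "Q = {z \<in> space P. sup_norm_on X (?F z) \<le> ennreal R}"
    have cont: "continuous_on (X \<times> X) (\<lambda>p. t_B X c \<epsilon> N z (fst p) (snd p))"
      "continuous_on (X \<times> X) (\<lambda>p. t_C X c \<mu> \<nu> \<epsilon> N z (fst p) (snd p))" if "z \<in> space P" for z
      by (intro t_B_continuous[OF N smp[OF that]] t_C_continuous[OF mu nu smp[OF that]])+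
    have Q_sets: "Q \<in> sets P"
      unfolding Q_def
    proof (rule sup_norm_event_measurable[OF assms(1) R0])
      show "continuous_on (X \<times> X) (\<lambda>p. ?F z (fst p) (snd p))" if "z \<in> space P" for z
        by (intro continuous_on_diff cont that)
      show "(\<lambda>z. ?F z x y) \<in> borel_measurable P" if "x \<in> X" "y \<in> X" for x y
        by (intro borel_measurable_diff t_B_measurable[OF N coord that] t_C_measurable[OF N coord mu nu that])
    qed
    have sub: "E1 \<inter> E2 \<subseteq> Q"
    proof
      fix z assume z: "z \<in> E1 \<inter> E2"
      then have zP: "z \<in> space P" using sets.sets_into_space[OF E1(1)] by blast
      note zX = smp[OF zP]
      have d1: "\<forall>x\<in>X. \<bar>gibbs_op (empirical_on X N (\<lambda>i. fst (z i))) (scaling_of \<mu>) x - gibbs_op \<mu> (scaling_of \<mu>) x\<bar> \<le> \<eta>"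
      proof
        fix x assume x: "x \<in> X"
        have "\<bar>deviation \<pi> N z (\<lambda>\<omega>. G x (fst \<omega>) * scaling_of \<mu> (fst \<omega>))\<bar> \<le> \<eta>"
          using close1 z x by blast
        then show "\<bar>gibbs_op (empirical_on X N (\<lambda>i. fst (z i))) (scaling_of \<mu>) x - gibbs_op \<mu> (scaling_of \<mu>) x\<bar> \<le> \<eta>"
          unfolding deviation_gibbs_op[OF fs(1) Pi_Times_coords(1)[OF zX] scaling_continuous[OF scaling_of[OF mu]] x] marg .
      qed
      have d2: "\<forall>x\<in>X. \<bar>gibbs_op (empirical_on X N (\<lambda>i. snd (z i))) (scaling_of \<nu>) x - gibbs_op \<nu> (scaling_of \<nu>) x\<bar> \<le> \<eta>"
      proof
        fix x assume x: "x \<in> X"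
        have "\<bar>deviation \<pi> N z (\<lambda>\<omega>. G x (snd \<omega>) * scaling_of \<nu> (snd \<omega>))\<bar> \<le> \<eta>"
          using close2 z x by blast
        then show "\<bar>gibbs_op (empirical_on X N (\<lambda>i. snd (z i))) (scaling_of \<nu>) x - gibbs_op \<nu> (scaling_of \<nu>) x\<bar> \<le> \<eta>"
          unfolding deviation_gibbs_op[OF fs(2) Pi_Times_coords(2)[OF zX] scaling_continuous[OF scaling_of[OF nu]] x] marg .
      qed
      have "\<bar>?F z x y\<bar> \<le> R" if "x \<in> X" "y \<in> X" for x y
        using t_B_t_C_close[OF N zX mu nu d1 d2 that] bound by linarith
      then show "z \<in> Q" unfolding Q_def using zP sup_norm_on_le_iff[OF R0] by blast
    qed
    have "P.prob (space P - E1 \<inter> E2) \<le> P.prob (space P - E1) + P.prob (space P - E2)"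
      unfolding Diff_Int using E1 E2 by (intro measure_Un_le sets.compl_sets)
    also have "\<dots> \<le> \<tau> + \<tau>"
      using E1(2) E2(2) P.prob_compl[OF E1(1)] P.prob_compl[OF E2(1)] by linarith
    finally have "1 - 2 * \<tau> \<le> P.prob (E1 \<inter> E2)"
      using P.prob_compl[OF sets.Int[OF E1(1) E2(1)]] by linarith
    also have "\<dots> \<le> P.prob Q" by (rule P.finite_measure_mono[OF sub Q_sets])
    also have "Q = {z \<in> space P.
           hs_norm \<mu> \<nu> (\<lambda>u y. kernel_op \<mu> (t_B X c \<epsilon> N z) u y - kernel_op \<mu> (t_C X c \<mu> \<nu> \<epsilon> N z) u y)
             \<le> sup_norm_on X (?F z) \<and> sup_norm_on X (?F z) \<le> ennreal R}"
      unfolding Q_def using hs_norm_kernel_diff_le_sup[OF mu nu assms(1) cont] by blast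
    finally have "1 - 2 * \<tau> \<le> P.prob {z \<in> space P.
           hs_norm \<mu> \<nu> (\<lambda>u y. kernel_op \<mu> (t_B X c \<epsilon> N z) u y - kernel_op \<mu> (t_C X c \<mu> \<nu> \<epsilon> N z) u y)
             \<le> sup_norm_on X (?F z) \<and> sup_norm_on X (?F z) \<le> ennreal R}" .
    then show ?thesis using \<tau> unfolding P_def R_def by linarith
  qed
  have "0 < C" using B by (simp add: C_def)
  show ?thesis
  proof (rule exI[of _ 1], rule exI[of _ C], rule exI[of _ 1], intro conjI allI impI)
    fix \<mu> \<nu> \<pi> C\<mu> D\<mu> \<delta>\<mu> C\<nu> D\<nu> \<delta>\<nu>
    assume "\<mu> \<in> prob_measures_on X" "\<nu> \<in> prob_measures_on X"
      "ball_mass \<mu> C\<mu> D\<mu> \<delta>\<mu>" "ball_mass \<nu> C\<nu> D\<nu> \<delta>\<nu>" "is_coupling X \<mu> \<nu> \<pi>"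
    then show "\<exists>M>0. \<forall>(\<tau>::real) (\<epsilon>::real) (N::nat).
          0 < \<tau> \<longrightarrow> \<tau> < 1 \<longrightarrow> 0 < \<epsilon> \<longrightarrow> \<epsilon> \<le> 1 \<longrightarrow> N > 0 \<longrightarrow>
          ln (3 / \<tau>) / (\<epsilon> powr (real DIM('a) / 2) * sqrt (real N)) * (4 * 1 * exp (C / \<epsilon>) + 2 * sqrt 1) \<le> 1 \<longrightarrow>
          measure (\<Pi>\<^sub>M i\<in>{..<N}. \<pi>)
            {z \<in> space (\<Pi>\<^sub>M i\<in>{..<N}. \<pi>).
               hs_norm \<mu> \<nu> (\<lambda>u y. kernel_op \<mu> (t_B X c \<epsilon> N z) u y
                                     - kernel_op \<mu> (t_C X c \<mu> \<nu> \<epsilon> N z) u y)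
                 \<le> sup_norm_on X (\<lambda>x y. t_B X c \<epsilon> N z x y - t_C X c \<mu> \<nu> \<epsilon> N z x y)
               \<and> sup_norm_on X (\<lambda>x y. t_B X c \<epsilon> N z x y - t_C X c \<mu> \<nu> \<epsilon> N z x y)
                 \<le> ennreal (M * (\<epsilon> powr (- (real DIM('a) / 2 + D\<mu> + D\<nu>)) / sqrt (real N))
                              * exp (C / \<epsilon>) * ln (3 / \<tau>))}
          \<ge> 1 - 4 * \<tau>"
      using M by (intro exI[of _ M] conjI allI impI main) (auto simp: ball_mass_def)
  qed (use \<open>0 < C\<close> in simp_all)
qed

end
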